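(* There exists a fundamental domain for the action of $\mathrm{O}_{\mathcal A}(\mathbb{Z})$ on $\mathrm{O}_{\mathcal A}(\mathbb{R})$ (by left multiplication) that is box-shaped at infinity.
   Context: Fix $n\ge3$; $\mathcal{A}$ is the $n\times n$ anti-diagonal matrix with all anti-diagonal entries $1$, and $\mathrm{O}_{\mathcal A}(R)=\{g\in\mathrm{GL}_n(R):g^t\mathcal{A}g=\mathcal{A}\}$. Iwasawa decomposition: $\mathrm{O}_{\mathcal A}(\mathbb{R})=N(\mathbb{R})TK$, where $N$ is the group of lower-triangular unipotent matrices in $\mathrm{O}_{\mathcal A}$, $T$ is the group of diagonal matrices with positive entries in $\mathrm{O}_{\mathcal A}(\mathbb{R})$, and $K$ is a maximal compact subgroup. Elements of $T$ are $\mathrm{diag}(t_1,\dots,t_n)$ with $t_it_{n+1-i}=1$; coordinates $s=(s_1,\dots,s_{\lfloor n/2\rfloor})$, $s_i>0$, on $T$ are defined by: for $n$ odd, $(t_1,\dots,t_{\lfloor n/2\rfloor})=(\prod_{i=1}^{\lfloor n/2\rfloor}s_i^{-1},\prod_{i=2}^{\lfloor n/2\rfloor}s_i^{-1},\dots,s_{\lfloor n/2\rfloor}^{-1})$; for $n$ even, with $\mathfrak{s}=\sqrt{s_{\frac{n-2}{2}}s_{\frac n2}}$, $(t_1,\dots,t_{n/2})=(\mathfrak{s}^{-1}\prod_{i=1}^{\frac{n-4}{2}}s_i^{-1},\mathfrak{s}^{-1}\prod_{i=2}^{\frac{n-4}{2}}s_i^{-1},\dots,\mathfrak{s}^{-1}s_{\frac{n-4}{2}}^{-1},\mathfrak{s}^{-1},\mathfrak{s}^{-1}s_{\frac{n-2}{2}})$.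 For $c>0$ let $T_c=\{s\in T:s_i>c\text{ for all }i\}$. A generalized Siegel set here is a set of the form $\mathcal{N}'T_cK'$ with $\mathcal{N}'\subset N(\mathbb{R})$ compact, $c>0$, $K'\subset K$. A fundamental domain $\mathcal{F}$ is box-shaped at infinity if there are nested generalized Siegel sets $\mathcal{S}_1\subset\mathcal{F}\subset\mathcal{S}_2$ such that: (a) there is an open subset $\mathcal{U}_1\subset\mathcal{S}_1$ of full measure such that every $\mathrm{O}_{\mathcal A}(\mathbb{Z})$-orbit on $\mathrm{O}_{\mathcal A}(\mathbb{R})$ meets $\mathcal{U}_1$ at most once; (b) every $\mathrm{O}_{\mathcal A}(\mathbb{Z})$-orbit on $\mathrm{O}_{\mathcal A}(\mathbb{R})$ meets $\mathcal{S}_2$ at least once; (c) for some $c>0$, $\mathcal{S}_1\cap N(\mathbb{R})T_cK=\mathcal{S}_2\cap N(\mathbb{R})T_cK$. *)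

theory Defs
  imports "HOL-Analysis.Analysis"
begin

type_synonym ('a, 'n) sqmat = "'a ^ 'n ^ 'n"

text \<open>Matrices are indexed by a finite linear order; \<open>pos i\<close> is the 1-based position of the index \<open>i\<close>,
  so that \<open>pos\<close> is the increasing bijection onto \<open>{1..n}\<close>, where \<open>n = CARD('n)\<close>.\<close>

definition pos :: "'n::{finite,linorder} \<Rightarrow> nat" where
  "pos i = card {..i}"

lemma pos_less_iff: "pos i < pos j \<longleftrightarrow> i < (j::'n::{finite,linorder})"
proof -
  have *: "pos a < pos b" if "a < b" for a b :: 'n
    unfolding pos_def using that by (intro psubset_card_mono) auto
  show ?thesis
    using *[of i j] *[of j i] by (metis less_asym less_irrefl linorder_less_linear)
qed

lemma bij_betw_pos: "bij_betw pos (UNIV :: 'n::{finite,linorder} set) {1..CARD('n)}"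
proof -
  have inj: "inj (pos :: 'n \<Rightarrow> nat)"
    by (rule injI) (metis pos_less_iff less_irrefl linorder_less_linear)
  have "pos i \<in> {1..CARD('n)}" for i :: 'n
    by (auto simp: pos_def Suc_le_eq card_gt_0_iff intro: card_mono)
  then have "range (pos :: 'n \<Rightarrow> nat) \<subseteq> {1..CARD('n)}" by blast
  moreover have "card (range (pos :: 'n \<Rightarrow> nat)) = card {1..CARD('n)}"
    using inj by (simp add: card_image)
  ultimately show ?thesis
    using inj by (simp add: bij_betw_def card_subset_eq)
qed

definition antidiag :: "('a::{zero,one}, 'n::{finite,linorder}) sqmat" where
  "antidiag = (\<chi> i j. if pos i + pos j = CARD('n) + 1 then 1 else 0)"

definition OA :: "(('a::comm_ring_1, 'n::{finite,linorder}) sqmat) set" where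
  "OA = {g. invertible g \<and> transpose g ** antidiag ** g = antidiag}"

definition lmult :: "(int, 'n::{finite,linorder}) sqmat \<Rightarrow> (real, 'n) sqmat \<Rightarrow> (real, 'n) sqmat" where
  "lmult \<gamma> g = map_matrix of_int \<gamma> ** g"

definition orbit :: "(real, 'n::{finite,linorder}) sqmat \<Rightarrow> (real, 'n) sqmat set" where
  "orbit g = (\<lambda>\<gamma>. lmult \<gamma> g) ` OA"


definition N_grp :: "(real, 'n::{finite,linorder}) sqmat set" where
  "N_grp = {g \<in> OA. (\<forall>i. g $ i $ i = 1) \<and> (\<forall>i j. i < j \<longrightarrow> g $ i $ j = 0)}"

definition T_grp :: "(real, 'n::{finite,linorder}) sqmat set" where
  "T_grp = {g \<in> OA. (\<forall>i. g $ i $ i > 0) \<and> (\<forall>i j. i \<noteq> j \<longrightarrow> g $ i $ j = 0)}"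

definition compact_subgroup :: "(real, 'n::{finite,linorder}) sqmat set \<Rightarrow> bool" where
  "compact_subgroup K \<longleftrightarrow> K \<subseteq> OA \<and> compact K \<and> mat 1 \<in> K \<and>
     (\<forall>g\<in>K. \<forall>h\<in>K. g ** h \<in> K) \<and> (\<forall>g\<in>K. matrix_inv g \<in> K)"

definition maximal_compact_subgroup :: "(real, 'n::{finite,linorder}) sqmat set \<Rightarrow> bool" where
  "maximal_compact_subgroup K \<longleftrightarrow>
     compact_subgroup K \<and> (\<forall>L. compact_subgroup L \<and> K \<subseteq> L \<longrightarrow> L = K)"

text \<open>\<open>torus_coord n s j\<close> is the diagonal entry \<open>t\<^sub>j\<close>, for \<open>1 \<le> j \<le> n div 2\<close>, of the torus element with
  coordinates \<open>s\<^sub>1, \<dots>, s\<^sub>m\<close>, \<open>m = n div 2\<close>. The remaining entries are determined by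
  \<open>t\<^sub>i t\<^sub>j = 1\<close> for \<open>i + j = n + 1\<close>, which together with positivity forces the middle entry
  to be 1 when \<open>n\<close> is odd. For even \<open>n\<close> one has \<open>(n - 2) / 2 = m - 1\<close> and \<open>(n - 4) / 2 = m - 2\<close>.\<close>

definition torus_coord :: "nat \<Rightarrow> (nat \<Rightarrow> real) \<Rightarrow> nat \<Rightarrow> real" where
  "torus_coord n s j =
     (let m = n div 2 in
      if odd n then (\<Prod>i=j..m. inverse (s i))
      else let r = sqrt (s (m - 1) * s m) in
        if j = m then inverse r * s (m - 1)
        else inverse r * (\<Prod>i=j..m - 2. inverse (s i)))"

definition T_above :: "real \<Rightarrow> (real, 'n::{finite,linorder}) sqmat set" where
  "T_above c = {t \<in> T_grp. \<exists>s. (\<forall>i\<in>{1..CARD('n) div 2}. s i > 0 \<and> s i > c) \<and>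
     (\<forall>i. pos i \<le> CARD('n) div 2 \<longrightarrow> t $ i $ i = torus_coord CARD('n) s (pos i))}"

definition siegel :: "(real, 'n::{finite,linorder}) sqmat set \<Rightarrow> real \<Rightarrow> (real, 'n) sqmat set \<Rightarrow>
    (real, 'n) sqmat set" where
  "siegel N' c K' = {u ** t ** k | u t k. u \<in> N' \<and> t \<in> T_above c \<and> k \<in> K'}"

definition generalized_siegel_set :: "(real, 'n::{finite,linorder}) sqmat set \<Rightarrow>
    (real, 'n) sqmat set \<Rightarrow> bool" where
  "generalized_siegel_set K S \<longleftrightarrow>
     (\<exists>N' c K'. N' \<subseteq> N_grp \<and> compact N' \<and> c > 0 \<and> K' \<subseteq> K \<and> S = siegel N' c K')"

text \<open>Haar measures on the real group, as Borel measures. Regularity is automatic, since the group is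
  locally compact and second countable.\<close>

definition haar_measure :: "(real, 'n::{finite,linorder}) sqmat measure \<Rightarrow> bool" where
  "haar_measure \<mu> \<longleftrightarrow>
     space \<mu> = OA \<and> sets \<mu> = sets (restrict_space borel OA) \<and>
     emeasure \<mu> OA \<noteq> 0 \<and>
     (\<forall>C. C \<subseteq> OA \<and> compact C \<longrightarrow> emeasure \<mu> C < \<infinity>) \<and>
     (\<forall>g\<in>OA. \<forall>B\<in>sets \<mu>. emeasure \<mu> ((\<lambda>x. g ** x) ` B) = emeasure \<mu> B)"

text \<open>A fundamental domain in the measure-theoretic sense: the translates cover the group and overlap
  in null sets. A strict set of orbit representatives cannot be box-shaped at infinity, because
  the unipotent parts of the Siegel sets below are compact.\<close>

definition fundamental_domain :: "(real, 'n::{finite,linorder}) sqmat measure \<Rightarrow>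
    (real, 'n) sqmat set \<Rightarrow> bool" where
  "fundamental_domain \<mu> F \<longleftrightarrow>
     F \<subseteq> OA \<and> F \<in> sets \<mu> \<and>
     (\<forall>g\<in>OA. orbit g \<inter> F \<noteq> {}) \<and>
     (\<forall>\<gamma>\<in>OA. \<gamma> \<noteq> mat 1 \<longrightarrow> lmult \<gamma> ` F \<inter> F \<in> null_sets \<mu>)"

text \<open>Full measure of \<open>U1\<close> in \<open>S1\<close> is phrased with \<open>AE\<close>, i.e. \<open>S1 - U1\<close> is contained in a null set:
  generalized Siegel sets need not be Borel, the compact part being an arbitrary subset of \<open>K\<close>.\<close>

definition box_shaped_at_infinity :: "(real, 'n::{finite,linorder}) sqmat measure \<Rightarrow> (real, 'n) sqmat set \<Rightarrow>
    (real, 'n) sqmat set \<Rightarrow> bool" where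
  "box_shaped_at_infinity \<mu> K F \<longleftrightarrow>
     (\<exists>S1 S2. generalized_siegel_set K S1 \<and> generalized_siegel_set K S2 \<and> S1 \<subseteq> F \<and> F \<subseteq> S2 \<and>
        (\<exists>U1. U1 \<subseteq> S1 \<and> openin (top_of_set OA) U1 \<and> (AE x in \<mu>. x \<in> S1 \<longrightarrow> x \<in> U1) \<and>
           (\<forall>g\<in>OA. \<forall>x\<in>orbit g \<inter> U1. \<forall>y\<in>orbit g \<inter> U1. x = y)) \<and>
        (\<forall>g\<in>OA. orbit g \<inter> S2 \<noteq> {}) \<and>
        (\<exists>c>0. S1 \<inter> siegel N_grp c K = S2 \<inter> siegel N_grp c K))"

end

theory Submission
  imports Defs
begin

text \<open>Every maximal compact subgroup is conjugate to the standard one by a lower triangular matrix, so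
  that \<open>O\<^sub>A(\<real>) = N T K\<close> is a product with continuous coordinates. If \<open>c\<^sub>1\<close> is large, then an integral \<open>\<gamma>\<close> that
  maps some point of \<open>N T K\<close> with \<open>T\<close>-coordinates above \<open>c\<^sub>1\<close> to another one is the product of an element of \<open>N(\<int>)\<close>
  and an element of the finite group \<open>W\<close> of integral monomial matrices that commute with \<open>T\<close> up to a swap
  of the two middle coordinates; this follows by comparing the lengths of the orthogonalised rows.
  Conversely, a point of an orbit at which the sequence of these lengths is lexicographically minimal has
  \<open>T\<close>-coordinates above a small \<open>c\<^sub>2\<close>, as in the reduction of binary forms. Since \<open>N(\<int>)\<close> acts on the coordinate
  in \<open>N\<close> and \<open>W\<close> on the one in \<open>K\<close>, both Siegel sets can be built from the same compact tiles for these two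
  actions, and differ only in the bound on \<open>T\<close>. Between them, a fundamental domain arises by a Borel choice
  of orbit representatives. The frontiers of the tiles are null for any Haar measure because the tiles are
  made of balls of generic radius: only countably many level sets of a function have positive measure.\<close>

section \<open>The orthogonal group of the form\<close>

text \<open>For even \<open>n\<close> the conditions on \<open>T\<close> bound both middle entries
  from below by the entry before them, but not by each other. So an integral matrix that keeps the
  \<open>T\<close>-coordinates large is lower triangular only up to the two middle indices; this is
  why triangularity, the group \<open>W\<close> and the simple pairs are phrased through the
  relation \<open>near\<close>. The loss is harmless: an integral isometry of a hyperbolic plane is
  a signed permutation, and a real one that is unipotent is trivial, so \<open>W\<close> consists of
  orthogonal matrices and normalises \<open>N T\<close>. Freeness near the cusp has to be read off
  in a fixed order. Left multiplication by \<open>N(\<int>)\<close> leaves the compact coordinate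
  alone, whereas \<open>W\<close> changes the coordinate in \<open>N\<close> by conjugation; so the
  factor in \<open>W\<close> is detected on \<open>K\<close> first, and the factor in
  \<open>N(\<int>)\<close> on \<open>N\<close> afterwards. Moving a point into the larger Siegel set
  follows the same order. As \<open>W\<close> always contains \<open>-1\<close>, the compact factor
  of the smaller Siegel set must be a tile rather than all of \<open>K\<close>.\<close>

definition opp :: "'n::{finite,linorder} \<Rightarrow> 'n" where
  "opp i = inv_into UNIV pos (CARD('n) + 1 - pos i)"

lemma pos_range: "1 \<le> pos (i::'n::{finite,linorder})" "pos i \<le> CARD('n)"
  using bij_betw_pos by (fastforce simp: bij_betw_def)+

lemma pos_inj: "pos i = pos j \<longleftrightarrow> i = (j::'n::{finite,linorder})"
  using bij_betw_pos[where 'n='n] by (auto simp: bij_betw_def inj_on_def)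

lemma pos_le_iff: "pos i \<le> pos j \<longleftrightarrow> i \<le> (j::'n::{finite,linorder})"
  by (meson not_less pos_less_iff)

lemma pos_surj: "1 \<le> k \<Longrightarrow> k \<le> CARD('n) \<Longrightarrow> \<exists>i::'n::{finite,linorder}. pos i = k"
  using bij_betw_pos[where 'n='n] by (metis atLeastAtMost_iff bij_betw_def imageE)

lemma pos_opp: "pos (opp (i::'n::{finite,linorder})) = CARD('n) + 1 - pos i"
proof -
  have "1 \<le> CARD('n) + 1 - pos i" "CARD('n) + 1 - pos i \<le> CARD('n)"
    using pos_range[of i] by linarith+
  then have "CARD('n) + 1 - pos i \<in> range (pos :: 'n \<Rightarrow> nat)"
    using pos_surj by (metis rangeI)
  then show ?thesis unfolding opp_def by (rule f_inv_into_f)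
qed

lemma pos_opp_add: "pos i + pos (opp (i::'n::{finite,linorder})) = CARD('n) + 1"
  using pos_range[of i] by (simp add: pos_opp)

lemma opp_eq_iff: "pos i + pos j = CARD('n) + 1 \<longleftrightarrow> j = opp (i::'n::{finite,linorder})"
  using pos_opp_add[of i] pos_inj by (metis add_left_cancel)

lemma opp_opp [simp]: "opp (opp i) = (i::'n::{finite,linorder})"
  by (metis opp_eq_iff add.commute)

lemma opp_inj [simp]: "opp i = opp j \<longleftrightarrow> i = (j::'n::{finite,linorder})"
  by (metis opp_opp)

lemma opp_less [simp]: "opp i < opp j \<longleftrightarrow> j < (i::'n::{finite,linorder})"
  using pos_opp_add[of i] pos_opp_add[of j]
  unfolding pos_less_iff[symmetric] by linarith

lemma opp_le [simp]: "opp i \<le> opp j \<longleftrightarrow> j \<le> (i::'n::{finite,linorder})"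
  by (metis opp_less not_le)

lemma bij_opp: "bij (opp :: 'n::{finite,linorder} \<Rightarrow> 'n)"
  by (rule o_bij[where g=opp]) auto

lemma sum_opp: "(\<Sum>l\<in>UNIV. f (opp l)) = (\<Sum>l\<in>UNIV. f (l::'n::{finite,linorder}))"
  using sum.reindex_bij_betw[OF bij_opp, of f] .

lemma antidiag_nth: "antidiag $ i $ j = (if j = opp i then 1 else 0)"
  unfolding antidiag_def opp_eq_iff by simp

lemma antidiag_mult: "(antidiag ** (M :: ('a::comm_ring_1, 'n::{finite,linorder}) sqmat)) $ i $ j = M $ opp i $ j"
  by (simp add: matrix_matrix_mult_def antidiag_nth if_distrib[of "\<lambda>x. x * _"] cong: if_cong)

lemma mult_antidiag: "((M :: ('a::comm_ring_1, 'n::{finite,linorder}) sqmat) ** antidiag) $ i $ j = M $ i $ opp j"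
proof -
  have "j = opp k \<longleftrightarrow> k = opp j" for k by (metis opp_opp)
  then show ?thesis
    by (simp add: matrix_matrix_mult_def antidiag_nth if_distrib[of "\<lambda>x. _ * x"] cong: if_cong)
qed

lemma antidiag_sq: "antidiag ** antidiag = (mat 1 :: ('a::comm_ring_1, 'n::{finite,linorder}) sqmat)"
  by (auto simp: vec_eq_iff antidiag_mult antidiag_nth mat_def)

lemma transpose_antidiag: "transpose antidiag = (antidiag :: ('a::comm_ring_1, 'n::{finite,linorder}) sqmat)"
  by (auto simp: vec_eq_iff antidiag_nth transpose_def)

lemma form_nth:
  fixes g h :: "('a::comm_ring_1, 'n::{finite,linorder}) sqmat"
  shows "(transpose g ** antidiag ** h) $ i $ j = (\<Sum>l\<in>UNIV. g $ l $ i * h $ opp l $ j)"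
proof -
  have "(transpose g ** antidiag ** h) $ i $ j = (transpose g ** (antidiag ** h)) $ i $ j"
    by (simp add: matrix_mul_assoc)
  also have "\<dots> = (\<Sum>l\<in>UNIV. g $ l $ i * h $ opp l $ j)"
    unfolding matrix_matrix_mult_def[of "transpose g"] by (simp add: antidiag_mult transpose_def)
  finally show ?thesis .
qed

text \<open>The adjoint with respect to the form: reflection of the matrix in its anti-diagonal. On
  \<open>OA\<close> it is the inverse, over any commutative ring, so inverses visibly stay integral
  and lower triangular.\<close>

definition adj :: "('a::comm_ring_1, 'n::{finite,linorder}) sqmat \<Rightarrow> ('a, 'n) sqmat" where
  "adj g = antidiag ** transpose g ** antidiag"

lemma adj_nth: "adj g $ i $ j = g $ opp j $ opp i"
  by (simp add: adj_def mult_antidiag antidiag_mult transpose_def)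

lemma adj_adj [simp]: "adj (adj g) = g"
  by (simp add: vec_eq_iff adj_nth)

lemma adj_mult: "adj (g ** h) = adj h ** adj g"
proof -
  have "adj h ** adj g = antidiag ** transpose h ** (antidiag ** antidiag) ** transpose g ** antidiag"
    by (simp add: adj_def matrix_mul_assoc)
  then show ?thesis
    by (simp add: antidiag_sq adj_def matrix_transpose_mul matrix_mul_assoc)
qed

lemma adj_one [simp]: "adj (mat 1) = mat 1"
  by (simp add: adj_def antidiag_sq)

lemma form_iff_adj: "transpose g ** antidiag ** g = antidiag \<longleftrightarrow> adj g ** g = mat 1"
proof
  assume "transpose g ** antidiag ** g = antidiag"
  then have "antidiag ** (transpose g ** antidiag ** g) = antidiag ** antidiag" by simp
  then show "adj g ** g = mat 1"
    by (simp add: adj_def matrix_mul_assoc antidiag_sq)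
next
  assume "adj g ** g = mat 1"
  then have "antidiag ** (adj g ** g) = antidiag" by simp
  moreover have "antidiag ** (adj g ** g) = (antidiag ** antidiag) ** transpose g ** antidiag ** g"
    by (simp add: adj_def matrix_mul_assoc)
  ultimately show "transpose g ** antidiag ** g = antidiag"
    by (simp add: antidiag_sq)
qed

lemma OA_adj: "g \<in> OA \<longleftrightarrow> adj g ** g = mat 1 \<and> g ** adj g = mat 1"
proof
  assume "g \<in> OA"
  then obtain g' where g': "g ** g' = mat 1" "adj g ** g = mat 1"
    by (auto simp: OA_def form_iff_adj invertible_def)
  have "adj g ** (g ** g') = g'" unfolding matrix_mul_assoc g'(2) by simp
  then have "g' = adj g" unfolding g'(1) by simp
  then show "adj g ** g = mat 1 \<and> g ** adj g = mat 1" using g' by simp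
next
  assume "adj g ** g = mat 1 \<and> g ** adj g = mat 1"
  then show "g \<in> OA" unfolding OA_def form_iff_adj invertible_def by auto
qed

lemma OA_D:
  assumes "g \<in> OA" shows "adj g ** g = mat 1" "g ** adj g = mat 1"
  using assms by (auto simp: OA_adj)

lemma OA_mult: "g \<in> OA \<Longrightarrow> h \<in> OA \<Longrightarrow> g ** h \<in> OA"
proof -
  assume "g \<in> OA" "h \<in> OA"
  then have *: "adj g ** g = mat 1" "g ** adj g = mat 1" "adj h ** h = mat 1" "h ** adj h = mat 1"
    by (auto simp: OA_adj)
  have "adj (g ** h) ** (g ** h) = adj h ** (adj g ** g) ** h"
    by (simp add: adj_mult matrix_mul_assoc)
  moreover have "(g ** h) ** adj (g ** h) = g ** (h ** adj h) ** adj g"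
    by (simp add: adj_mult matrix_mul_assoc)
  ultimately show "g ** h \<in> OA" using * by (simp add: OA_adj)
qed

lemma OA_adj_closed [simp]: "adj g \<in> OA \<longleftrightarrow> g \<in> OA"
  by (auto simp: OA_adj)

lemma OA_one [simp]: "mat 1 \<in> OA"
  by (simp add: OA_adj)

lemma OA_real: "g \<in> OA \<longleftrightarrow> adj g ** g = mat 1" for g :: "('a::field, 'n::{finite,linorder}) sqmat"
  by (metis OA_adj matrix_left_right_inverse)

lemma OA_antidiag: "antidiag \<in> (OA :: ('a::comm_ring_1, 'n::{finite,linorder}) sqmat set)"
  by (simp add: OA_adj adj_def transpose_antidiag antidiag_sq)

lemma OA_transpose: "g \<in> OA \<Longrightarrow> transpose g \<in> OA"
proof -
  assume "g \<in> OA"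
  moreover have "transpose g = antidiag ** adj g ** antidiag"
    by (simp add: vec_eq_iff adj_nth mult_antidiag antidiag_mult transpose_def)
  ultimately show ?thesis by (simp add: OA_mult OA_antidiag)
qed

lemma OA_cancel_left: "g \<in> OA \<Longrightarrow> adj g ** (g ** x) = x" "g \<in> OA \<Longrightarrow> g ** (adj g ** x) = x"
  by (simp_all add: matrix_mul_assoc OA_adj)

lemma OA_cancel_right: "g \<in> OA \<Longrightarrow> x ** g ** adj g = x" "g \<in> OA \<Longrightarrow> x ** adj g ** g = x"
  by (simp_all add: matrix_mul_assoc[symmetric] OA_D)

lemma matrix_inv_OA: "g \<in> OA \<Longrightarrow> matrix_inv g = adj g"
  unfolding matrix_inv_def
  by (rule some_equality) (auto simp: OA_D, metis OA_cancel_left(1) matrix_mul_rid)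

section \<open>Integral matrices and their action\<close>

abbreviation emb :: "(int, 'n::{finite,linorder}) sqmat \<Rightarrow> (real, 'n) sqmat" where
  "emb \<equiv> map_matrix of_int"

lemma emb_mult: "emb (g ** h) = emb g ** emb h"
  by (simp add: vec_eq_iff matrix_matrix_mult_def map_matrix_def)

lemma emb_one [simp]: "emb (mat 1) = mat 1"
  by (simp add: vec_eq_iff mat_def map_matrix_def)

lemma emb_adj: "emb (adj g) = adj (emb g)"
  by (simp add: vec_eq_iff adj_nth map_matrix_def)

lemma emb_nth [simp]: "emb g $ i $ j = of_int (g $ i $ j)"
  by (simp add: map_matrix_def)

lemma emb_inj [simp]: "emb g = emb h \<longleftrightarrow> g = h"
  by (simp add: vec_eq_iff)

lemma emb_OA [simp]: "emb g \<in> OA \<longleftrightarrow> g \<in> OA"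
  by (simp add: OA_adj emb_adj[symmetric] emb_mult[symmetric] emb_one[symmetric] del: emb_one)

text \<open>A one-sided inverse is two-sided over the reals, and \<open>emb\<close> is
  injective.\<close>

lemma OA_int: "g \<in> OA \<longleftrightarrow> adj g ** g = mat 1" for g :: "(int, 'n::{finite,linorder}) sqmat"
proof -
  have "g \<in> OA \<longleftrightarrow> adj (emb g) ** emb g = mat 1" by (simp only: emb_OA[symmetric] OA_real)
  also have "\<dots> \<longleftrightarrow> adj g ** g = mat 1"
    by (simp add: emb_adj[symmetric] emb_mult[symmetric] emb_one[symmetric] del: emb_one)
  finally show ?thesis .
qed

lemma lmult_emb: "lmult g x = emb g ** x" by (simp add: lmult_def)

lemma lmult_OA: "g \<in> OA \<Longrightarrow> x \<in> OA \<Longrightarrow> lmult g x \<in> OA"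
  by (simp add: lmult_emb OA_mult)

lemma lmult_mult: "lmult (g ** h) x = lmult g (lmult h x)"
  by (simp add: lmult_emb emb_mult matrix_mul_assoc)

lemma lmult_one [simp]: "lmult (mat 1) x = x"
  by (simp add: lmult_emb)

lemma lmult_adj [simp]: "g \<in> OA \<Longrightarrow> lmult (adj g) (lmult g x) = x" "g \<in> OA \<Longrightarrow> lmult g (lmult (adj g) x) = x"
  by (simp_all add: lmult_mult[symmetric] OA_D)

lemma lmult_assoc: "lmult g (x ** y) = lmult g x ** y"
  by (simp add: lmult_emb matrix_mul_assoc)

lemma lmult_free: "x \<in> OA \<Longrightarrow> lmult g x = lmult h x \<Longrightarrow> g = h"
proof -
  assume x: "x \<in> OA" and "lmult g x = lmult h x"
  then have "emb g ** x ** adj x = emb h ** x ** adj x" by (simp add: lmult_emb)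
  then show "g = h" by (simp add: OA_cancel_right(1)[OF x])
qed

section \<open>Continuity, boundedness and discreteness\<close>

lemma continuous_on_mult_matrix [continuous_intros]:
  fixes f g :: "'a::topological_space \<Rightarrow> real ^ 'n ^ 'n"
  assumes "continuous_on S f" "continuous_on S g"
  shows "continuous_on S (\<lambda>x. f x ** g x)"
  unfolding matrix_matrix_mult_def by (intro continuous_intros assms)

lemma continuous_on_transpose_matrix [continuous_intros]:
  fixes f :: "'a::topological_space \<Rightarrow> real ^ 'n ^ 'n"
  assumes "continuous_on S f"
  shows "continuous_on S (\<lambda>x. transpose (f x))"
  unfolding transpose_def by (intro continuous_intros assms)

lemma continuous_on_adj [continuous_intros]:
  fixes f :: "'a::topological_space \<Rightarrow> (real, 'n::{finite,linorder}) sqmat"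
  assumes "continuous_on S f"
  shows "continuous_on S (\<lambda>x. adj (f x))"
  unfolding adj_def by (intro continuous_intros assms)

lemma continuous_on_lmult [continuous_intros]:
  assumes "continuous_on S f"
  shows "continuous_on S (\<lambda>x. lmult g (f x))"
  unfolding lmult_def by (intro continuous_intros assms)

lemma closed_OA: "closed (OA :: (real, 'n::{finite,linorder}) sqmat set)"
proof -
  have "OA = {g :: (real, 'n) sqmat. adj g ** g = mat 1}" by (auto simp: OA_real)
  moreover have "closed {g :: (real, 'n) sqmat. adj g ** g = mat 1}"
    by (intro closed_Collect_eq continuous_intros)
  ultimately show ?thesis by simp
qed

lemma bounded_matrix_iff:
  fixes S :: "(real ^ 'n ^ 'm) set"
  shows "bounded S \<longleftrightarrow> (\<exists>B. \<forall>x\<in>S. \<forall>i j. \<bar>x $ i $ j\<bar> \<le> B)"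
proof
  assume "bounded S"
  then obtain B where B: "\<And>x. x \<in> S \<Longrightarrow> norm x \<le> B" by (auto simp: bounded_iff)
  have "\<bar>x $ i $ j\<bar> \<le> B" if "x \<in> S" for x i j
  proof -
    have "\<bar>x $ i $ j\<bar> \<le> norm (x $ i)" by (rule component_le_norm_cart)
    also have "\<dots> \<le> norm x" by (rule Finite_Cartesian_Product.norm_nth_le)
    finally show ?thesis using B[OF that] by simp
  qed
  then show "\<exists>B. \<forall>x\<in>S. \<forall>i j. \<bar>x $ i $ j\<bar> \<le> B" by blast
next
  assume "\<exists>B. \<forall>x\<in>S. \<forall>i j. \<bar>x $ i $ j\<bar> \<le> B"
  then obtain B where B: "\<And>x i j. x \<in> S \<Longrightarrow> \<bar>x $ i $ j\<bar> \<le> B" by blast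
  have "norm x \<le> (\<Sum>i\<in>(UNIV::'m set). \<Sum>j\<in>(UNIV::'n set). B)" if "x \<in> S" for x
  proof -
    have "norm x \<le> (\<Sum>i\<in>UNIV. norm (x $ i))" unfolding norm_vec_def by (rule L2_set_le_sum) simp
    also have "\<dots> \<le> (\<Sum>i\<in>UNIV. \<Sum>j\<in>UNIV. \<bar>x $ i $ j\<bar>)" by (intro sum_mono norm_le_l1_cart)
    also have "\<dots> \<le> (\<Sum>i\<in>(UNIV::'m set). \<Sum>j\<in>(UNIV::'n set). B)" by (intro sum_mono B that)
    finally show ?thesis .
  qed
  then show "bounded S" unfolding bounded_iff by blast
qed

lemma bounded_adj: "bounded S \<Longrightarrow> bounded (adj ` S)" for S :: "(real, 'n::{finite,linorder}) sqmat set"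
  unfolding bounded_matrix_iff by (force simp: adj_nth)

lemma bounded_matrix_mult:
  fixes S T :: "(real ^ 'n ^ 'n) set"
  assumes "bounded S" "bounded T"
  shows "bounded {x ** y | x y. x \<in> S \<and> y \<in> T}"
proof -
  obtain A where A: "\<And>x i j. x \<in> S \<Longrightarrow> \<bar>x $ i $ j\<bar> \<le> A" using assms(1) unfolding bounded_matrix_iff by blast
  obtain B where B: "\<And>x i j. x \<in> T \<Longrightarrow> \<bar>x $ i $ j\<bar> \<le> B" using assms(2) unfolding bounded_matrix_iff by blast
  have "\<bar>(x ** y) $ i $ j\<bar> \<le> (\<Sum>k\<in>(UNIV::'n set). A * B)" if "x \<in> S" "y \<in> T" for x y i j
  proof -
    have "\<bar>(x ** y) $ i $ j\<bar> \<le> (\<Sum>k\<in>UNIV. \<bar>x $ i $ k * y $ k $ j\<bar>)"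
      unfolding matrix_matrix_mult_def vec_lambda_beta by (rule sum_abs)
    also have "\<dots> \<le> (\<Sum>k\<in>(UNIV::'n set). A * B)"
      unfolding abs_mult using A[OF that(1)] B[OF that(2)] order_trans[OF abs_ge_zero A[OF that(1)]]
      by (intro sum_mono mult_mono) (assumption | simp)+
    finally show ?thesis .
  qed
  then have "\<forall>z\<in>{x ** y | x y. x \<in> S \<and> y \<in> T}. \<forall>i j. \<bar>z $ i $ j\<bar> \<le> (\<Sum>k\<in>(UNIV::'n set). A * B)"
    by (intro ballI allI, elim CollectE exE conjE) simp
  then show ?thesis unfolding bounded_matrix_iff by (rule exI)
qed

lemma finite_bounded_int_matrices:
  fixes S :: "(real, 'n::{finite,linorder}) sqmat set"
  assumes "bounded S"
  shows "finite {g. emb g \<in> S}"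
proof -
  obtain B where B: "\<And>x i j. x \<in> S \<Longrightarrow> \<bar>x $ i $ j\<bar> \<le> B" using assms unfolding bounded_matrix_iff by blast
  define F where "F = {g :: (int, 'n) sqmat. \<forall>i j. g $ i $ j \<in> {-\<lceil>B\<rceil>..\<lceil>B\<rceil>}}"
  let ?V = "{v :: (int, 'n) vec. \<forall>j. v $ j \<in> {-\<lceil>B\<rceil>..\<lceil>B\<rceil>}}"
  have "finite ((\<lambda>f. vec_lambda f :: (int, 'n) vec) ` (UNIV \<rightarrow>\<^sub>E {-\<lceil>B\<rceil>..\<lceil>B\<rceil>}))"
    by (intro finite_imageI finite_PiE) auto
  moreover have "?V \<subseteq> (\<lambda>f. vec_lambda f :: (int, 'n) vec) ` (UNIV \<rightarrow>\<^sub>E {-\<lceil>B\<rceil>..\<lceil>B\<rceil>})"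
  proof
    fix v assume "v \<in> ?V"
    then show "v \<in> (\<lambda>f. vec_lambda f :: (int, 'n) vec) ` (UNIV \<rightarrow>\<^sub>E {-\<lceil>B\<rceil>..\<lceil>B\<rceil>})"
      by (intro image_eqI[of _ _ "vec_nth v"]) auto
  qed
  ultimately have V: "finite ?V" by (rule finite_subset[rotated])
  have "finite ((\<lambda>f. vec_lambda f :: (int, 'n) sqmat) ` (UNIV \<rightarrow>\<^sub>E ?V))"
    by (intro finite_imageI finite_PiE V) auto
  moreover have "F \<subseteq> (\<lambda>f. vec_lambda f :: (int, 'n) sqmat) ` (UNIV \<rightarrow>\<^sub>E ?V)"
  proof
    fix g assume "g \<in> F"
    then show "g \<in> (\<lambda>f. vec_lambda f :: (int, 'n) sqmat) ` (UNIV \<rightarrow>\<^sub>E ?V)"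
      by (intro image_eqI[of _ _ "vec_nth g"]) (auto simp: F_def)
  qed
  ultimately have "finite F" by (rule finite_subset[rotated])
  moreover have "{g. emb g \<in> S} \<subseteq> F"
  proof
    fix g assume "g \<in> {g. emb g \<in> S}"
    then have "\<bar>real_of_int (g $ i $ j)\<bar> \<le> B" for i j using B[of "emb g" i j] by simp
    then have "real_of_int (g $ i $ j) \<le> B" "real_of_int (- (g $ i $ j)) \<le> B" for i j
      by (simp_all add: abs_le_iff)
    then have "\<lceil>real_of_int (g $ i $ j)\<rceil> \<le> \<lceil>B\<rceil>" "\<lceil>real_of_int (- (g $ i $ j))\<rceil> \<le> \<lceil>B\<rceil>" for i j
      by (intro ceiling_mono; simp)+
    then have "g $ i $ j \<le> \<lceil>B\<rceil>" "- (g $ i $ j) \<le> \<lceil>B\<rceil>" for i j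
      unfolding ceiling_of_int by blast+
    then have "-\<lceil>B\<rceil> \<le> g $ i $ j \<and> g $ i $ j \<le> \<lceil>B\<rceil>" for i j
      using minus_le_iff by blast
    then show "g \<in> F" by (auto simp: F_def)
  qed
  ultimately show ?thesis by (rule finite_subset[rotated])
qed

lemma countable_int_matrices: "countable (S :: (int, 'n::{finite,linorder}) sqmat set)"
  by (rule countableI_type)

text \<open>Proper discontinuity: \<open>emb g\<close> is the product of \<open>lmult g x\<close>
  and the inverse \<open>adj x\<close>, both from bounded sets, and a bounded set contains only
  finitely many integral matrices.\<close>

lemma finite_movers:
  fixes C D :: "(real, 'n::{finite,linorder}) sqmat set"
  assumes "bounded C" "bounded D" "C \<subseteq> OA"
  shows "finite {g. \<exists>x\<in>C. lmult g x \<in> D}"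
proof -
  have "bounded {x ** y | x y. x \<in> D \<and> y \<in> adj ` C}"
    by (intro bounded_matrix_mult assms bounded_adj)
  then have "finite {g. emb g \<in> {x ** y | x y. x \<in> D \<and> y \<in> adj ` C}}"
    by (rule finite_bounded_int_matrices)
  moreover have "{g. \<exists>x\<in>C. lmult g x \<in> D} \<subseteq> {g. emb g \<in> {x ** y | x y. x \<in> D \<and> y \<in> adj ` C}}"
  proof clarify
    fix g x assume "x \<in> C" "lmult g x \<in> D"
    then show "\<exists>xa y. emb g = xa ** y \<and> xa \<in> D \<and> y \<in> adj ` C"
      using assms(3) by (intro exI[of _ "lmult g x"] exI[of _ "adj x"]) (auto simp: lmult_emb OA_cancel_right)
  qed
  ultimately show ?thesis by (rule finite_subset[rotated])
qed

section \<open>Iwasawa decomposition\<close>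

lemma finite_less_induct [case_names less]:
  fixes i :: "'n::{finite,linorder}"
  assumes "\<And>i. (\<And>j. j < i \<Longrightarrow> P j) \<Longrightarrow> P i"
  shows "P i"
  using measure_induct_rule[of pos P i] assms by (simp add: pos_less_iff)

definition lowtri :: "(real, 'n::{finite,linorder}) sqmat \<Rightarrow> bool" where
  "lowtri g \<longleftrightarrow> (\<forall>i j. i < j \<longrightarrow> g $ i $ j = 0)"

definition lowpos :: "(real, 'n::{finite,linorder}) sqmat \<Rightarrow> bool" where
  "lowpos g \<longleftrightarrow> lowtri g \<and> (\<forall>i. g $ i $ i > 0)"

lemma lowtriD: "lowtri g \<Longrightarrow> i < j \<Longrightarrow> g $ i $ j = 0"
  by (simp add: lowtri_def)

lemma lowtri_nth_mult:
  assumes "lowtri g"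
  shows "(g ** h) $ i $ j = (\<Sum>l\<in>{..i}. g $ i $ l * h $ l $ j)"
  unfolding matrix_matrix_mult_def
  by (simp, rule sum.mono_neutral_right) (auto simp: lowtriD[OF assms] not_le)

lemma lowtri_mult: "lowtri g \<Longrightarrow> lowtri h \<Longrightarrow> lowtri (g ** h)"
  unfolding lowtri_def[of "g ** h"]
  by (auto simp: lowtri_nth_mult intro!: sum.neutral lowtriD[of h])

lemma lowtri_mult_diag:
  assumes "lowtri g" "lowtri h"
  shows "(g ** h) $ i $ i = g $ i $ i * h $ i $ i"
proof -
  have "(g ** h) $ i $ i = (\<Sum>l\<in>{..i}. if l = i then g $ i $ i * h $ i $ i else 0)"
    unfolding lowtri_nth_mult[OF assms(1)]
    by (rule sum.cong) (auto simp: lowtriD[OF assms(2)])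
  then show ?thesis by simp
qed

lemma lowpos_mult: "lowpos g \<Longrightarrow> lowpos h \<Longrightarrow> lowpos (g ** h)"
  by (simp add: lowpos_def lowtri_mult lowtri_mult_diag)

lemma lowtri_adj: "lowtri g \<Longrightarrow> lowtri (adj g)"
  by (simp add: lowtri_def adj_nth)

lemma lowpos_adj: "lowpos g \<Longrightarrow> lowpos (adj g)"
  by (simp add: lowpos_def lowtri_adj) (simp add: adj_nth)

lemma lowpos_one: "lowpos (mat 1)"
  by (auto simp: lowpos_def lowtri_def mat_def)

text \<open>Uniqueness in the factorisation into a triangular and an orthogonal matrix:
  \<open>k\<close> is a quotient of lower triangular matrices with positive diagonal, and an
  orthogonal matrix of this kind is the identity.\<close>

lemma lowpos_orthogonal_mult:
  assumes L: "lowpos L" and M: "lowpos M" and k: "orthogonal_matrix k" and eq: "L ** k = M"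
  shows "k = mat 1"
proof -
  have Lt: "lowtri L" and Lp: "\<And>i. L $ i $ i > 0" and Mt: "lowtri M" and Mp: "\<And>i. M $ i $ i > 0"
    using L M by (auto simp: lowpos_def)
  have up: "\<forall>j. i < j \<longrightarrow> k $ i $ j = 0" for i
  proof (induction i rule: finite_less_induct)
    case (less i)
    show ?case
    proof (intro allI impI)
      fix j assume ij: "i < j"
      have "0 = (L ** k) $ i $ j" using eq lowtriD[OF Mt ij] by simp
      also have "\<dots> = (\<Sum>l\<in>{..i}. if l = i then L $ i $ i * k $ i $ j else 0)"
        unfolding lowtri_nth_mult[OF Lt]
      proof (rule sum.cong[OF refl])
        fix l assume "l \<in> {..i}"
        then have "l = i \<or> l < i \<and> l < j" using ij by auto
        then show "L $ i $ l * k $ l $ j = (if l = i then L $ i $ i * k $ i $ j else 0)"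
          using less by auto
      qed
      finally show "k $ i $ j = 0" using Lp[of i] by simp
    qed
  qed
  then have kt: "lowtri k" by (simp add: lowtri_def)
  have kp: "k $ i $ i > 0" for i
    using lowtri_mult_diag[OF Lt kt, of i] eq Lp[of i] Mp[of i] zero_less_mult_pos by metis
  have kk: "k ** transpose k = mat 1"
    using k by (simp add: orthogonal_matrix_def)
  \<comment> \<open>Row \<open>j\<close> vanishes to the right of \<open>j\<close> by triangularity
    and to the left by induction over the columns, so the scalar product of rows \<open>i\<close>
    and \<open>j\<close> has a single term.\<close>
  have "\<forall>i. k $ i $ j = (if i = j then 1 else 0)" for j
  proof (induction j rule: finite_less_induct)
    case (less j)
    have *: "k $ i $ j * k $ j $ j = (if i = j then 1 else 0)" if "j \<le> i" for i
    proof -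
      have "(if i = j then 1 else 0) = (k ** transpose k) $ i $ j" using kk by (simp add: mat_def)
      also have "\<dots> = (\<Sum>l\<in>UNIV. k $ i $ l * k $ j $ l)"
        by (simp add: matrix_matrix_mult_def transpose_def)
      also have "\<dots> = (\<Sum>l\<in>UNIV. if l = j then k $ i $ j * k $ j $ j else 0)"
      proof (rule sum.cong[OF refl])
        fix l
        show "k $ i $ l * k $ j $ l = (if l = j then k $ i $ j * k $ j $ j else 0)"
          using lowtriD[OF kt, of j l] less[of l] by (metis mult_zero_right less_irrefl linorder_less_linear)
      qed
      finally show ?thesis by simp
    qed
    have "k $ j $ j * k $ j $ j = 1" using *[of j] by simp
    then have "k $ j $ j = 1 \<or> k $ j $ j = -1" by (simp only: square_eq_1_iff)
    then have "k $ j $ j = 1" using kp[of j] by auto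
    moreover have "k $ i $ j = 0" if "i \<noteq> j" for i
    proof (cases "i < j")
      case True
      then show ?thesis using lowtriD[OF kt] by blast
    next
      case False
      then show ?thesis using *[of i] that kp[of j] by simp
    qed
    ultimately show ?case by simp
  qed
  then show ?thesis by (simp add: vec_eq_iff mat_def)
qed

text \<open>The vectors live in an arbitrary Euclidean space because \<open>average_form\<close>
  applies this in a product space of twice the dimension.\<close>

lemma gram_schmidt:
  fixes v :: "'n::{finite,linorder} \<Rightarrow> 'e::euclidean_space"
  assumes "\<And>i. v i \<notin> span (v ` {..<i})"
  obtains L q where "lowpos L" "\<And>i. v i = (\<Sum>j\<in>UNIV. L $ i $ j *\<^sub>R q j)"
    "\<And>i j. q i \<bullet> q j = (if i = j then 1 else 0)"
proof -
  have "\<exists>z. v i - z \<in> span (v ` {..<i}) \<and> (\<forall>w\<in>span (v ` {..<i}). orthogonal z w)" for i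
    by (rule orthogonal_subspace_decomp_exists[of "v ` {..<i}" "v i"]) (metis add_diff_cancel_right')
  then obtain z where z: "\<And>i. v i - z i \<in> span (v ` {..<i})"
    "\<And>i w. w \<in> span (v ` {..<i}) \<Longrightarrow> z i \<bullet> w = 0"
    unfolding orthogonal_def by metis
  have z0: "z i \<noteq> 0" for i using z(1)[of i] assms[of i] by auto
  define q where "q i = z i /\<^sub>R norm (z i)" for i
  define L where "L = (\<chi> i j. v i \<bullet> q j)"
  have zs: "z i \<in> span (v ` {..<j})" if "i < j" for i j
  proof -
    have "v i - z i \<in> span (v ` {..<j})"
      using z(1)[of i] span_mono[of "v ` {..<i}" "v ` {..<j}"] that by (meson image_mono lessThan_subset_iff less_imp_le subsetD)
    moreover have "v i \<in> span (v ` {..<j})" using that by (intro span_base) auto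
    ultimately show ?thesis using span_diff by fastforce
  qed
  have qo: "q i \<bullet> w = 0" if "w \<in> span (v ` {..<i})" for i w
    using z(2)[OF that] by (simp add: q_def)
  have qs: "q i \<in> span (v ` {..<j})" if "i < j" for i j
    unfolding q_def by (intro span_mul zs that)
  have qq: "q i \<bullet> q j = (if i = j then 1 else 0)" for i j
  proof (cases i j rule: linorder_cases)
    case less then show ?thesis using qo[OF qs[OF less]] by (simp add: inner_commute)
  next
    case equal then show ?thesis using z0[of j]
      by (simp add: q_def dot_square_norm power2_eq_square field_simps)
  next
    case greater then show ?thesis using qo[OF qs[OF greater]] by simp
  qed
  have "lowpos L"
    unfolding lowpos_def lowtri_def
  proof safe
    fix i j :: 'n assume "i < j"
    then have "v i \<in> span (v ` {..<j})" by (intro span_base) auto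
    from qo[OF this] show "L $ i $ j = 0" by (simp add: L_def inner_commute)
  next
    fix i
    have "q i \<bullet> (v i - z i) = 0" by (rule qo[OF z(1)])
    then have "v i \<bullet> q i = z i \<bullet> q i" by (simp add: inner_diff_right inner_commute)
    also have "\<dots> > 0" using z0[of i] by (simp add: q_def)
    finally show "L $ i $ i > 0" by (simp add: L_def)
  qed
  moreover have "v i = (\<Sum>j\<in>UNIV. L $ i $ j *\<^sub>R q j)" for i
  proof -
    have vs: "v i \<in> span (range q)" for i
    proof (induction i rule: finite_less_induct)
      case (less i)
      have "span (v ` {..<i}) \<subseteq> span (range q)"
        using less by (intro span_minimal) auto
      then have "v i - z i \<in> span (range q)" using z(1) by blast
      moreover have "z i = norm (z i) *\<^sub>R q i" using z0[of i] by (simp add: q_def)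
      then have "z i \<in> span (range q)" by (metis rangeI span_base span_mul)
      ultimately show ?case using span_add by fastforce
    qed
    define w where "w = v i - (\<Sum>j\<in>UNIV. L $ i $ j *\<^sub>R q j)"
    have "w \<in> span (range q)"
      unfolding w_def by (intro span_diff vs span_sum span_mul span_base rangeI)
    moreover have "w \<bullet> q l = 0" for l
      by (simp add: w_def inner_diff_left inner_sum_left qq L_def if_distrib[of "\<lambda>x. _ * x"] cong: if_cong)
    then have "orthogonal w x" if "x \<in> range q" for x using that by (auto simp: orthogonal_def)
    ultimately have "orthogonal w w" using orthogonal_to_span by blast
    then show ?thesis by (simp add: orthogonal_self w_def)
  qed
  ultimately show ?thesis using that qq by blast
qed

text \<open>Independence is certified by dual functionals, taken below from the columns or rows of
  an inverse matrix.\<close>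

lemma not_in_span_functional:
  fixes f :: "'a::real_vector \<Rightarrow> real"
  assumes "linear f" "\<And>x. x \<in> S \<Longrightarrow> f x = 0" "f y \<noteq> 0"
  shows "y \<notin> span S"
  using linear_eq_0_on_span[OF assms(1), of S y] assms(2,3) by auto

lemma lowpos_orthogonal_decomposition:
  fixes g :: "(real, 'n::{finite,linorder}) sqmat"
  assumes "invertible g"
  obtains L k where "lowpos L" "orthogonal_matrix k" "g = L ** k"
proof -
  obtain g' where g': "g ** g' = mat 1" using assms by (auto simp: invertible_def)
  have "g $ i \<notin> span ((\<lambda>i. g $ i) ` {..<i})" for i
  proof (rule not_in_span_functional)
    show "linear (\<lambda>x. (\<Sum>l\<in>UNIV. x $ l * g' $ l $ i))"
      by (auto intro!: linearI simp: sum.distrib algebra_simps sum_distrib_left)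
    have *: "(\<Sum>l\<in>UNIV. g $ j $ l * g' $ l $ i) = (if j = i then 1 else 0)" for j
      using arg_cong[OF g', of "\<lambda>x. x $ j $ i"] by (simp add: matrix_matrix_mult_def mat_def)
    show "(\<Sum>l\<in>UNIV. g $ i $ l * g' $ l $ i) \<noteq> 0" by (simp add: *)
    fix x assume "x \<in> (\<lambda>i. g $ i) ` {..<i}"
    then show "(\<Sum>l\<in>UNIV. x $ l * g' $ l $ i) = 0" by (auto simp: *)
  qed
  then obtain L q where L: "lowpos L" and q: "\<And>i. g $ i = (\<Sum>j\<in>UNIV. L $ i $ j *\<^sub>R q j)"
    "\<And>i j. q i \<bullet> q j = (if i = j then 1 else 0)"
    using gram_schmidt[of "\<lambda>i. g $ i"] by metis
  define k :: "(real, 'n) sqmat" where "k = (\<chi> i. q i)"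
  have "k ** transpose k = mat 1"
    using q(2) by (simp add: vec_eq_iff matrix_matrix_mult_def transpose_def k_def mat_def inner_vec_def)
  then have "orthogonal_matrix k" by (metis orthogonal_matrix matrix_left_right_inverse)
  moreover have "g = L ** k"
    by (simp add: vec_eq_iff q(1) matrix_matrix_mult_def k_def)
  ultimately show ?thesis using that L by blast
qed

text \<open>The product \<open>N T\<close>. The Iwasawa decomposition is proved with this group as
  one factor; \<open>npart\<close> and \<open>diagm\<close> separate \<open>N\<close> and
  \<open>T\<close> later.\<close>

definition B_grp :: "(real, 'n::{finite,linorder}) sqmat set" where
  "B_grp = {g \<in> OA. lowpos g}"

definition K_std :: "(real, 'n::{finite,linorder}) sqmat set" where
  "K_std = {g \<in> OA. orthogonal_matrix g}"

lemma K_std_OA: "k \<in> K_std \<Longrightarrow> k \<in> OA" by (simp add: K_std_def)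
lemma B_grp_OA: "k \<in> B_grp \<Longrightarrow> k \<in> OA" by (simp add: B_grp_def)

lemma B_grp_mult: "g \<in> B_grp \<Longrightarrow> h \<in> B_grp \<Longrightarrow> g ** h \<in> B_grp"
  by (simp add: B_grp_def OA_mult lowpos_mult)

lemma B_grp_adj: "g \<in> B_grp \<Longrightarrow> adj g \<in> B_grp"
  by (simp add: B_grp_def lowpos_adj)

lemma B_grp_one: "mat 1 \<in> B_grp"
  by (simp add: B_grp_def lowpos_one)

lemma K_std_transpose: "k \<in> K_std \<Longrightarrow> adj k = transpose k"
proof -
  assume k: "k \<in> K_std"
  then have "k ** transpose k = mat 1" by (simp add: K_std_def orthogonal_matrix_def)
  then have "adj k ** (k ** transpose k) = adj k" by simp
  then show ?thesis using k by (simp add: K_std_OA OA_cancel_left)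
qed

lemma K_std_mult: "g \<in> K_std \<Longrightarrow> h \<in> K_std \<Longrightarrow> g ** h \<in> K_std"
  by (simp add: K_std_def OA_mult orthogonal_matrix_mul)

lemma K_std_adj: "g \<in> K_std \<Longrightarrow> adj g \<in> K_std"
  using K_std_transpose[of g] by (auto simp: K_std_def orthogonal_matrix_def OA_transpose)

lemma K_std_one: "mat 1 \<in> K_std"
  by (simp add: K_std_def orthogonal_matrix_id)

lemma orthogonal_adj:
  fixes k :: "(real, 'n::{finite,linorder}) sqmat"
  assumes "orthogonal_matrix k" shows "orthogonal_matrix (adj k)"
proof -
  note assms
  moreover have "orthogonal_matrix (antidiag :: (real, 'n) sqmat)"
    by (simp add: orthogonal_matrix_def transpose_antidiag antidiag_sq)
  moreover have "orthogonal_matrix (transpose k)" using calculation(1) by (simp add: orthogonal_matrix_def)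
  ultimately show ?thesis unfolding adj_def by (intro orthogonal_matrix_mul)
qed

lemma compact_K_std: "compact (K_std :: (real, 'n::{finite,linorder}) sqmat set)"
  unfolding compact_eq_bounded_closed
proof (intro conjI)
  have eq: "K_std = OA \<inter> {k :: (real, 'n) sqmat. transpose k ** k = mat 1}"
    by (auto simp: K_std_def orthogonal_matrix)
  have "closed {k :: (real, 'n) sqmat. transpose k ** k = mat 1}"
    by (intro closed_Collect_eq continuous_intros)
  then show "closed (K_std :: (real, 'n) sqmat set)" unfolding eq by (rule closed_Int[OF closed_OA])
  have "\<bar>k $ i $ j\<bar> \<le> 1" if "k \<in> K_std" for k :: "(real, 'n) sqmat" and i j
  proof -
    have "(transpose k ** k) $ j $ j = 1"
      using that by (simp add: K_std_def orthogonal_matrix_def mat_def)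
    then have "(\<Sum>l\<in>UNIV. (k $ l $ j)\<^sup>2) = 1"
      by (simp add: matrix_matrix_mult_def transpose_def power2_eq_square)
    moreover have "(k $ i $ j)\<^sup>2 \<le> (\<Sum>l\<in>UNIV. (k $ l $ j)\<^sup>2)"
      by (rule member_le_sum) auto
    ultimately show ?thesis by (simp add: abs_square_le_1)
  qed
  then show "bounded (K_std :: (real, 'n) sqmat set)" unfolding bounded_matrix_iff by blast
qed

text \<open>The factorisation in the general linear group restricts to \<open>OA\<close> since
  \<open>adj\<close> preserves both kinds of factors: \<open>adj L ** L\<close> is triangular with
  positive diagonal, and \<open>adj g ** g = mat 1\<close> makes it orthogonal as well, so it is the
  identity.\<close>

lemma lowpos_orthogonal_OA:
  assumes "g \<in> OA" "g = L ** k" "lowpos L" "orthogonal_matrix k"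
  shows "L \<in> B_grp" "k \<in> K_std"
proof -
  have "adj k ** (adj L ** L) ** k = mat 1"
    using OA_D(1)[OF assms(1)] by (simp add: assms(2) adj_mult matrix_mul_assoc)
  moreover have "k ** transpose k = mat 1" "transpose (adj k) ** adj k = mat 1"
    using assms(4) orthogonal_adj[OF assms(4)] by (simp_all add: orthogonal_matrix_def)
  ultimately have *: "adj L ** L = transpose (adj k) ** transpose k"
    by (metis matrix_mul_assoc matrix_mul_lid matrix_mul_rid)
  have "orthogonal_matrix (transpose (adj k) ** transpose k)"
    using assms(4) orthogonal_adj[OF assms(4)] by (intro orthogonal_matrix_mul) (simp_all add: orthogonal_matrix_def)
  then have "transpose (adj k) ** transpose k = mat 1"
    using lowpos_orthogonal_mult[OF lowpos_one lowpos_mult[OF lowpos_adj[OF assms(3)] assms(3)]] * by simp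
  then have "adj L ** L = mat 1" using * by simp
  then have L: "L \<in> OA" by (simp add: OA_real)
  then show "L \<in> B_grp" by (simp add: B_grp_def assms(3))
  have "k = adj L ** g" using L by (simp add: assms(2) OA_cancel_left)
  then show "k \<in> K_std" using L assms(1,4) by (simp add: K_std_def OA_mult)
qed

lemma iwasawa_exists:
  assumes "g \<in> OA"
  obtains b k where "b \<in> B_grp" "k \<in> K_std" "g = b ** k"
proof -
  have "invertible g" using assms by (simp add: OA_def)
  then obtain L k where "lowpos L" "orthogonal_matrix k" "g = L ** k"
    by (rule lowpos_orthogonal_decomposition)
  then show ?thesis using that lowpos_orthogonal_OA[OF assms] by blast
qed

lemma iwasawa_unique:
  assumes "b ** k = b' ** k'" "b \<in> B_grp" "b' \<in> B_grp" "k \<in> K_std" "k' \<in> K_std"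
  shows "b = b'" "k = k'"
proof -
  have "b ** (k ** adj k') = b'"
    using assms by (metis K_std_OA OA_cancel_right(1) matrix_mul_assoc)
  then have "k ** adj k' = mat 1"
    using lowpos_orthogonal_mult[of b b' "k ** adj k'"] assms K_std_mult[OF assms(4) K_std_adj[OF assms(5)]]
    by (simp add: B_grp_def K_std_def)
  then show "k = k'" using assms(5) by (metis K_std_OA OA_cancel_right(2) matrix_mul_lid)
  then show "b = b'" using assms(1,5) by (metis K_std_OA OA_cancel_right(1))
qed

definition iwK :: "(real, 'n::{finite,linorder}) sqmat \<Rightarrow> (real, 'n) sqmat" where
  "iwK g = (SOME k. k \<in> K_std \<and> g ** adj k \<in> B_grp)"

definition iwB :: "(real, 'n::{finite,linorder}) sqmat \<Rightarrow> (real, 'n) sqmat" where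
  "iwB g = g ** adj (iwK g)"

lemma iwasawa:
  assumes "g \<in> OA"
  shows "iwK g \<in> K_std" "iwB g \<in> B_grp" "iwB g ** iwK g = g"
proof -
  have "\<exists>k. k \<in> K_std \<and> g ** adj k \<in> B_grp"
    by (rule iwasawa_exists[OF assms]) (auto simp: OA_cancel_right K_std_OA)
  from someI_ex[OF this] show "iwK g \<in> K_std" "iwB g \<in> B_grp"
    by (auto simp: iwK_def iwB_def)
  then show "iwB g ** iwK g = g" by (simp add: iwB_def OA_cancel_right K_std_OA)
qed

lemma iwasawa_eq:
  assumes "b \<in> B_grp" "k \<in> K_std"
  shows "iwB (b ** k) = b" "iwK (b ** k) = k"
proof -
  have g: "b ** k \<in> OA" using assms by (simp add: OA_mult B_grp_OA K_std_OA)
  show "iwB (b ** k) = b" "iwK (b ** k) = k"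
    using iwasawa_unique[OF iwasawa(3)[OF g] iwasawa(2)[OF g] assms(1) iwasawa(1)[OF g] assms(2)] by auto
qed

text \<open>The inverse \<open>adj g\<close> is triangular too, so no diagonal entry of
  \<open>g\<close> vanishes. Membership in \<open>B_grp\<close> thus becomes a closed condition, as
  the closed graph argument for \<open>iwK\<close> requires.\<close>

lemma B_grp_nonneg_diag:
  assumes "g \<in> OA" "lowtri g" "\<And>i. 0 \<le> g $ i $ i"
  shows "g \<in> B_grp"
proof -
  have "g $ i $ i \<noteq> 0" for i
    using lowtri_mult_diag[OF lowtri_adj[OF assms(2)] assms(2), of i] OA_D(1)[OF assms(1)]
    by (auto simp: mat_def)
  then show ?thesis using assms by (auto simp: B_grp_def lowpos_def less_le)
qed

lemma continuous_on_iwK: "continuous_on OA (iwK :: (real, 'n::{finite,linorder}) sqmat \<Rightarrow> _)"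
proof (rule continuous_from_closed_graph[OF compact_K_std])
  show "(iwK :: (real, 'n) sqmat \<Rightarrow> _) \<in> OA \<rightarrow> K_std" using iwasawa by auto
  let ?G = "{x :: (real, 'n) sqmat \<times> (real, 'n) sqmat.
      (\<forall>i j. i < j \<longrightarrow> (fst x ** adj (snd x)) $ i $ j = 0) \<and> (\<forall>i. 0 \<le> (fst x ** adj (snd x)) $ i $ i)}"
  have "(\<lambda>x. Pair x (iwK x)) ` (OA :: (real, 'n) sqmat set) = (OA \<times> K_std) \<inter> ?G"
  proof (intro equalityI subsetI)
    fix z assume "z \<in> (\<lambda>x. Pair x (iwK x)) ` (OA :: (real, 'n) sqmat set)"
    then obtain x where x: "x \<in> OA" "z = (x, iwK x)" by auto
    then show "z \<in> (OA \<times> K_std) \<inter> ?G"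
      using iwasawa[OF x(1)] by (auto simp: iwB_def[symmetric] B_grp_def lowpos_def lowtri_def less_imp_le)
  next
    fix z assume z: "z \<in> (OA \<times> K_std) \<inter> ?G"
    obtain x k where xk: "z = (x, k)" by (cases z)
    have k: "x \<in> OA" "k \<in> K_std" "lowtri (x ** adj k)" "\<And>i. 0 \<le> (x ** adj k) $ i $ i"
      using z by (auto simp: xk lowtri_def)
    then have "x ** adj k \<in> B_grp" by (intro B_grp_nonneg_diag) (auto simp: OA_mult K_std_OA)
    then have "iwK (x ** adj k ** k) = k" using k by (intro iwasawa_eq)
    then have "iwK x = k" using k by (simp add: OA_cancel_right K_std_OA)
    then show "z \<in> (\<lambda>x. Pair x (iwK x)) ` OA" using k xk by auto
  qed
  moreover have "closed ?G"
    by (intro closed_Collect_conj closed_Collect_all closed_Collect_imp open_Collect_const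
         closed_Collect_eq closed_Collect_le continuous_intros)
  moreover have "closed (OA \<times> K_std :: ((real, 'n) sqmat \<times> (real, 'n) sqmat) set)"
    by (intro closed_Times closed_OA compact_imp_closed compact_K_std)
  ultimately show "closed ((\<lambda>x. Pair x (iwK x)) ` (OA :: (real, 'n) sqmat set))"
    by (simp only: closed_Int)
qed

lemma continuous_on_iwB: "continuous_on OA iwB"
  unfolding iwB_def by (intro continuous_intros continuous_on_iwK)

section \<open>Maximal compact subgroups\<close>

lemma inner_matrix: "x \<bullet> y = (\<Sum>i\<in>UNIV. \<Sum>j\<in>UNIV. x $ i $ j * y $ i $ j)"
  for x y :: "real ^ 'n ^ 'n"
  by (simp add: inner_vec_def)

lemma inner_transpose_mult: "(transpose a ** x) \<bullet> y = x \<bullet> (a ** y)"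
  for x y a :: "real ^ 'n ^ 'n"
proof -
  have "(transpose a ** x) \<bullet> y = (\<Sum>i\<in>UNIV. \<Sum>j\<in>UNIV. \<Sum>l\<in>UNIV. a $ l $ i * x $ l $ j * y $ i $ j)"
    by (simp add: inner_matrix matrix_matrix_mult_def transpose_def sum_distrib_right)
  also have "\<dots> = (\<Sum>i\<in>UNIV. \<Sum>l\<in>UNIV. \<Sum>j\<in>UNIV. a $ l $ i * x $ l $ j * y $ i $ j)"
    by (intro sum.cong refl sum.swap)
  also have "\<dots> = (\<Sum>l\<in>UNIV. \<Sum>i\<in>UNIV. \<Sum>j\<in>UNIV. a $ l $ i * x $ l $ j * y $ i $ j)"
    by (rule sum.swap)
  also have "\<dots> = (\<Sum>l\<in>UNIV. \<Sum>j\<in>UNIV. \<Sum>i\<in>UNIV. a $ l $ i * x $ l $ j * y $ i $ j)"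
    by (intro sum.cong refl sum.swap)
  also have "\<dots> = x \<bullet> (a ** y)"
    by (simp add: inner_matrix matrix_matrix_mult_def sum_distrib_left mult_ac)
  finally show ?thesis .
qed

lemma inner_mult_matrix: "(a ** x) \<bullet> y = x \<bullet> (transpose a ** y)"
  for x y a :: "real ^ 'n ^ 'n"
  using inner_transpose_mult[of "transpose a" x y] by simp

lemma lowpos_invertible:
  assumes "lowpos L" shows "\<exists>M. L ** M = mat 1 \<and> M ** L = mat 1"
proof -
  have "x = 0" if "L *v x = 0" for x
  proof -
    have "x $ i = 0" for i
    proof (induction i rule: finite_less_induct)
      case (less i)
      have "0 = (\<Sum>l\<in>UNIV. L $ i $ l * x $ l)"
        using arg_cong[OF that, of "\<lambda>v. v $ i"] by (simp add: matrix_vector_mult_def)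
      also have "\<dots> = (\<Sum>l\<in>UNIV. if l = i then L $ i $ i * x $ i else 0)"
      proof (rule sum.cong[OF refl])
        fix l
        show "L $ i $ l * x $ l = (if l = i then L $ i $ i * x $ i else 0)"
          using assms less[of l] lowtriD[of L i l]
          by (cases i l rule: linorder_cases) (auto simp: lowpos_def)
      qed
      finally show ?case using assms by (auto simp: lowpos_def less_le)
    qed
    then show ?thesis by (simp add: vec_eq_iff)
  qed
  then obtain M where "M ** L = mat 1" using matrix_left_invertible_ker by blast
  then show ?thesis using matrix_left_right_inverse by blast
qed

text \<open>With \<open>P = transpose h ** h\<close> and \<open>h' = inverse h\<close>, this is \<open>tr (k\<^sup>T P k) + tr ((A k)\<^sup>T P\<inverse> (A k))\<close>. Its supremum
  over \<open>k\<close> in a compact group is a strictly convex function of \<open>P\<close>, invariant under the group and under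
  \<open>P \<mapsto> A P\<inverse> A\<close>; so its unique minimiser is a form fixed by both.\<close>

definition energy :: "(real, 'n::{finite,linorder}) sqmat \<Rightarrow> (real, 'n) sqmat \<Rightarrow> (real, 'n) sqmat \<Rightarrow> real" where
  "energy h h' k = (norm (h ** k))\<^sup>2 + (norm (transpose h' ** antidiag ** k))\<^sup>2"

text \<open>The mean of the two forms is the Gram matrix of the vectors \<open>v j\<close>, which
  stack the scaled columns of \<open>h0\<close> and \<open>h1\<close>. The triangular matrix
  \<open>L\<close> of their orthogonalisation is a Cholesky factor, and \<open>h\<close> is its
  transpose.\<close>

lemma average_form:
  fixes h0 h1 :: "(real, 'n::{finite,linorder}) sqmat"
  assumes "h0 ** h0' = mat 1" "h1 ** h1' = mat 1"
  obtains h h' :: "(real, 'n) sqmat" where "h ** h' = mat 1" "transpose h ** h = (1/2) *\<^sub>R (transpose h0 ** h0 + transpose h1 ** h1)"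
proof -
  define v where "v j = (1 / sqrt 2) *\<^sub>R (transpose h0 $ j, transpose h1 $ j)" for j
  have inv: "h0' ** h0 = mat 1" using assms matrix_left_right_inverse by blast
  have indep: "v i \<notin> span (v ` {..<i})" for i
  proof (rule not_in_span_functional)
    let ?f = "\<lambda>x :: (real, 'n) vec \<times> (real, 'n) vec. (\<Sum>l\<in>UNIV. h0' $ i $ l * fst x $ l)"
    show "linear ?f"
      by (auto intro!: linearI simp: sum.distrib algebra_simps sum_distrib_left)
    have *: "?f (v j) = (1 / sqrt 2) * (if i = j then 1 else 0)" for j
    proof -
      have "?f (v j) = (1 / sqrt 2) * (\<Sum>l\<in>UNIV. h0' $ i $ l * h0 $ l $ j)"
        by (simp add: v_def transpose_def sum_distrib_left mult_ac)
      also have "(\<Sum>l\<in>UNIV. h0' $ i $ l * h0 $ l $ j) = (if i = j then 1 else 0)"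
        using arg_cong[OF inv, of "\<lambda>x. x $ i $ j"] by (simp add: matrix_matrix_mult_def mat_def)
      finally show ?thesis .
    qed
    show "?f (v i) \<noteq> 0" unfolding * by simp
    fix x assume "x \<in> v ` {..<i}"
    then show "?f x = 0" using * by auto
  qed
  obtain L q where L: "lowpos L" and q: "\<And>i. v i = (\<Sum>j\<in>UNIV. L $ i $ j *\<^sub>R q j)"
    "\<And>i j. q i \<bullet> q j = (if i = j then 1 else 0)"
    by (rule gram_schmidt[of v, OF indep], rule that)
  obtain M where M: "L ** M = mat 1" "M ** L = mat 1" using lowpos_invertible[OF L] by blast
  have vv: "v i \<bullet> v j = (L ** transpose L) $ i $ j" for i j
    by (simp add: q(1) inner_sum_left inner_sum_right q(2) matrix_matrix_mult_def transpose_def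
        if_distrib[of "\<lambda>x. _ * x"] mult.commute cong: if_cong)
  have "L ** transpose L = (1/2) *\<^sub>R (transpose h0 ** h0 + transpose h1 ** h1)"
  proof (simp only: vec_eq_iff vv[symmetric], intro allI)
    fix i j
    have "v i \<bullet> v j = (1 / sqrt 2) * (1 / sqrt 2) * (transpose h0 $ i \<bullet> transpose h0 $ j + transpose h1 $ i \<bullet> transpose h1 $ j)"
      unfolding v_def by (simp add: inner_Pair)
    also have "(1 / sqrt 2) * (1 / sqrt 2) = 1 / (2::real)" by simp
    finally show "v i \<bullet> v j = ((1/2) *\<^sub>R (transpose h0 ** h0 + transpose h1 ** h1)) $ i $ j"
      by (simp add: inner_vec_def matrix_matrix_mult_def transpose_def)
  qed
  moreover have "transpose L ** transpose M = mat 1"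
    using M by (simp add: matrix_transpose_mul[symmetric])
  ultimately show ?thesis using that[of "transpose L" "transpose M"] by simp
qed

text \<open>Put \<open>P = transpose h ** h\<close>, \<open>x = antidiag ** k\<close> and
  \<open>y = P\<inverse> x\<close>. For a form \<open>Q = transpose g ** g\<close> with
  \<open>g' = g\<inverse>\<close>, the square of the norm of
  \<open>transpose g' ** x - g ** y\<close> is the value of \<open>Q\<inverse>\<close> at
  \<open>x\<close>, minus twice \<open>x \<bullet> y\<close>, plus the value of \<open>Q\<close> at
  \<open>y\<close>. Averaging over the two forms, whose mean is \<open>P\<close>, gives convexity.
  Equality would mean \<open>Q y = x\<close> for both forms, hence equal forms, as \<open>y\<close>
  is invertible.\<close>

lemma energy_average:
  fixes h0 h1 h :: "(real, 'n::{finite,linorder}) sqmat"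
  assumes inv: "h0 ** h0' = mat 1" "h1 ** h1' = mat 1" "h ** h' = mat 1"
    and avg: "transpose h ** h = (1/2) *\<^sub>R (transpose h0 ** h0 + transpose h1 ** h1)"
    and ne: "transpose h0 ** h0 \<noteq> transpose h1 ** h1" and k: "k \<in> OA"
  shows "energy h h' k < (energy h0 h0' k + energy h1 h1' k) / 2"
proof -
  have inv': "h0' ** h0 = mat 1" "h1' ** h1 = mat 1" "h' ** h = mat 1"
    using inv matrix_left_right_inverse by blast+
  have sq: "(norm (a ** x))\<^sup>2 = x \<bullet> (transpose a ** a ** x)" for a x :: "(real, 'n) sqmat"
    by (simp add: power2_norm_eq_inner inner_mult_matrix matrix_mul_assoc)
  have add_mult: "(a + b) ** x = a ** x + b ** x" for a b x :: "(real, 'n) sqmat"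
    by (simp add: vec_eq_iff matrix_matrix_mult_def sum.distrib algebra_simps)
  have scale_mult: "(c *\<^sub>R a) ** x = c *\<^sub>R (a ** x)" for a x :: "(real, 'n) sqmat" and c
    by (simp add: vec_eq_iff matrix_matrix_mult_def sum_distrib_left algebra_simps)
  have half: "(norm (h ** x))\<^sup>2 = ((norm (h0 ** x))\<^sup>2 + (norm (h1 ** x))\<^sup>2) / 2"
    for x :: "(real, 'n) sqmat"
    by (simp add: sq avg scale_mult add_mult inner_add_right)
  define x where "x = antidiag ** k"
  define y where "y = h' ** transpose h' ** x"
  have hh: "transpose h ** transpose h' = mat 1"
    using inv'(3) by (simp add: matrix_transpose_mul[symmetric])
  have Py: "transpose h ** (h ** y) = x"
  proof -
    have "transpose h ** (h ** y) = transpose h ** ((h ** h') ** (transpose h' ** x))"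
      by (simp add: y_def matrix_mul_assoc)
    also have "\<dots> = (transpose h ** transpose h') ** x" by (simp only: inv matrix_mul_lid matrix_mul_assoc)
    finally show ?thesis by (simp add: hh)
  qed
  have xy: "(norm (transpose h' ** x))\<^sup>2 = x \<bullet> y" "(norm (h ** y))\<^sup>2 = x \<bullet> y"
  proof -
    show "(norm (transpose h' ** x))\<^sup>2 = x \<bullet> y"
      by (simp add: sq y_def matrix_mul_assoc)
    show "(norm (h ** y))\<^sup>2 = x \<bullet> y"
      using Py by (simp add: sq matrix_mul_assoc inner_commute)
  qed
  have expand: "(norm (transpose g' ** x - g ** y))\<^sup>2 = (norm (transpose g' ** x))\<^sup>2 - 2 * (x \<bullet> y) + (norm (g ** y))\<^sup>2"
    if "g' ** g = mat 1" for g g' :: "(real, 'n) sqmat"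
  proof -
    have "(transpose g' ** x) \<bullet> (g ** y) = x \<bullet> y"
      using that by (simp add: inner_transpose_mult matrix_mul_assoc)
    then show ?thesis
      by (simp add: power2_norm_eq_inner inner_diff_left inner_diff_right inner_commute)
  qed
  have ne': "transpose h0' ** x - h0 ** y \<noteq> 0 \<or> transpose h1' ** x - h1 ** y \<noteq> 0"
  proof (rule ccontr)
    assume "\<not> ?thesis"
    then have e: "transpose h0' ** x = h0 ** y" "transpose h1' ** x = h1 ** y" by auto
    have "transpose h0 ** transpose h0' = mat 1" "transpose h1 ** transpose h1' = mat 1"
      using inv' by (simp_all add: matrix_transpose_mul[symmetric])
    then have "transpose h0 ** h0 ** y = x" "transpose h1 ** h1 ** y = x"
      by (simp_all only: matrix_mul_assoc[symmetric] e[symmetric]) (simp_all add: matrix_mul_assoc)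
    then have "transpose h0 ** h0 ** y ** (adj k ** antidiag ** transpose h ** h)
      = transpose h1 ** h1 ** y ** (adj k ** antidiag ** transpose h ** h)" by simp
    moreover have "y ** (adj k ** antidiag ** transpose h ** h) = mat 1"
    proof -
      have "y ** (adj k ** antidiag ** transpose h ** h) =
        h' ** (transpose h' ** (antidiag ** (k ** adj k) ** antidiag) ** transpose h) ** h"
        by (simp add: y_def x_def matrix_mul_assoc)
      also have "\<dots> = h' ** transpose (h ** h') ** h"
        by (simp add: OA_D[OF k] antidiag_sq matrix_transpose_mul)
      finally show ?thesis by (simp add: inv inv')
    qed
    ultimately show False using ne by (simp only: matrix_mul_assoc[symmetric] matrix_mul_rid)
  qed
  have "0 < (norm (transpose h0' ** x - h0 ** y))\<^sup>2 + (norm (transpose h1' ** x - h1 ** y))\<^sup>2"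
    using ne' by (auto simp: add_pos_nonneg add_nonneg_pos)
  also have "\<dots> = (norm (transpose h0' ** x))\<^sup>2 + (norm (transpose h1' ** x))\<^sup>2 - 2 * (norm (transpose h' ** x))\<^sup>2"
    unfolding expand[OF inv'(1)] expand[OF inv'(2)] using half[of y] xy by simp
  finally show ?thesis
    unfolding energy_def using half[of k] by (simp add: x_def matrix_mul_assoc)
qed

lemma norm_antidiag_mult: "norm (x ** antidiag) = norm x"
  for x :: "(real, 'n::{finite,linorder}) sqmat"
proof -
  have "(norm (x ** antidiag))\<^sup>2 = (\<Sum>i\<in>UNIV. \<Sum>j\<in>UNIV. x $ i $ opp j * x $ i $ opp j)"
    by (simp add: power2_norm_eq_inner inner_matrix mult_antidiag)
  also have "\<dots> = (norm x)\<^sup>2"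
    by (simp add: power2_norm_eq_inner inner_matrix sum_opp[of "\<lambda>j. x $ _ $ j * x $ _ $ j"])
  finally show ?thesis by simp
qed

lemma norm_transpose: "norm (transpose x) = norm x" for x :: "real ^ 'n ^ 'n"
proof -
  have "(norm (transpose x))\<^sup>2 = (norm x)\<^sup>2"
    unfolding power2_norm_eq_inner inner_matrix transpose_def by (simp, rule sum.swap)
  then show ?thesis by simp
qed

lemma invariant_form_exists:
  fixes K :: "(real, 'n::{finite,linorder}) sqmat set"
  assumes "compact_subgroup K"
  obtains h h' :: "(real, 'n) sqmat" where "h ** h' = mat 1" "\<And>k. k \<in> K \<Longrightarrow> transpose (h ** k) ** (h ** k) = transpose h ** h"
    "antidiag ** h' ** transpose h' ** antidiag = transpose h ** h"
proof -
  have KOA: "K \<subseteq> OA" and K: "compact K" and K1: "mat 1 \<in> K"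
    and Km: "\<And>g h. g \<in> K \<Longrightarrow> h \<in> K \<Longrightarrow> g ** h \<in> K"
    using assms by (auto simp: compact_subgroup_def)
  \<comment> \<open>Pairs of a matrix and its inverse: the energy at \<open>mat 1\<close> bounds
    both, so the sublevel set is compact and limits stay invertible.\<close>
  define S where "S c = {p. fst p ** snd p = mat 1 \<and> (\<forall>k\<in>K. energy (fst p) (snd p) k \<le> c)}" for c
  have cont: "continuous_on X (\<lambda>p. energy (f p) (g p) (q p))"
    if "continuous_on X f" "continuous_on X g" "continuous_on X q"
    for X and f g q :: "'z::topological_space \<Rightarrow> (real, 'n) sqmat"
    unfolding energy_def by (intro continuous_intros that)
  have compS: "compact (S c)" for c
    unfolding compact_eq_bounded_closed
  proof
    have "S c \<subseteq> cball 0 (sqrt c) \<times> cball 0 (sqrt c)"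
    proof
      fix p assume "p \<in> S c"
      then have "energy (fst p) (snd p) (mat 1) \<le> c" using K1 by (auto simp: S_def)
      then have "(norm (fst p))\<^sup>2 + (norm (snd p))\<^sup>2 \<le> c"
        by (simp add: energy_def norm_antidiag_mult norm_transpose)
      then have "(norm (fst p))\<^sup>2 \<le> c" "(norm (snd p))\<^sup>2 \<le> c"
        using zero_le_power2[of "norm (fst p)"] zero_le_power2[of "norm (snd p)"] by linarith+
      then show "p \<in> cball 0 (sqrt c) \<times> cball 0 (sqrt c)" by (cases p) (auto intro: real_le_rsqrt)
    qed
    then show "bounded (S c)" by (rule bounded_subset[rotated]) (intro bounded_Times bounded_cball)
    have "S c = {p. fst p ** snd p = mat 1} \<inter> (\<Inter>k\<in>K. {p. energy (fst p) (snd p) k \<le> c})"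
      by (auto simp: S_def)
    then show "closed (S c)"
      by (simp only:) (intro closed_Int closed_INT ballI closed_Collect_eq closed_Collect_le cont continuous_intros)
  qed
  have max: "\<exists>k\<in>K. \<forall>k'\<in>K. energy h h' k' \<le> energy h h' k" for h h'
    by (rule continuous_attains_sup[OF K]) (use K1 in \<open>auto intro!: cont continuous_intros\<close>)
  define C where "C = {c. S c \<noteq> {}}"
  have C0: "0 \<le> c" if "c \<in> C" for c
  proof -
    from that obtain p where "p \<in> S c" by (auto simp: C_def)
    then have "energy (fst p) (snd p) (mat 1) \<le> c" using K1 by (auto simp: S_def)
    then show ?thesis by (simp add: energy_def) (smt (verit) zero_le_power2)
  qed
  have Cne: "C \<noteq> {}"
  proof -
    obtain k where "k \<in> K" "\<And>k'. k' \<in> K \<Longrightarrow> energy (mat 1) (mat 1) k' \<le> energy (mat 1) (mat 1) k"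
      using max[of "mat 1" "mat 1"] by blast
    then have "(mat 1, mat 1) \<in> S (energy (mat 1) (mat 1) k)" by (auto simp: S_def)
    then show ?thesis by (auto simp: C_def)
  qed
  define m where "m = Inf C"
  have mC: "m \<le> c" if "c \<in> C" for c
    unfolding m_def using that C0 by (intro cInf_lower bdd_belowI)
  define R where "R n = S (m + 1 / real (Suc n))" for n :: nat
  \<comment> \<open>The infimum \<open>m\<close> is attained because the sublevel sets slightly
    above \<open>m\<close> are nested, compact and nonempty.\<close>
  have "\<Inter>(range R) \<noteq> {}"
  proof (rule compact_nest)
    show "compact (R n)" for n by (simp add: R_def compS)
    show "R n \<noteq> {}" for n
    proof -
      have "Inf C < m + 1 / real (Suc n)" by (simp add: m_def)
      then obtain c where "c \<in> C" "c < m + 1 / real (Suc n)" using cInf_lessD[OF Cne] by blast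
      then show ?thesis unfolding R_def C_def S_def by (force intro: less_imp_le)
    qed
    show "R l \<subseteq> R k" if "k \<le> l" for k l
    proof -
      have "1 / real (Suc l) \<le> 1 / real (Suc k)" using that by (simp add: frac_le)
      then show ?thesis unfolding R_def S_def by force
    qed
  qed
  then obtain h h' :: "(real, 'n) sqmat" where hR: "\<And>n. (h, h') \<in> R n" by auto
  have hS: "(h, h') \<in> S m"
  proof -
    have "energy h h' k \<le> m" if "k \<in> K" for k
    proof (rule field_le_epsilon)
      fix e :: real assume "0 < e"
      then obtain n where "inverse (real (Suc n)) < e" using reals_Archimedean by blast
      moreover have "energy h h' k \<le> m + 1 / real (Suc n)" using hR[of n] that by (auto simp: R_def S_def)
      ultimately show "energy h h' k \<le> m + e" by (simp add: inverse_eq_divide)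
    qed
    then show ?thesis using hR[of 0] by (auto simp: R_def S_def)
  qed
  \<comment> \<open>Otherwise the maximal energy of the midpoint form would be below
    \<open>m\<close>, by strict convexity at the point \<open>k\<close> where this maximum is
    attained.\<close>
  have uniq: "transpose (fst p) ** fst p = transpose h ** h" if "p \<in> S m" for p
  proof (rule ccontr)
    assume ne: "transpose (fst p) ** fst p \<noteq> transpose h ** h"
    have i: "fst p ** snd p = mat 1" "h ** h' = mat 1" using that hS by (auto simp: S_def)
    obtain g g' :: "(real, 'n) sqmat" where g: "g ** g' = mat 1"
      "transpose g ** g = (1/2) *\<^sub>R (transpose (fst p) ** fst p + transpose h ** h)"
      by (rule average_form[OF i])
    obtain k where k: "k \<in> K" "\<And>k'. k' \<in> K \<Longrightarrow> energy g g' k' \<le> energy g g' k"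
      using max[of g g'] by blast
    then have "(g, g') \<in> S (energy g g' k)" using g by (auto simp: S_def)
    then have "m \<le> energy g g' k" by (intro mC) (auto simp: C_def)
    also have "\<dots> < (energy (fst p) (snd p) k + energy h h' k) / 2"
      using energy_average[OF i g ne] k KOA by blast
    also have "\<dots> \<le> m"
    proof -
      have "energy (fst p) (snd p) k \<le> m" "energy h h' k \<le> m" using that hS k(1) by (auto simp: S_def)
      then show ?thesis by simp
    qed
    finally show False by simp
  qed
  have hh: "h ** h' = mat 1" "h' ** h = mat 1" using hS matrix_left_right_inverse by (auto simp: S_def)
  have "transpose (h ** k) ** (h ** k) = transpose h ** h" if k: "k \<in> K" for k
  proof -
    have kO: "k \<in> OA" using k KOA by blast
    have ta: "transpose (adj k) = antidiag ** k ** antidiag"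
      by (simp add: adj_def matrix_transpose_mul transpose_antidiag matrix_mul_assoc)
    have "energy (h ** k) (adj k ** h') k' = energy h h' (k ** k')" for k'
    proof -
      have "transpose (adj k ** h') ** antidiag ** k' = transpose h' ** antidiag ** k ** (antidiag ** antidiag) ** k'"
        by (simp add: matrix_transpose_mul ta matrix_mul_assoc)
      then show ?thesis by (simp add: energy_def matrix_mul_assoc antidiag_sq)
    qed
    moreover have "(h ** k) ** (adj k ** h') = h ** (k ** adj k) ** h'" by (simp add: matrix_mul_assoc)
    ultimately have "(h ** k, adj k ** h') \<in> S m"
      using hS Km[OF k] by (auto simp: S_def OA_D[OF kO])
    from uniq[OF this] show ?thesis by simp
  qed
  moreover have "antidiag ** h' ** transpose h' ** antidiag = transpose h ** h"
  proof -
    have "(transpose h' ** antidiag) ** (antidiag ** transpose h) = transpose h' ** (antidiag ** antidiag) ** transpose h"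
      by (simp add: matrix_mul_assoc)
    also have "\<dots> = transpose (h ** h')" by (simp add: antidiag_sq matrix_transpose_mul)
    finally have "(transpose h' ** antidiag) ** (antidiag ** transpose h) = mat 1" by (simp add: hh)
    moreover have "energy (transpose h' ** antidiag) (antidiag ** transpose h) k = energy h h' k" for k
    proof -
      have "transpose (antidiag ** transpose h) ** antidiag ** k = h ** (antidiag ** antidiag) ** k"
        by (simp add: matrix_transpose_mul transpose_antidiag matrix_mul_assoc)
      then show ?thesis by (simp add: energy_def antidiag_sq)
    qed
    ultimately have "(transpose h' ** antidiag, antidiag ** transpose h) \<in> S m"
      using hS by (auto simp: S_def)
    from uniq[OF this] show ?thesis
      by (simp add: matrix_transpose_mul transpose_antidiag matrix_mul_assoc)
  qed
  ultimately show ?thesis using that hh by blast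
qed

text \<open>Write the invariant form as \<open>transpose b ** b\<close> with \<open>b\<close> lower
  triangular; then \<open>b\<close> conjugates the group into orthogonal matrices. The second
  invariance, under \<open>P \<mapsto> A P\<inverse> A\<close>, makes the triangular matrix
  \<open>b ** adj b\<close> orthogonal, hence the identity, which puts \<open>b\<close> into
  \<open>OA\<close>.\<close>

lemma compact_subgroup_conjugate:
  fixes K :: "(real, 'n::{finite,linorder}) sqmat set"
  assumes "compact_subgroup K"
  obtains b where "b \<in> B_grp" "\<And>k. k \<in> K \<Longrightarrow> b ** k ** adj b \<in> K_std"
proof -
  obtain h h' :: "(real, 'n) sqmat" where hh: "h ** h' = mat 1"
    and hK: "\<And>k. k \<in> K \<Longrightarrow> transpose (h ** k) ** (h ** k) = transpose h ** h"
    and hA: "antidiag ** h' ** transpose h' ** antidiag = transpose h ** h"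
    using invariant_form_exists[OF assms] by blast
  have h'h: "h' ** h = mat 1" using hh matrix_left_right_inverse by blast
  have "adj h' ** adj h = mat 1" by (simp add: adj_mult[symmetric] hh)
  then have "invertible (adj h)" unfolding invertible_def using matrix_left_right_inverse by blast
  \<comment> \<open>Factorising \<open>adj h\<close> instead of \<open>h\<close> yields
    \<open>h\<close> as orthogonal times triangular, so that the orthogonal factor cancels in
    \<open>transpose h ** h\<close>.\<close>
  then obtain L \<kappa> where L: "lowpos L" "orthogonal_matrix \<kappa>" "adj h = L ** \<kappa>"
    by (rule lowpos_orthogonal_decomposition)
  define b where "b = adj L"
  have b: "lowpos b" by (simp add: b_def lowpos_adj L)
  have h: "h = adj \<kappa> ** b" using L(3) by (metis adj_adj adj_mult b_def)
  have orth: "transpose (adj \<kappa>) ** adj \<kappa> = mat 1"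
    using orthogonal_adj[OF L(2)] by (simp add: orthogonal_matrix_def)
  have form: "transpose (h ** x) ** (h ** x) = transpose (b ** x) ** (b ** x)" for x
  proof -
    have "transpose (h ** x) ** (h ** x) = transpose (b ** x) ** (transpose (adj \<kappa>) ** adj \<kappa>) ** (b ** x)"
      by (simp add: h matrix_transpose_mul matrix_mul_assoc)
    then show ?thesis by (simp add: orth)
  qed
  have P: "transpose h ** h = transpose b ** b" using form[of "mat 1"] by simp
  have "antidiag ** (transpose b ** b) ** antidiag = (antidiag ** antidiag) ** h' ** transpose h' ** (antidiag ** antidiag)"
    unfolding P[symmetric] hA[symmetric] by (simp add: matrix_mul_assoc)
  then have APA: "antidiag ** transpose b ** b ** antidiag = h' ** transpose h'"
    by (simp add: antidiag_sq matrix_mul_assoc)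
  have "(transpose b ** b) ** (h' ** transpose h') = transpose h ** (h ** h') ** transpose h'"
    unfolding P[symmetric] by (simp add: matrix_mul_assoc)
  also have "\<dots> = transpose (h' ** h)" by (simp add: hh matrix_transpose_mul)
  finally have bb: "(transpose b ** b) ** (h' ** transpose h') = mat 1" by (simp add: h'h)
  obtain b' where b': "b ** b' = mat 1" "b' ** b = mat 1" using lowpos_invertible[OF b] by blast
  define M where "M = b ** adj b"
  have "M ** transpose M = b ** (antidiag ** transpose b ** (antidiag ** antidiag) ** b ** antidiag) ** transpose b"
    by (simp add: M_def adj_def matrix_transpose_mul transpose_antidiag matrix_mul_assoc)
  also have "\<dots> = b ** (h' ** transpose h') ** transpose b" by (simp add: antidiag_sq APA)
  also have "\<dots> = (transpose b' ** transpose b) ** (b ** (h' ** transpose h') ** transpose b)"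
    using b' by (simp add: matrix_transpose_mul[symmetric])
  also have "\<dots> = transpose b' ** ((transpose b ** b) ** (h' ** transpose h')) ** transpose b"
    by (simp add: matrix_mul_assoc)
  also have "\<dots> = mat 1" using b' by (simp add: bb matrix_transpose_mul[symmetric])
  finally have "orthogonal_matrix M" by (metis orthogonal_matrix matrix_left_right_inverse)
  moreover have "lowpos M" by (simp add: M_def lowpos_mult lowpos_adj b)
  ultimately have "M = mat 1" by (intro lowpos_orthogonal_mult[OF lowpos_one]) simp_all
  then have "adj b ** b = mat 1" unfolding M_def using matrix_left_right_inverse by blast
  then have bO: "b \<in> OA" by (simp add: OA_real)
  then have bB: "b \<in> B_grp" by (simp add: B_grp_def b)
  have "b ** k ** adj b \<in> K_std" if k: "k \<in> K" for k
  proof -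
    have kO: "k \<in> OA" using k assms by (auto simp: compact_subgroup_def)
    have "transpose (b ** k ** adj b) ** (b ** k ** adj b)
      = transpose (adj b) ** (transpose (b ** k) ** (b ** k)) ** adj b"
      by (simp add: matrix_transpose_mul matrix_mul_assoc)
    also have "\<dots> = transpose (adj b) ** (transpose b ** b) ** adj b"
      using hK[OF k] by (simp add: form P)
    also have "\<dots> = transpose (b ** adj b) ** (b ** adj b)"
      by (simp add: matrix_transpose_mul matrix_mul_assoc)
    also have "\<dots> = mat 1" by (simp add: OA_D[OF bO])
    finally show ?thesis using bO kO by (simp add: K_std_def orthogonal_matrix OA_mult)
  qed
  then show ?thesis using that bB by blast
qed

text \<open>Conjugation by \<open>b\<close> embeds \<open>K\<close> into \<open>K_std\<close>, and
  maximality turns this into equality. As \<open>b\<close> is in \<open>B_grp\<close>, right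
  multiplication by \<open>adj b\<close> turns the decomposition \<open>N T K\<close> into
  \<open>N T K_std\<close>.\<close>

lemma maximal_compact_eq:
  fixes K :: "(real, 'n::{finite,linorder}) sqmat set"
  assumes "maximal_compact_subgroup K"
  obtains b where "b \<in> B_grp" "K = (\<lambda>k. adj b ** k ** b) ` K_std"
proof -
  have cK: "compact_subgroup K" and max: "\<And>L. compact_subgroup L \<Longrightarrow> K \<subseteq> L \<Longrightarrow> L = K"
    using assms by (auto simp: maximal_compact_subgroup_def)
  obtain b where b: "b \<in> B_grp" "\<And>k. k \<in> K \<Longrightarrow> b ** k ** adj b \<in> K_std"
    using compact_subgroup_conjugate[OF cK] by blast
  have bO: "b \<in> OA" using b B_grp_OA by blast
  let ?L = "(\<lambda>k. adj b ** k ** b) ` K_std"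
  have "compact_subgroup ?L"
    unfolding compact_subgroup_def
  proof (intro conjI ballI)
    show "?L \<subseteq> OA" using bO K_std_OA by (auto intro!: OA_mult)
    show "compact ?L" by (intro compact_continuous_image continuous_intros compact_K_std)
    show "mat 1 \<in> ?L" by (rule image_eqI[OF _ K_std_one]) (simp add: OA_D[OF bO])
    fix g assume "g \<in> ?L"
    then obtain k where k: "k \<in> K_std" "g = adj b ** k ** b" by auto
    have "matrix_inv g = adj b ** adj k ** b"
      using bO K_std_OA[OF k(1)] by (simp add: matrix_inv_OA OA_mult k(2) adj_mult matrix_mul_assoc)
    then show "matrix_inv g \<in> ?L" using K_std_adj[OF k(1)] by auto
    fix h assume "h \<in> ?L"
    then obtain k' where k': "k' \<in> K_std" "h = adj b ** k' ** b" by auto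
    have "g ** h = adj b ** k ** (b ** adj b) ** k' ** b" by (simp add: k k' matrix_mul_assoc)
    then have "g ** h = adj b ** (k ** k') ** b" by (simp add: OA_D[OF bO] matrix_mul_assoc)
    then show "g ** h \<in> ?L" using K_std_mult[OF k(1) k'(1)] by auto
  qed
  moreover have "K \<subseteq> ?L"
  proof
    fix k assume "k \<in> K"
    then show "k \<in> ?L"
      by (intro image_eqI[OF _ b(2)]) (auto simp: matrix_mul_assoc OA_D[OF bO] OA_cancel_right[OF bO])
  qed
  ultimately show ?thesis using that b(1) max by metis
qed

section \<open>Torus coordinates\<close>

definition diagm :: "(real, 'n::{finite,linorder}) sqmat \<Rightarrow> (real, 'n) sqmat" where
  "diagm g = (\<chi> i j. if i = j then g $ i $ i else 0)"

definition npart :: "(real, 'n::{finite,linorder}) sqmat \<Rightarrow> (real, 'n) sqmat" where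
  "npart g = g ** adj (diagm g)"

lemma diagm_nth: "diagm g $ i $ j = (if i = j then g $ i $ i else 0)"
  by (simp add: diagm_def)

lemma mult_diagm_nth: "(g ** diagm h) $ i $ j = g $ i $ j * h $ j $ j"
  by (simp add: matrix_matrix_mult_def diagm_nth if_distrib[of "\<lambda>x. _ * x"] cong: if_cong)

lemma diagm_mult_nth: "(diagm h ** g) $ i $ j = h $ i $ i * g $ i $ j"
  by (simp add: matrix_matrix_mult_def diagm_nth if_distrib[of "\<lambda>x. x * _"] cong: if_cong)

lemma adj_diagm: "adj (diagm g) = diagm (adj g)"
  by (auto simp: vec_eq_iff adj_nth diagm_nth)

lemma B_grp_diag_opp:
  assumes "b \<in> B_grp"
  shows "b $ i $ i * b $ opp i $ opp i = 1"
proof -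
  have "(adj b ** b) $ i $ i = 1" using OA_D[OF B_grp_OA[OF assms]] by (simp add: mat_def)
  then show ?thesis
    using lowtri_mult_diag[OF lowtri_adj, of b b i] assms
    by (simp add: B_grp_def lowpos_def adj_nth mult.commute)
qed

lemma diagm_T_grp:
  assumes "b \<in> B_grp" shows "diagm b \<in> T_grp"
proof -
  have "adj (diagm b) ** diagm b = mat 1"
    using B_grp_diag_opp[OF assms]
    by (auto simp: vec_eq_iff adj_diagm diagm_mult_nth diagm_nth adj_nth mat_def mult.commute)
  then have "diagm b \<in> OA" by (simp add: OA_real)
  then show ?thesis using assms by (auto simp: T_grp_def diagm_nth B_grp_def lowpos_def)
qed

lemma T_grp_B: "t \<in> T_grp \<Longrightarrow> t \<in> B_grp"
  by (auto simp: T_grp_def B_grp_def lowpos_def lowtri_def)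

lemma N_grp_B: "t \<in> N_grp \<Longrightarrow> t \<in> B_grp"
  by (auto simp: N_grp_def B_grp_def lowpos_def lowtri_def)

lemma N_grp_iff: "u \<in> N_grp \<longleftrightarrow> u \<in> B_grp \<and> (\<forall>i. u $ i $ i = 1)"
  by (auto simp: N_grp_def B_grp_def lowpos_def lowtri_def)

lemma T_grp_diagm: "t \<in> T_grp \<Longrightarrow> diagm t = t"
  by (auto simp: T_grp_def diagm_nth vec_eq_iff)

lemma npart_N:
  assumes "b \<in> B_grp" shows "npart b \<in> N_grp"
  using assms B_grp_diag_opp[OF assms] diagm_T_grp[OF assms]
  by (auto simp: N_grp_iff npart_def B_grp_mult B_grp_adj T_grp_B)
     (simp add: adj_diagm mult_diagm_nth adj_nth)

lemma npart_diagm: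
  assumes "b \<in> B_grp" shows "npart b ** diagm b = b"
  using OA_cancel_right(2)[of "diagm b"] diagm_T_grp[OF assms] by (simp add: npart_def T_grp_def)

lemma diagm_mult:
  assumes "u \<in> N_grp" "b \<in> B_grp"
  shows "diagm (u ** b) = diagm b"
  using assms by (auto simp: vec_eq_iff diagm_nth lowtri_mult_diag N_grp_iff B_grp_def lowpos_def)

lemma npart_mult:
  assumes "u \<in> N_grp" "b \<in> B_grp"
  shows "npart (u ** b) = u ** npart b"
  using assms by (simp add: npart_def diagm_mult matrix_mul_assoc)

lemma npart_NT:
  assumes "u \<in> N_grp" "t \<in> T_grp"
  shows "npart (u ** t) = u" "diagm (u ** t) = t"
proof -
  show "diagm (u ** t) = t" using assms by (simp add: diagm_mult T_grp_B T_grp_diagm)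
  then show "npart (u ** t) = u" using assms by (simp add: npart_def OA_cancel_right T_grp_def)
qed

lemma continuous_on_diagm [continuous_intros]:
  assumes "continuous_on S f" shows "continuous_on S (\<lambda>x. diagm (f x))"
proof -
  have "continuous_on S (\<lambda>x. if i = j then f x $ i $ i else 0)" for i j
    by (cases "i = j") (auto intro!: continuous_intros assms)
  then show ?thesis unfolding diagm_def by (intro continuous_intros)
qed

lemma continuous_on_npart [continuous_intros]:
  assumes "continuous_on S f" shows "continuous_on S (\<lambda>x. npart (f x))"
  unfolding npart_def by (intro continuous_intros assms)

text \<open>Distinct indices are near only for even \<open>n\<close>, and then they are the two middle ones. The coordinates
  \<open>s\<^sub>1, \<dots>, s\<^sub>m\<close> of \<open>T\<close> are the quotients \<open>t\<^sub>j / t\<^sub>i\<close> for the simple pairs \<open>(i, j)\<close>: these are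
  \<open>(1, 2), \<dots>, (m, m + 1)\<close> for odd \<open>n\<close> and \<open>(1, 2), \<dots>, (m - 1, m), (m - 1, m + 1)\<close> for even \<open>n\<close>.\<close>

definition near :: "'n::{finite,linorder} \<Rightarrow> 'n \<Rightarrow> bool" where
  "near i j \<longleftrightarrow> i = j \<or> (j = opp i \<and> (pos i = pos j + 1 \<or> pos j = pos i + 1))"

definition simple_pair :: "'n::{finite,linorder} \<Rightarrow> 'n \<Rightarrow> bool" where
  "simple_pair i j \<longleftrightarrow> pos i \<le> (CARD('n) - 1) div 2 \<and> i < j \<and> (\<forall>l. i < l \<and> l < j \<longrightarrow> near l j)"

definition idx :: "nat \<Rightarrow> 'n::{finite,linorder}" where
  "idx k = inv_into UNIV pos k"

lemma pos_idx: "1 \<le> k \<Longrightarrow> k \<le> CARD('n) \<Longrightarrow> pos (idx k :: 'n::{finite,linorder}) = k"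
  unfolding idx_def by (rule f_inv_into_f) (metis pos_surj rangeI)

lemma idx_pos [simp]: "idx (pos i) = i"
  by (metis pos_idx pos_inj pos_range)

lemma near_iff_pos: "near i (j::'n::{finite,linorder}) \<longleftrightarrow>
  i = j \<or> (pos i + pos j = CARD('n) + 1 \<and> (pos i = pos j + 1 \<or> pos j = pos i + 1))"
  unfolding near_def by (metis opp_eq_iff)

lemma simple_pair_pos:
  "simple_pair i (j::'n::{finite,linorder}) \<longleftrightarrow> pos i \<le> (CARD('n) - 1) div 2 \<and>
     (pos j = pos i + 1 \<or> (even CARD('n) \<and> pos j = CARD('n) div 2 + 1 \<and> pos i + 1 = CARD('n) div 2))"
proof
  assume sp: "simple_pair i j"
  then have ij: "pos i < pos j" and i: "pos i \<le> (CARD('n) - 1) div 2"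
    and nl: "\<And>l. pos i < pos l \<Longrightarrow> pos l < pos j \<Longrightarrow> near l j"
    by (auto simp: simple_pair_def pos_less_iff)
  have jn: "pos j \<le> CARD('n)" by (rule pos_range)
  show "pos i \<le> (CARD('n) - 1) div 2 \<and>
     (pos j = pos i + 1 \<or> (even CARD('n) \<and> pos j = CARD('n) div 2 + 1 \<and> pos i + 1 = CARD('n) div 2))"
  proof (cases "pos j = pos i + 1")
    case False
    define l where "l = (idx (pos i + 1) :: 'n)"
    have l: "pos l = pos i + 1" unfolding l_def using ij jn by (intro pos_idx) auto
    then have "near l j" using ij False by (intro nl) auto
    then have "pos l + pos j = CARD('n) + 1" "pos l + 1 = pos j"
      using ij False l by (auto simp: near_iff_pos)
    then have "CARD('n) = 2 * (pos i + 1)" "pos j = pos i + 2" unfolding l by simp_all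
    then show ?thesis using i by simp
  qed (use i in simp)
next
  assume A: "pos i \<le> (CARD('n) - 1) div 2 \<and>
     (pos j = pos i + 1 \<or> (even CARD('n) \<and> pos j = CARD('n) div 2 + 1 \<and> pos i + 1 = CARD('n) div 2))"
  have "near l j" if "pos i < pos l" "pos l < pos j" for l
  proof -
    have "pos j \<noteq> pos i + 1" using that by linarith
    with A have e: "even CARD('n)" "pos j = CARD('n) div 2 + 1" "pos i + 1 = CARD('n) div 2" by blast+
    moreover from e(1) have "CARD('n) = 2 * (CARD('n) div 2)" by simp
    ultimately have "pos l + 1 = pos j" "pos l + pos j = CARD('n) + 1" using that by linarith+
    then show ?thesis by (simp add: near_iff_pos)
  qed
  moreover have "pos i < pos j" using A by linarith
  ultimately show "simple_pair i j" using A by (auto simp: simple_pair_def pos_less_iff)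
qed

lemma half_facts:
  fixes n :: nat assumes "n \<ge> 3"
  shows "(n - 1) div 2 + 1 \<le> n" "n div 2 + 1 \<le> n" "1 \<le> (n - 1) div 2" "1 \<le> n div 2"
    "even n \<Longrightarrow> n = 2 * (n div 2)" "odd n \<Longrightarrow> n = 2 * (n div 2) + 1"
    "even n \<Longrightarrow> (n - 1) div 2 = n div 2 - 1" "odd n \<Longrightarrow> (n - 1) div 2 = n div 2"
    "even n \<Longrightarrow> 2 \<le> n div 2"
  using assms by presburger+

lemma torus_coord_odd:
  assumes "odd n" "j \<le> n div 2"
  shows "torus_coord n s j = inverse (s j) * (if j = n div 2 then 1 else torus_coord n s (Suc j))"
  using assms by (auto simp: torus_coord_def prod.atLeast_Suc_atMost[of j "n div 2"])

lemma torus_coord_even: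
  assumes "even n" "j + 1 < n div 2"
  shows "torus_coord n s j = inverse (s j) * torus_coord n s (Suc j)"
  using assms by (auto simp: torus_coord_def Let_def prod.atLeast_Suc_atMost[of j "n div 2 - 2"])

lemma torus_coord_even_end:
  assumes "even n" "2 \<le> n div 2"
  shows "torus_coord n s (n div 2) = inverse (sqrt (s (n div 2 - 1) * s (n div 2))) * s (n div 2 - 1)"
    "torus_coord n s (n div 2 - 1) = inverse (sqrt (s (n div 2 - 1) * s (n div 2)))"
  using assms by (auto simp: torus_coord_def Let_def)

lemma T_grp_pos: "t \<in> T_grp \<Longrightarrow> t $ i $ i > 0"
  by (simp add: T_grp_def)

lemma T_grp_mid:
  fixes t :: "(real, 'n::{finite,linorder}) sqmat"
  assumes "t \<in> T_grp" "opp i = i"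
  shows "t $ i $ i = 1"
  using B_grp_diag_opp[OF T_grp_B[OF assms(1)], of i] T_grp_pos[OF assms(1), of i] assms(2)
  by (simp add: square_eq_1_iff)

lemma T_above_iff:
  fixes t :: "(real, 'n::{finite,linorder}) sqmat"
  assumes c: "c > 0" and n: "CARD('n) \<ge> 3"
  shows "t \<in> T_above c \<longleftrightarrow> t \<in> T_grp \<and> (\<forall>i j. simple_pair i j \<longrightarrow> c * t $ i $ i < t $ j $ j)"
proof
  let ?m = "CARD('n) div 2"
  assume "t \<in> T_above c"
  then obtain s where t: "t \<in> T_grp" and s: "\<And>i. i \<in> {1..?m} \<Longrightarrow> s i > 0 \<and> s i > c"
    and ts: "\<And>i. pos i \<le> ?m \<Longrightarrow> t $ i $ i = torus_coord CARD('n) s (pos i)"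
    unfolding T_above_def by blast
  have "c * t $ i $ i < t $ j $ j" if sp: "simple_pair i j" for i j
  proof -
    have "\<exists>k\<in>{1..?m}. t $ j $ j = s k * t $ i $ i"
    proof (cases "odd CARD('n)")
      case odd: True
      then have ij: "pos j = pos i + 1" "pos i \<le> ?m" "1 \<le> pos i"
        using sp pos_range[of i] by (auto simp: simple_pair_pos) 
      have si: "s (pos i) > 0" using s ij by simp
      show ?thesis
      proof (cases "pos i = ?m")
        case True
        then have "opp j = j" using ij odd by (metis opp_eq_iff add.commute add_Suc_right even_two_times_div_two mult_2 odd_two_times_div_two_succ Suc_eq_plus1 add_Suc)
        then have "t $ j $ j = 1" using T_grp_mid[OF t] by blast
        moreover have "t $ i $ i = inverse (s (pos i))"
          using ts[of i] torus_coord_odd[OF odd, of "pos i" s] True by simp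
        ultimately show ?thesis using si ij by (intro bexI[of _ "pos i"]) auto
      next
        case False
        then show ?thesis
          using ts[of i] ts[of j] torus_coord_odd[OF odd, of "pos i" s] ij si
          by (intro bexI[of _ "pos i"]) auto
      qed
    next
      case False
      then have ev: "even CARD('n)" by simp
      have m2: "2 \<le> ?m" using half_facts(9)[OF n ev] .
      have i: "1 \<le> pos i" "pos i + 1 \<le> ?m" using sp pos_range[of i] ev by (auto simp: simple_pair_pos) 
      have si: "s (pos i) > 0" "s ?m > 0" using s i by auto
      consider "pos j = pos i + 1" "pos i + 1 < ?m" | "pos j = pos i + 1" "pos i + 1 = ?m"
        | "pos j = ?m + 1" "pos i + 1 = ?m"
        using sp i by (auto simp: simple_pair_pos) linarith
      then show ?thesis
      proof cases
        case 1
        then show ?thesis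
          using ts[of i] ts[of j] torus_coord_even[OF ev, of "pos i" s] si i
          by (intro bexI[of _ "pos i"]) auto
      next
        case 2
        then have e: "pos i = ?m - 1" "pos j = ?m" by auto
        have "t $ j $ j = s (?m - 1) * t $ i $ i"
          using ts[of i] ts[of j] torus_coord_even_end[OF ev m2, of s] by (simp add: e)
        then show ?thesis using e i by (intro bexI[of _ "pos i"]) auto
      next
        case 3
        \<comment> \<open>Here \<open>j\<close> is the upper middle index, beyond the range of
          \<open>torus_coord\<close>; its entry is the inverse of the one at
          \<open>l\<close>.\<close>
        define l where "l = opp j"
        have l: "pos l = ?m" using 3 ev by (auto simp: l_def pos_opp elim!: evenE)
        have e: "pos i = ?m - 1" using 3 by auto
        let ?r = "sqrt (s (?m - 1) * s ?m)"
        have r: "?r > 0" "?r * ?r = s (?m - 1) * s ?m" using si e by auto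
        have "t $ j $ j * t $ l $ l = 1" using B_grp_diag_opp[OF T_grp_B[OF t]] by (simp add: l_def)
        moreover have "t $ l $ l = inverse ?r * s (?m - 1)" "t $ i $ i = inverse ?r"
          using ts[of l] ts[of i] torus_coord_even_end[OF ev m2, of s] by (simp_all add: l e)
        ultimately have A: "t $ j $ j * s (?m - 1) = ?r" and B: "t $ i $ i * ?r = 1"
          using r(1) by (auto simp: field_simps)
        have "s ?m * t $ i $ i * s (?m - 1) = t $ i $ i * (?r * ?r)"
          unfolding r(2) by (simp only: mult_ac)
        also have "\<dots> = (t $ i $ i * ?r) * ?r" by (simp only: mult.assoc)
        finally have "t $ j $ j * s (?m - 1) = s ?m * t $ i $ i * s (?m - 1)" by (simp only: A B mult_1)
        then have "t $ j $ j = s ?m * t $ i $ i" using si e by simp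
        then show ?thesis using m2 by (intro bexI[of _ ?m]) auto
      qed
    qed
    then show ?thesis using s T_grp_pos[OF t, of i] by auto
  qed
  then show "t \<in> T_grp \<and> (\<forall>i j. simple_pair i j \<longrightarrow> c * t $ i $ i < t $ j $ j)" using t by blast
next
  let ?m = "CARD('n) div 2"
  assume "t \<in> T_grp \<and> (\<forall>i j. simple_pair i j \<longrightarrow> c * t $ i $ i < t $ j $ j)"
  then have t: "t \<in> T_grp" and sp: "\<And>i j. simple_pair i j \<Longrightarrow> c * t $ i $ i < t $ j $ j" by auto
  define T where "T k = t $ (idx k :: 'n) $ idx k" for k
  have Tp: "T k > 0" for k using T_grp_pos[OF t] by (simp add: T_def)
  have Topp: "T k * T l = 1" if "k + l = CARD('n) + 1" "1 \<le> k" "1 \<le> l" for k l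
  proof -
    have "idx l = opp (idx k :: 'n)"
      using that opp_eq_iff[of "idx k :: 'n" "idx l"] by (simp add: pos_idx)
    then show ?thesis using B_grp_diag_opp[OF T_grp_B[OF t]] by (simp add: T_def)
  qed
  have Tsp: "c * T k < T l" if "1 \<le> k" "k \<le> (CARD('n) - 1) div 2"
    "l = k + 1 \<or> (even CARD('n) \<and> l = ?m + 1 \<and> k + 1 = ?m)" for k l
  proof -
    have "k \<le> CARD('n)" "1 \<le> l" "l \<le> CARD('n)"
      using that(1,2) half_facts(1,2)[OF n] that(3) by (auto simp del: One_nat_def)
    then show ?thesis unfolding T_def using that by (intro sp) (simp add: simple_pair_pos pos_idx)
  qed
  define s where "s k = (if even CARD('n) \<and> k = ?m then T (?m + 1) / T (?m - 1) else T (k + 1) / T k)" for k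
  have tor: "T k = torus_coord CARD('n) s k" if "1 \<le> k" "k \<le> ?m" for k
  proof (cases "odd CARD('n)")
    case odd: True
    show ?thesis using that(2,1)
    proof (induction k rule: inc_induct)
      case base
      have "T (?m + 1) * T (?m + 1) = 1" using half_facts(6)[OF n odd] by (intro Topp) linarith+
      then have "T (?m + 1) = 1" using Tp[of "?m + 1"] by (simp add: square_eq_1_iff)
      then show ?case using odd by (simp add: torus_coord_odd s_def)
    next
      case (step k)
      then show ?case using odd Tp[of k] Tp[of "Suc k"] by (simp add: torus_coord_odd[of _ k] s_def)
    qed
  next
    case False
    then have ev: "even CARD('n)" by simp
    have m2: "2 \<le> ?m" using half_facts(9)[OF n ev] .
    have mm: "?m - 1 \<noteq> ?m" "?m - 1 + 1 = ?m" using m2 by linarith+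
    have s1: "s (?m - 1) = T ?m / T (?m - 1)" unfolding s_def using mm by (metis)
    have s2: "s ?m = T (?m + 1) / T (?m - 1)" unfolding s_def using ev by simp
    \<comment> \<open>The two middle entries are inverse to each other, so the product under the
      square root is the square of \<open>inverse (T (?m - 1))\<close>.\<close>
    have "T ?m * T (?m + 1) = 1" using half_facts(5)[OF n ev] m2 by (intro Topp) linarith+
    moreover have "s (?m - 1) * s ?m = (T ?m * T (?m + 1)) / (T (?m - 1) * T (?m - 1))"
      unfolding s1 s2 by simp
    ultimately have "s (?m - 1) * s ?m = (inverse (T (?m - 1)))\<^sup>2" by (simp add: power2_eq_square field_simps)
    then have r: "inverse (sqrt (s (?m - 1) * s ?m)) = T (?m - 1)"
      using Tp[of "?m - 1"] by (simp add: less_imp_le)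
    have "T k = torus_coord CARD('n) s k" if "1 \<le> k" "k \<le> ?m - 1" using that(2,1)
    proof (induction k rule: inc_induct)
      case base
      show ?case unfolding torus_coord_even_end(2)[OF ev m2, of s] r ..
    next
      case (step k)
      then have "s k = T (Suc k) / T k" by (auto simp: s_def)
      then show ?case using step Tp[of k] Tp[of "Suc k"] torus_coord_even[OF ev, of k s] by simp
    qed
    moreover have "T ?m = torus_coord CARD('n) s ?m"
      unfolding torus_coord_even_end(1)[OF ev m2, of s] r unfolding s1 using Tp[of "?m - 1"]
      by (simp add: field_simps)
    ultimately show ?thesis using that by (cases "k = ?m") auto
  qed
  have "s k > 0 \<and> s k > c" if "k \<in> {1..?m}" for k
  proof -
    have "s k > c"
    proof (cases "even CARD('n) \<and> k = ?m")
      case True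
      then have "c * T (?m - 1) < T (?m + 1)" using half_facts(7,9)[OF n] by (intro Tsp) auto
      then show ?thesis using True Tp by (simp add: s_def field_simps)
    next
      case False
      then have "k \<le> (CARD('n) - 1) div 2"
        using that half_facts(7,8)[OF n] by (cases "even CARD('n)") auto
      then have "c * T k < T (k + 1)" using that by (intro Tsp) auto
      then show ?thesis using False Tp by (auto simp: s_def field_simps)
    qed
    then show ?thesis using c by simp
  qed
  moreover have "t $ i $ i = torus_coord CARD('n) s (pos i)" if "pos i \<le> ?m" for i
    using tor[of "pos i"] pos_range[of i] that by (simp add: T_def)
  ultimately show "t \<in> T_above c" unfolding T_above_def using t by blast
qed

text \<open>The smaller index \<open>i\<close> has to lie before the middle, since for even
  \<open>n\<close> nothing orders the two middle entries. Up to position \<open>?h\<close> the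
  entries increase and stay below 1; those behind the middle are their inverses.\<close>

lemma T_above_one_less:
  fixes t :: "(real, 'n::{finite,linorder}) sqmat"
  assumes n: "CARD('n) \<ge> 3" and t: "t \<in> T_above 1"
    and i: "pos i \<le> (CARD('n) - 1) div 2" and ij: "i < j"
  shows "t $ i $ i < t $ j $ j"
proof -
  let ?h = "(CARD('n) - 1) div 2"
  have tT: "t \<in> T_grp" and sp: "\<And>i j. simple_pair i j \<Longrightarrow> t $ i $ i < t $ j $ j"
    using t T_above_iff[of 1 t] n by auto
  have chain: "t $ i $ i < t $ j $ j" if "i < j" "pos j \<le> ?h + 1" for i j
  proof -
    define d where "d = pos j - pos i - 1"
    have "pos j = pos i + 1 + d" using that by (simp add: d_def pos_less_iff[symmetric])
    then show ?thesis using that(2)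
    proof (induction d arbitrary: j)
      case 0
      then show ?case by (intro sp) (simp add: simple_pair_pos)
    next
      case (Suc d)
      define l where "l = (idx (pos i + 1 + d) :: 'n)"
      have l: "pos l = pos i + 1 + d" unfolding l_def using Suc pos_range[of j] by (intro pos_idx) auto
      have "t $ i $ i < t $ l $ l" using Suc l by (intro Suc.IH) auto
      also have "t $ l $ l < t $ j $ j" using Suc l by (intro sp) (simp add: simple_pair_pos)
      finally show ?case .
    qed
  qed
  have opp1: "t $ i $ i * t $ opp i $ opp i = 1" for i by (rule B_grp_diag_opp[OF T_grp_B[OF tT]])
  define p where "p = (idx ?h :: 'n)"
  define q where "q = (idx (?h + 1) :: 'n)"
  have pq: "pos p = ?h" "pos q = ?h + 1" unfolding p_def q_def using n by (intro pos_idx; presburger)+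
  have spq: "simple_pair p q" "simple_pair p (opp q)"
    using n by (simp_all add: simple_pair_pos pq pos_opp) presburger
  then have lt: "t $ p $ p < t $ q $ q" "t $ p $ p < t $ opp q $ opp q" using sp by blast+
  \<comment> \<open>Both \<open>q\<close> and \<open>opp q\<close> form simple pairs with
    \<open>p\<close>, and their entries have product 1. For odd \<open>n\<close> they
    coincide.\<close>
  have "t $ p $ p * t $ p $ p < t $ q $ q * t $ opp q $ opp q"
    using lt T_grp_pos[OF tT] by (intro mult_strict_mono) (auto intro: less_imp_le)
  then have p1: "t $ p $ p < 1" using opp1[of q] by (simp add: power2_eq_square[symmetric] abs_square_less_1 T_grp_pos[OF tT] less_imp_le)
  have le_p: "t $ i $ i \<le> t $ p $ p" if "pos i \<le> ?h" for i
    using chain[of i p] that pq pos_less_iff[of i p] pos_inj[of i p] by fastforce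
  consider "pos j \<le> ?h + 1" | "j = opp q" | "pos j > ?h + 1" "j \<noteq> opp q" by linarith
  then show ?thesis
  proof cases
    case 1 then show ?thesis using chain[OF ij] by blast
  next
    case 2 then show ?thesis using lt le_p[OF i] by simp
  next
    case 3
    have "pos (opp j) \<le> ?h"
    proof -
      have "pos j \<noteq> pos (opp q)" using 3 pos_inj by metis
      then show ?thesis using 3(1) pq pos_opp[of j] pos_opp[of q] pos_range[of j] by presburger
    qed
    then have "t $ opp j $ opp j < 1" using le_p p1 by fastforce
    then have "t $ j $ j > 1"
      using opp1[of j] T_grp_pos[OF tT, of "opp j"] T_grp_pos[OF tT, of j]
      by (smt (verit) mult_less_cancel_left2 mult_left_le)
    then show ?thesis using le_p[OF i] p1 by simp
  qed
qed

section \<open>Cocompactness of the integral unipotent group\<close>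

definition N_int :: "(int, 'n::{finite,linorder}) sqmat set" where
  "N_int = {g \<in> OA. emb g \<in> N_grp}"

definition unipotent :: "(real, 'n::{finite,linorder}) sqmat \<Rightarrow> bool" where
  "unipotent g \<longleftrightarrow> lowtri g \<and> (\<forall>i. g $ i $ i = 1)"

lemma unipotent_mult: "unipotent g \<Longrightarrow> unipotent h \<Longrightarrow> unipotent (g ** h)"
  by (simp add: unipotent_def lowtri_mult lowtri_mult_diag)

lemma N_grp_unipotent: "g \<in> N_grp \<longleftrightarrow> g \<in> OA \<and> unipotent g"
  by (auto simp: N_grp_def unipotent_def lowtri_def)

lemma closed_N_grp: "closed (N_grp :: (real, 'n::{finite,linorder}) sqmat set)"
proof -
  have eq: "N_grp = (OA :: (real, 'n) sqmat set) \<inter> {g. (\<forall>i. g $ i $ i = 1) \<and> (\<forall>i j. i < j \<longrightarrow> g $ i $ j = 0)}"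
    by (auto simp: N_grp_def)
  show ?thesis unfolding eq
    by (intro closed_Int closed_OA closed_Collect_conj closed_Collect_all closed_Collect_imp
        open_Collect_const closed_Collect_eq continuous_intros)
qed

text \<open>Coordinates are made small from the \<open>k\<close>-th downwards: row \<open>p\<close>
  of \<open>g\<close> has entry 1 at \<open>p\<close> and zeros behind it, so the use of earlier
  rows for earlier coordinates does not disturb the later ones.\<close>

lemma row_reduction:
  fixes g :: "(real, 'n::{finite,linorder}) sqmat"
  assumes g: "unipotent g" and k: "k \<le> CARD('n)"
  shows "\<exists>a :: 'n \<Rightarrow> int. (\<forall>j. k < pos j \<longrightarrow> a j = (0::int)) \<and>
    (\<forall>j. pos j \<le> k \<longrightarrow> v j + (\<Sum>l\<in>UNIV. of_int (a l) * g $ l $ j) \<in> {0..<1})"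
  using k
proof (induction k arbitrary: v)
  case 0
  have z: "pos (j::'n) = 0 \<longleftrightarrow> False" for j using pos_range(1)[of j] by auto
  show ?case by (intro exI[of _ "\<lambda>_. 0"]) (simp add: z)
next
  case (Suc k)
  define p where "p = (idx (Suc k) :: 'n)"
  have p: "pos p = Suc k" unfolding p_def using Suc by (intro pos_idx) auto
  define v' where "v' j = v j - of_int \<lfloor>v p\<rfloor> * g $ p $ j" for j
  obtain a where a: "\<And>j. k < pos j \<Longrightarrow> a j = 0"
    "\<And>j. pos j \<le> k \<Longrightarrow> v' j + (\<Sum>l\<in>UNIV. of_int (a l) * g $ l $ j) \<in> {0..<1}"
    using Suc.IH[of v'] Suc.prems by auto
  define a' where "a' = a(p := - \<lfloor>v p\<rfloor>)"
  have ap: "a p = 0" by (rule a) (simp add: p)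
  have sum_a': "v j + (\<Sum>l\<in>UNIV. of_int (a' l) * g $ l $ j) = v' j + (\<Sum>l\<in>UNIV. of_int (a l) * g $ l $ j)" for j
  proof -
    have "(\<Sum>l\<in>UNIV. of_int (a' l) * g $ l $ j)
      = (\<Sum>l\<in>UNIV. of_int (a l) * g $ l $ j + (if l = p then - of_int \<lfloor>v p\<rfloor> * g $ p $ j else 0))"
      by (rule sum.cong) (auto simp: a'_def ap)
    then show ?thesis by (simp add: sum.distrib v'_def)
  qed
  show ?case
  proof (intro exI[of _ a'] conjI allI impI)
    fix j :: 'n assume "Suc k < pos j"
    then show "a' j = 0" using a(1)[of j] p by (auto simp: a'_def)
  next
    fix j :: 'n assume j: "pos j \<le> Suc k"
    show "v j + (\<Sum>l\<in>UNIV. of_int (a' l) * g $ l $ j) \<in> {0..<1}"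
    proof (cases "pos j \<le> k")
      case True
      then show ?thesis unfolding sum_a' by (rule a)
    next
      case False
      then have jp: "j = p" using j p by (simp add: pos_inj[symmetric])
      have "of_int (a l) * g $ l $ p = 0" for l
      proof (cases "k < pos l")
        case False
        then have "l < p" using p by (simp add: pos_less_iff[symmetric])
        then show ?thesis using g by (simp add: unipotent_def lowtri_def)
      qed (simp add: a)
      then have "(\<Sum>l\<in>UNIV. of_int (a l) * g $ l $ p) = 0" by (intro sum.neutral) blast
      then have "v p + (\<Sum>l\<in>UNIV. of_int (a' l) * g $ l $ p) = v p - of_int \<lfloor>v p\<rfloor>"
        unfolding sum_a' using g by (simp add: v'_def unipotent_def)
      then show ?thesis unfolding jp by simp linarith
    qed
  qed
qed

lemma unipotent_reduction:
  fixes g :: "(real, 'n::{finite,linorder}) sqmat"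
  assumes g: "unipotent g"
  obtains d :: "(int, 'n) sqmat" where "unipotent (emb d)" "unipotent (emb d ** g)"
    "\<And>i j. j < i \<Longrightarrow> (emb d ** g) $ i $ j \<in> {0..<1}"
proof -
  have "\<forall>i. \<exists>a :: 'n \<Rightarrow> int. (\<forall>j. i \<le> j \<longrightarrow> a j = (0::int)) \<and>
    (\<forall>j. j < i \<longrightarrow> g $ i $ j + (\<Sum>l\<in>UNIV. of_int (a l) * g $ l $ j) \<in> {0..<1})"
  proof
    fix i :: 'n
    have *: "pos i - 1 < pos j \<longleftrightarrow> i \<le> j" "pos j \<le> pos i - 1 \<longleftrightarrow> j < i" for j
      using pos_range[of i] pos_le_iff[of i j] pos_less_iff[of j i] by linarith+
    have "pos i - 1 \<le> CARD('n)" using pos_range[of i] by simp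
    from row_reduction[OF g this, of "\<lambda>j. g $ i $ j"]
    show "\<exists>a :: 'n \<Rightarrow> int. (\<forall>j. i \<le> j \<longrightarrow> a j = (0::int)) \<and>
        (\<forall>j. j < i \<longrightarrow> g $ i $ j + (\<Sum>l\<in>UNIV. of_int (a l) * g $ l $ j) \<in> {0..<1})"
      by (simp only: *)
  qed
  from choice[OF this] obtain a :: "'n \<Rightarrow> 'n \<Rightarrow> int" where a: "\<And>i j. i \<le> j \<Longrightarrow> a i j = 0"
    "\<And>i j. j < i \<Longrightarrow> g $ i $ j + (\<Sum>l\<in>UNIV. of_int (a i l) * g $ l $ j) \<in> {0..<1}"
    by blast
  define d :: "(int, 'n) sqmat" where "d = (\<chi> i j. if i = j then 1 else a i j)"
  have dg: "(emb d ** g) $ i $ j = g $ i $ j + (\<Sum>l\<in>UNIV. of_int (a i l) * g $ l $ j)" for i j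
  proof -
    have "(emb d ** g) $ i $ j = (\<Sum>l\<in>UNIV. (if l = i then g $ i $ j else 0) + of_int (a i l) * g $ l $ j)"
      unfolding matrix_matrix_mult_def by (simp, rule sum.cong) (auto simp: d_def a)
    then show ?thesis by (simp add: sum.distrib)
  qed
  have "unipotent (emb d)" using a(1) by (auto simp: unipotent_def lowtri_def d_def)
  then show ?thesis using that[of d] unipotent_mult[OF _ g] a(2) dg by simp
qed

text \<open>Reducing \<open>d\<close> itself leaves integral entries in \<open>{0..<1}\<close>, so
  the reduced matrix is the identity and the reducing matrix is the inverse.\<close>

lemma unipotent_int_inverse:
  fixes d :: "(int, 'n::{finite,linorder}) sqmat"
  assumes "unipotent (emb d)"
  obtains e where "unipotent (emb e)" "e ** d = mat 1" "d ** e = mat 1"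
proof -
  obtain e :: "(int, 'n) sqmat" where e: "unipotent (emb e)" "unipotent (emb e ** emb d)"
    "\<And>i j. j < i \<Longrightarrow> (emb e ** emb d) $ i $ j \<in> {0..<1}"
    by (rule unipotent_reduction[OF assms], rule that)
  have "(e ** d) $ i $ j = mat 1 $ i $ j" for i j
  proof (cases i j rule: linorder_cases)
    case less
    then have "(emb (e ** d)) $ i $ j = 0" using e(2) by (simp add: emb_mult unipotent_def lowtri_def)
    then show ?thesis using less by (simp add: mat_def)
  next
    case equal
    then have "(emb (e ** d)) $ i $ j = 1" using e(2) by (simp add: emb_mult unipotent_def)
    then show ?thesis using equal by (simp add: mat_def)
  next
    case greater
    then have "(emb (e ** d)) $ i $ j \<in> {0..<1}" using e(3) by (simp only: emb_mult)
    then show ?thesis using greater by (simp add: mat_def)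
  qed
  then have 1: "e ** d = mat 1" by (simp add: vec_eq_iff)
  then have "emb d ** emb e = mat 1"
    using matrix_left_right_inverse[of "emb e" "emb d"] by (simp add: emb_mult[symmetric])
  then have "d ** e = mat 1" by (simp add: emb_mult[symmetric] emb_one[symmetric] del: emb_one)
  then show ?thesis using that e(1) 1 by blast
qed

lemma emb_transpose: "emb (transpose g) = transpose (emb g)"
  by (simp add: vec_eq_iff transpose_def)

lemma emb_antidiag [simp]: "emb antidiag = antidiag"
  by (simp add: vec_eq_iff antidiag_nth)

lemma OA_dual_form: "g \<in> OA \<longleftrightarrow> g ** antidiag ** transpose g = antidiag"
  for g :: "(int, 'n::{finite,linorder}) sqmat"
proof -
  have "g ** antidiag ** transpose g = antidiag \<longleftrightarrow> transpose g \<in> OA"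
    unfolding OA_int form_iff_adj[symmetric] by simp
  then show ?thesis using OA_transpose[of g] OA_transpose[of "transpose g"] by auto
qed

lemma OA_dual_form_real: "g \<in> OA \<Longrightarrow> g ** antidiag ** transpose g = antidiag"
  for g :: "(real, 'n::{finite,linorder}) sqmat"
  using OA_transpose[of g] unfolding OA_def by simp

text \<open>The integral matrix \<open>d A d\<^sup>T\<close> determines \<open>d\<close> up to the orthogonal group. So the reduction of
  \<open>N\<close> by all integral unipotent matrices, which is an elementary elimination, changes into a
  reduction by orthogonal ones after a correction from a finite set.\<close>

lemma N_int_cocompact:
  obtains C :: "(real, 'n::{finite,linorder}) sqmat set" where "compact C" "C \<subseteq> N_grp"
    "\<And>u. u \<in> N_grp \<Longrightarrow> \<exists>d\<in>N_int. lmult d u \<in> C"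
proof -
  define U where "U = {u :: (real, 'n) sqmat. unipotent u \<and> (\<forall>i j. j < i \<longrightarrow> u $ i $ j \<in> {0..<1})}"
  define D where "D = {d :: (int, 'n) sqmat. unipotent (emb d) \<and> (\<exists>u\<in>N_grp. emb d ** u \<in> U)}"
  define form where "form d = d ** antidiag ** transpose d" for d :: "(int, 'n) sqmat"
  have "\<bar>u $ i $ j\<bar> \<le> 1" if "u \<in> U" for u i j
    using that by (cases i j rule: linorder_cases) (force simp: U_def unipotent_def lowtri_def)+
  then have bU: "bounded U" unfolding bounded_matrix_iff by blast
  have "bounded {x ** y | x y. x \<in> {x ** y | x y. x \<in> U \<and> y \<in> {antidiag}} \<and> y \<in> transpose ` U}"
  proof (intro bounded_matrix_mult bU)
    show "bounded (transpose ` U)" using bU unfolding bounded_matrix_iff by (force simp: transpose_def)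
  qed simp
  then have "finite {M. emb M \<in> {x ** y | x y. x \<in> {x ** y | x y. x \<in> U \<and> y \<in> {antidiag}} \<and> y \<in> transpose ` U}}"
    by (rule finite_bounded_int_matrices)
  moreover have "form ` D \<subseteq> {M. emb M \<in> {x ** y | x y. x \<in> {x ** y | x y. x \<in> U \<and> y \<in> {antidiag}} \<and> y \<in> transpose ` U}}"
  proof clarify
    fix d assume "d \<in> D"
    then obtain u where u: "u \<in> N_grp" "emb d ** u \<in> U" by (auto simp: D_def)
    \<comment> \<open>As \<open>u\<close> preserves the dual form, \<open>form d\<close> can be
      computed from \<open>emb d ** u\<close>, which is bounded; being integral, it takes finitely
      many values.\<close>
    have "(emb d ** u) ** antidiag ** transpose (emb d ** u)
      = emb d ** (u ** antidiag ** transpose u) ** transpose (emb d)"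
      by (simp add: matrix_transpose_mul matrix_mul_assoc)
    also have "\<dots> = emb (form d)"
      using u by (simp add: OA_dual_form_real N_grp_unipotent form_def emb_mult emb_transpose)
    finally show "\<exists>x y. emb (form d) = x ** y \<and> x \<in> {x ** y | x y. x \<in> U \<and> y \<in> {antidiag}} \<and> y \<in> transpose ` U"
      using u(2) by (intro exI[of _ "(emb d ** u) ** antidiag"] exI[of _ "transpose (emb d ** u)"]) auto
  qed
  ultimately have fin: "finite (form ` D)" by (rule finite_subset[rotated])
  have "\<exists>e. unipotent (emb e) \<and> e ** (inv_into D form M) = mat 1 \<and> (inv_into D form M) ** e = mat 1"
    if "M \<in> form ` D" for M
    using inv_into_into[OF that] unipotent_int_inverse[of "inv_into D form M"] unfolding D_def by blast
  then obtain e where e: "\<And>M. M \<in> form ` D \<Longrightarrow> unipotent (emb (e M))"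
    "\<And>M. M \<in> form ` D \<Longrightarrow> e M ** (inv_into D form M) = mat 1" by metis
  have "bounded (\<Union>M\<in>form ` D. {x ** y | x y. x \<in> {emb (e M)} \<and> y \<in> U})"
    by (intro bounded_UN fin ballI bounded_matrix_mult bU) auto
  then obtain R where R0: "\<forall>z\<in>(\<Union>M\<in>form ` D. {x ** y | x y. x \<in> {emb (e M)} \<and> y \<in> U}). norm z \<le> R"
    unfolding bounded_iff by (rule exE)
  have R: "norm (emb (e M) ** u) \<le> R" if "M \<in> form ` D" "u \<in> U" for M u
    by (rule R0[rule_format], rule UN_I[OF that(1)]) (use that(2) in auto)
  show ?thesis
  proof (rule that[of "N_grp \<inter> cball 0 R"])
    show "compact (N_grp \<inter> cball 0 R :: (real, 'n) sqmat set)"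
      by (intro closed_Int_compact closed_N_grp compact_cball)
    fix u :: "(real, 'n) sqmat" assume u: "u \<in> N_grp"
    then have uu: "unipotent u" by (simp add: N_grp_unipotent)
    obtain d where d: "unipotent (emb d)" "unipotent (emb d ** u)"
      "\<And>i j. j < i \<Longrightarrow> (emb d ** u) $ i $ j \<in> {0..<1}"
      by (rule unipotent_reduction[OF uu], rule that)
    have dU: "emb d ** u \<in> U" using d by (simp add: U_def)
    then have dD: "d \<in> D" using d u by (auto simp: D_def)
    define M where "M = form d"
    have M: "M \<in> form ` D" using dD by (simp add: M_def)
    define d' where "d' = inv_into D form M"
    have fd': "form d' = form d" unfolding d'_def using M by (metis M_def f_inv_into_f)
    have ed: "e M ** d' = mat 1" using e(2)[OF M] by (simp add: d'_def)
    \<comment> \<open>\<open>d\<close> and the chosen representative \<open>d'\<close> have the same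
      form, so \<open>d'\<inverse> d\<close> is orthogonal. The factor
      \<open>e M = d'\<inverse>\<close> comes from a finite set, so the result stays
      bounded.\<close>
    define n where "n = e M ** d"
    have "n ** antidiag ** transpose n = e M ** form d ** transpose (e M)"
      by (simp add: n_def form_def matrix_transpose_mul matrix_mul_assoc)
    also have "\<dots> = (e M ** d') ** antidiag ** transpose (e M ** d')"
      unfolding fd'[symmetric] by (simp add: form_def matrix_transpose_mul matrix_mul_assoc)
    finally have "n \<in> OA" by (simp add: ed OA_dual_form)
    moreover have "unipotent (emb n)" unfolding n_def emb_mult by (intro unipotent_mult d e M)
    ultimately have nN: "n \<in> N_int" by (simp add: N_int_def N_grp_unipotent)
    have nu: "lmult n u = emb (e M) ** (emb d ** u)" by (simp add: n_def lmult_emb emb_mult matrix_mul_assoc)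
    have "lmult n u \<in> N_grp"
      using nN u by (simp add: lmult_emb N_int_def N_grp_unipotent unipotent_mult OA_mult)
    then show "\<exists>d\<in>N_int. lmult d u \<in> N_grp \<inter> cball 0 R"
      using nN R[OF M dU] nu by (intro bexI[of _ n]) auto
  qed auto
qed

section \<open>Integral elements permuting the middle coordinates\<close>

lemma near_sym: "near i j \<longleftrightarrow> near j i"
  unfolding near_def by (metis opp_opp)

lemma near_trans: "near i j \<Longrightarrow> near j k \<Longrightarrow> near i k"
  unfolding near_def by (metis opp_opp)

lemma near_opp: "near i j \<Longrightarrow> near (opp i) (opp j)"
  unfolding near_def using pos_opp_add[of i] pos_opp_add[of j] by fastforce

lemma near_opp_iff: "near (opp i) (opp j) \<longleftrightarrow> near i j"
  using near_opp[of i j] near_opp[of "opp i" "opp j"] by auto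

lemma near_cases:
  assumes "near i j" shows "j = i \<or> (j = opp i \<and> near i (opp i) \<and> i \<noteq> opp i)"
  using assms by (auto simp: near_def)

lemma near_between: "i < j \<Longrightarrow> near i j \<Longrightarrow> i < l \<Longrightarrow> \<not> l < j"
  by (auto simp: near_def pos_less_iff[symmetric])

lemma near_less:
  assumes "i < j" "\<not> near i j" "near i l" "near j a"
  shows "l < a"
  using assms unfolding near_iff_pos pos_inj[symmetric] pos_less_iff[symmetric]
  by (auto; linarith)

text \<open>The condition only restricts the support to blocks of size one and, for even
  \<open>n\<close>, a middle block of size two. That such matrices are signed permutations is a
  consequence of integrality.\<close>

definition W_int :: "(int, 'n::{finite,linorder}) sqmat set" where
  "W_int = {w \<in> OA. \<forall>i j. w $ i $ j \<noteq> 0 \<longrightarrow> near i j}"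

lemma W_int_nth: "w \<in> W_int \<Longrightarrow> \<not> near i j \<Longrightarrow> w $ i $ j = 0"
  by (auto simp: W_int_def)

lemma W_int_adj: "w \<in> W_int \<Longrightarrow> adj w \<in> W_int"
  by (auto simp: W_int_def adj_nth) (metis near_opp_iff near_sym)

lemma W_int_mult: "v \<in> W_int \<Longrightarrow> w \<in> W_int \<Longrightarrow> v ** w \<in> W_int"
proof -
  assume v: "v \<in> W_int" and w: "w \<in> W_int"
  have "near i j" if nz: "(v ** w) $ i $ j \<noteq> 0" for i j
  proof -
    have "(\<Sum>l\<in>UNIV. v $ i $ l * w $ l $ j) \<noteq> 0" using nz by (simp add: matrix_matrix_mult_def)
    then obtain l where "v $ i $ l * w $ l $ j \<noteq> 0" by (rule sum.not_neutral_contains_not_neutral)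
    then have "near i l" "near l j" using v w by (auto simp: W_int_def)
    then show ?thesis by (rule near_trans)
  qed
  then show ?thesis using v w by (auto simp: W_int_def OA_mult)
qed

lemma W_int_one: "mat 1 \<in> W_int"
  using OA_one unfolding W_int_def by (simp, simp add: mat_def near_def)

lemma sum_near:
  fixes f :: "'n::{finite,linorder} \<Rightarrow> 'a::comm_monoid_add"
  assumes "\<And>l. \<not> near i l \<Longrightarrow> f l = 0"
  shows "(\<Sum>l\<in>UNIV. f l) = (if near i (opp i) \<and> i \<noteq> opp i then f i + f (opp i) else f i)"
proof -
  have "(\<Sum>l\<in>UNIV. f l) = (\<Sum>l\<in>{l. near i l}. f l)"
    by (rule sum.mono_neutral_right) (auto simp: assms)
  also have "{l. near i l} = (if near i (opp i) \<and> i \<noteq> opp i then {i, opp i} else {i})"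
    using near_cases[of i] by (auto simp: near_def)
  finally show ?thesis by auto
qed

text \<open>The columns \<open>(a, c)\<close> and \<open>(b, d)\<close> are isotropic vectors of a
  hyperbolic plane, so they lie on the axes; their pairing 1 forces the remaining entries to be
  units.\<close>

lemma int_hyperbolic_plane:
  fixes a b c d :: int
  assumes "a * c = 0" "b * d = 0" "a * d + b * c = 1"
  shows "a * a + c * c = 1 \<and> b * b + d * d = 1 \<and> a * b + c * d = 0"
proof (cases "a = 0")
  case True
  then have "b * c = 1" using assms by simp
  then have "b * b = 1" "c * c = 1" "d = 0" "b \<noteq> 0" using assms(2) by (auto simp: zmult_eq_1_iff)
  then show ?thesis using True by simp
next
  case False
  then have "c = 0" using assms by simp
  then have "a * d = 1" using assms by simp
  then have "a * a = 1" "d * d = 1" "b = 0" using assms(2) by (auto simp: zmult_eq_1_iff)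
  then show ?thesis using \<open>c = 0\<close> by simp
qed

lemma W_int_orthogonal:
  assumes w: "w \<in> W_int"
  shows "transpose w ** w = mat 1"
proof -
  have form: "(\<Sum>l\<in>UNIV. w $ l $ i * w $ opp l $ j) = (if j = opp i then 1 else 0)" for i j
    using arg_cong[of _ _ "\<lambda>x. x $ i $ j", OF form_iff_adj[THEN iffD2, of w]] w
    by (auto simp: form_nth antidiag_nth W_int_def OA_adj)
  have z: "w $ l $ i = 0" if "\<not> near i l" for i l using W_int_nth[OF w] that near_sym by blast
  have "(\<Sum>l\<in>UNIV. w $ l $ i * w $ l $ j) = (if i = j then 1 else 0)" for i j
  proof (cases "near i (opp i) \<and> i \<noteq> opp i")
    case pair: True
    define a b c d where "a = w $ i $ i" and "b = w $ i $ opp i" and "c = w $ opp i $ i" and "d = w $ opp i $ opp i"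
    have 1: "(\<Sum>l\<in>UNIV. w $ l $ i * w $ opp l $ i) = a * c + c * a"
      "(\<Sum>l\<in>UNIV. w $ l $ i * w $ opp l $ opp i) = a * d + c * b"
      using pair by (simp_all add: sum_near[of i "\<lambda>l. w $ l $ i * _ l"] z a_def b_def c_def d_def)
    have z': "w $ l $ opp i = 0" if "\<not> near i l" for l
      using z[of "opp i" l] that pair near_trans near_sym by blast
    have 2: "(\<Sum>l\<in>UNIV. w $ l $ opp i * w $ opp l $ opp i) = b * d + d * b"
      using pair by (simp add: sum_near[of i "\<lambda>l. w $ l $ opp i * _ l"] z' a_def b_def c_def d_def)
    have "a * c + c * a = 0" "b * d + d * b = 0" "a * d + b * c = 1"
      using form[of i i] form[of "opp i" "opp i"] form[of i "opp i"] 1 2 pair by (auto simp: mult.commute)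
    then have *: "a * a + c * c = 1 \<and> b * b + d * d = 1 \<and> a * b + c * d = 0"
      by (intro int_hyperbolic_plane) auto
    consider "j = i" | "j = opp i" | "\<not> near i j" using near_cases[of i j] by blast
    then show ?thesis
    proof cases
      case 1
      then show ?thesis using * pair
        by (simp add: sum_near[of i "\<lambda>l. w $ l $ i * w $ l $ i"] z a_def c_def)
    next
      case 2
      then show ?thesis using * pair
        by (simp add: sum_near[of i "\<lambda>l. w $ l $ i * w $ l $ opp i"] z a_def b_def c_def d_def)
    next
      case 3
      then have "w $ l $ i * w $ l $ j = 0" for l using z near_trans near_sym by (metis mult_zero_left mult_zero_right)
      then have "(\<Sum>l\<in>UNIV. w $ l $ i * w $ l $ j) = 0" by (intro sum.neutral) blast
      then show ?thesis using 3 by (auto simp: near_def)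
    qed
  next
    case single: False
    have n1: "near i l \<longleftrightarrow> l = i" for l using near_cases[of i l] single by (auto simp: near_def)
    have "(\<Sum>l\<in>UNIV. w $ l $ i * w $ opp l $ opp i) = w $ i $ i * w $ opp i $ opp i"
      using sum_near[of i "\<lambda>l. w $ l $ i * w $ opp l $ opp i"] single z by simp
    then have "w $ i $ i * w $ opp i $ opp i = 1" using form[of i "opp i"] by simp
    then have "w $ i $ i * w $ i $ i = 1" by (auto simp: zmult_eq_1_iff)
    moreover have "(\<Sum>l\<in>UNIV. w $ l $ i * w $ l $ j) = w $ i $ i * w $ i $ j"
      using sum_near[of i "\<lambda>l. w $ l $ i * w $ l $ j"] single z by simp
    moreover have "w $ i $ j = 0" if "i \<noteq> j" using W_int_nth[OF w] n1 that by auto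
    ultimately show ?thesis by auto
  qed
  then show ?thesis by (simp add: vec_eq_iff matrix_matrix_mult_def transpose_def mat_def)
qed

lemma W_int_K_std:
  assumes w: "w \<in> W_int" shows "emb w \<in> K_std"
proof -
  have "transpose (emb w) ** emb w = mat 1"
    using W_int_orthogonal[OF w] by (simp add: emb_transpose[symmetric] emb_mult[symmetric])
  then show ?thesis using w by (simp add: K_std_def orthogonal_matrix W_int_def)
qed

lemma W_int_row_norm:
  assumes w: "w \<in> W_int" shows "(\<Sum>l\<in>UNIV. (w $ i $ l) * (w $ j $ l)) = (if i = j then 1 else 0)"
proof -
  have "emb w ** transpose (emb w) = mat 1"
    using W_int_K_std[OF w] by (simp add: K_std_def orthogonal_matrix_def)
  then have "w ** transpose w = mat 1"
    by (simp add: emb_transpose[symmetric] emb_mult[symmetric] emb_one[symmetric] del: emb_one)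
  then have "(w ** transpose w) $ i $ j = (if i = j then 1 else 0)" by (simp add: mat_def)
  then show ?thesis by (simp add: matrix_matrix_mult_def transpose_def)
qed

text \<open>A unipotent isometry of a hyperbolic plane is trivial. Concretely, for
  \<open>j < i\<close>, column \<open>j\<close> is isotropic, and by triangularity only the rows
  \<open>j\<close> and \<open>opp j\<close> contribute to this equation.\<close>

lemma B_grp_near:
  assumes b: "b \<in> B_grp" and "near i j" "i \<noteq> j"
  shows "b $ i $ j = 0"
proof (cases "i < j")
  case True
  then show ?thesis using b by (simp add: B_grp_def lowpos_def lowtri_def)
next
  case False
  then have ji: "j < i" and i: "i = opp j" using assms by (auto simp: near_def)
  have "(\<Sum>l\<in>UNIV. b $ l $ j * b $ opp l $ j) = 0"
    using arg_cong[of _ _ "\<lambda>x. x $ j $ j", OF form_iff_adj[THEN iffD2, of b]] OA_D(1)[OF B_grp_OA[OF b]] ji i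
    by (simp add: form_nth antidiag_nth)
  moreover have "b $ l $ j * b $ opp l $ j = 0" if "\<not> near j l" for l
  proof -
    have "l < j \<or> opp l < j"
    proof (rule ccontr)
      assume "\<not> ?thesis"
      then have "j \<le> l" "l \<le> i" using i opp_le[of "opp l" j] by auto
      moreover have "\<not> (j < l \<and> l < i)" using near_between[OF ji] assms(2) near_sym by blast
      ultimately have "l = j \<or> l = i" by auto
      then show False using that assms(2) near_sym by (auto simp: near_def)
    qed
    then show ?thesis using b by (auto simp: B_grp_def lowpos_def lowtri_def)
  qed
  ultimately have "b $ j $ j * b $ i $ j + b $ i $ j * b $ j $ j = 0"
    using sum_near[of j "\<lambda>l. b $ l $ j * b $ opp l $ j"] assms(2) i ji near_sym[of i j]
    by (auto simp: less_imp_neq)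
  then show ?thesis using b by (simp add: B_grp_def lowpos_def less_le)
qed

text \<open>A term with \<open>l \<noteq> a\<close> would need a nonzero entry of \<open>b\<close>
  above the diagonal or off the diagonal of the middle block, and there is none.\<close>

lemma W_int_conj_nth:
  assumes w: "w \<in> W_int" and b: "b \<in> B_grp" and "near i j \<or> i < j"
  shows "(emb w ** b ** adj (emb w)) $ i $ j
    = (\<Sum>l\<in>UNIV. of_int (w $ i $ l) * of_int (w $ j $ l) * b $ l $ l)"
proof -
  have "adj (emb w) = transpose (emb w)" by (rule K_std_transpose[OF W_int_K_std[OF w]])
  then have "(emb w ** b ** adj (emb w)) $ i $ j
      = (\<Sum>a\<in>UNIV. \<Sum>l\<in>UNIV. of_int (w $ i $ l) * b $ l $ a * of_int (w $ j $ a))"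
    by (simp add: matrix_matrix_mult_def transpose_def sum_distrib_right)
  also have "\<dots> = (\<Sum>a\<in>UNIV. \<Sum>l\<in>UNIV. if l = a then of_int (w $ i $ l) * of_int (w $ j $ l) * b $ l $ l else 0)"
  proof (intro sum.cong refl)
    fix a l
    show "of_int (w $ i $ l) * b $ l $ a * of_int (w $ j $ a)
      = (if l = a then of_int (w $ i $ l) * of_int (w $ j $ l) * b $ l $ l else 0)"
    proof (cases "w $ i $ l = 0 \<or> w $ j $ a = 0 \<or> l = a")
      case False
      then have il: "near i l" and ja: "near j a" and la: "l \<noteq> a" using W_int_nth[OF w] by blast+
      have "near l a \<or> l < a"
      proof (cases "near i j")
        case True
        then show ?thesis using il ja near_trans near_sym by blast
      next
        case False
        then have ij: "i < j" using assms(3) by blast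
        then have "l < a" using near_less[OF _ False il ja] by blast
        then show ?thesis by blast
      qed
      then have "b $ l $ a = 0" using B_grp_near[OF b] la b by (auto simp: B_grp_def lowpos_def lowtri_def)
      then show ?thesis using la by simp
    qed auto
  qed
  also have "\<dots> = (\<Sum>l\<in>UNIV. of_int (w $ i $ l) * of_int (w $ j $ l) * b $ l $ l)"
    by (simp cong: if_cong)
  finally show ?thesis .
qed

text \<open>By uniqueness of the Iwasawa decomposition this makes \<open>W_int\<close> act on the
  compact coordinate by left multiplication.\<close>

lemma W_int_conj_B:
  assumes w: "w \<in> W_int" and b: "b \<in> B_grp"
  shows "emb w ** b ** adj (emb w) \<in> B_grp"
proof (rule B_grp_nonneg_diag)
  have wO: "emb w \<in> OA" using w by (simp add: W_int_def)
  show "emb w ** b ** adj (emb w) \<in> OA" using wO B_grp_OA[OF b] by (simp add: OA_mult)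
  have bp: "b $ l $ l > 0" for l using b by (simp add: B_grp_def lowpos_def)
  show "0 \<le> (emb w ** b ** adj (emb w)) $ i $ i" for i
  proof -
    have "(emb w ** b ** adj (emb w)) $ i $ i = (\<Sum>l\<in>UNIV. of_int (w $ i $ l) * of_int (w $ i $ l) * b $ l $ l)"
      by (rule W_int_conj_nth[OF w b]) (simp add: near_def)
    also have "\<dots> \<ge> 0"
      by (rule sum_nonneg, rule mult_nonneg_nonneg, rule zero_le_square, rule less_imp_le, rule bp)
    finally show ?thesis .
  qed
  show "lowtri (emb w ** b ** adj (emb w))"
    unfolding lowtri_def
  proof (intro allI impI)
    fix i j :: 'a assume ij: "i < j"
    have "(\<Sum>l\<in>UNIV. of_int (w $ i $ l) * of_int (w $ j $ l) * b $ l $ l) = 0"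
    proof (cases "near i j")
      case False
      then have "w $ i $ l = 0 \<or> w $ j $ l = 0" for l using W_int_nth[OF w] near_trans near_sym by blast
      then show ?thesis by (intro sum.neutral) auto
    next
      case True
      then have j: "j = opp i" and ne: "i \<noteq> opp i" using ij by (auto simp: near_def)
      define e where "e l = w $ i $ l * w $ j $ l" for l
      have "e i + e j = 0"
      proof -
        have "(\<Sum>l\<in>UNIV. e l) = 0" using W_int_row_norm[OF w, of i j] ij by (simp add: e_def)
        moreover have "\<And>l. \<not> near i l \<Longrightarrow> e l = 0" using W_int_nth[OF w] by (simp add: e_def)
        ultimately show ?thesis using sum_near[of i e] True ij j ne by simp
      qed
      have "adj w \<in> W_int" "w \<in> OA" using W_int_adj w by (auto simp: W_int_def)
      \<comment> \<open>Row \<open>i\<close> is isotropic, so one of its two entries in the middle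
        block vanishes, and with it one of the products; the other follows from the orthogonality of
        the rows.\<close>
      have "e i = 0 \<and> e j = 0"
      proof -
        have f: "(\<Sum>l\<in>UNIV. w $ i $ l * w $ i $ opp l) = 0"
        proof -
          have "w ** (antidiag ** transpose w) = antidiag"
            using OA_dual_form[THEN iffD1, OF \<open>w \<in> OA\<close>] by (simp add: matrix_mul_assoc)
          then have "(w ** (antidiag ** transpose w)) $ i $ i = 0" using ne by (simp add: antidiag_nth)
          then show ?thesis
            unfolding matrix_matrix_mult_def[of w "antidiag ** transpose w"] by (simp add: antidiag_mult) (simp add: transpose_def)
        qed
        have "\<And>l. \<not> near i l \<Longrightarrow> w $ i $ l * w $ i $ opp l = 0" using W_int_nth[OF w] by simp
        with f have "w $ i $ i * w $ i $ j + w $ i $ j * w $ i $ i = 0"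
          using sum_near[of i "\<lambda>l. w $ i $ l * w $ i $ opp l"] True ij j ne by simp
        then have "w $ i $ i = 0 \<or> w $ i $ j = 0" by auto
        then show ?thesis using \<open>e i + e j = 0\<close> by (auto simp: e_def)
      qed
      moreover have "of_int (w $ i $ l) * of_int (w $ j $ l) * b $ l $ l = of_int (e l) * b $ l $ l" for l
        by (simp add: e_def)
      ultimately show ?thesis
        using sum_near[of i "\<lambda>l. of_int (e l) * b $ l $ l"] W_int_nth[OF w, of i] True ij j ne by (auto simp: e_def)
    qed
    then show "(emb w ** b ** adj (emb w)) $ i $ j = 0" using W_int_conj_nth[OF w b, of i j] ij by simp
  qed
qed

text \<open>For even \<open>n\<close> and \<open>m = n div 2\<close> the only case with
  \<open>j \<noteq> k\<close> exchanges the pairs \<open>(m - 1, m)\<close> and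
  \<open>(m - 1, m + 1)\<close>. The conditions on \<open>T\<close> are thus symmetric under the
  swap of the middle coordinates.\<close>

lemma simple_pair_near: "simple_pair i j \<Longrightarrow> near j k \<Longrightarrow> simple_pair i k"
proof -
  assume sp: "simple_pair i j" and jk: "near j k"
  show ?thesis
  proof (cases "j = k")
    case False
    then have k: "k = opp j" "pos j = pos k + 1 \<or> pos k = pos j + 1" using jk unfolding near_def by blast+
    then have sum: "pos j + pos k = CARD('a) + 1" using pos_opp_add[of j] by simp
    have sp': "pos i \<le> (CARD('a) - 1) div 2"
      "pos j = pos i + 1 \<or> (even CARD('a) \<and> pos j = CARD('a) div 2 + 1 \<and> pos i + 1 = CARD('a) div 2)"
      using sp unfolding simple_pair_pos by blast+
    from k(2) show ?thesis
    proof
      assume "pos j = pos k + 1"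
      then have n: "CARD('a) = 2 * pos k" "pos j = pos k + 1" using sum by auto
      then have "pos i < pos k" using sp'(1) pos_range(1)[of k] by auto
      then show ?thesis using sp' n by (auto simp: simple_pair_pos)
    next
      assume "pos k = pos j + 1"
      then have "CARD('a) = 2 * pos j" "pos k = pos j + 1" using sum by auto
      then show ?thesis using sp' by (auto simp: simple_pair_pos)
    qed
  qed (use sp in simp)
qed

text \<open>The first member of a simple pair is a block by itself, so its entry is unchanged. The
  entry at \<open>j\<close> becomes a mean of the entries near \<open>j\<close>, weighted with the
  squares of a row of \<open>w\<close>, and all of these satisfy the same bound.\<close>

lemma W_int_conj_simple:
  assumes w: "w \<in> W_int" and b: "b \<in> B_grp"
    and sp: "\<And>i j. simple_pair i j \<Longrightarrow> c * b $ i $ i < b $ j $ j" and ij: "simple_pair i j"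
  shows "c * (emb w ** b ** adj (emb w)) $ i $ i < (emb w ** b ** adj (emb w)) $ j $ j"
proof -
  have rows: "(\<Sum>l\<in>UNIV. real_of_int (w $ k $ l) * of_int (w $ k $ l)) = 1" for k
    using arg_cong[OF W_int_row_norm[OF w, of k k], of real_of_int] by simp
  have ii: "near i l \<longleftrightarrow> l = i" for l
  proof
    assume "near i l"
    then have "i = l \<or> pos i + pos l = CARD('a) + 1 \<and> (pos i = pos l + 1 \<or> pos l = pos i + 1)"
      unfolding near_iff_pos .
    moreover have h: "pos i \<le> (CARD('a) - 1) div 2" "2 * ((CARD('a) - 1) div 2) \<le> CARD('a) - 1"
      using ij by (simp_all add: simple_pair_pos)
    have False if "pos i + pos l = CARD('a) + 1" "pos i = pos l + 1 \<or> pos l = pos i + 1"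
      using that(2)
    proof
      assume "pos i = pos l + 1" then show False using h that(1) by linarith
    next
      assume "pos l = pos i + 1" then show False using h that(1) pos_range(2)[of l] by linarith
    qed
    ultimately show "l = i" by blast
  qed (auto simp: near_def)
  have "(emb w ** b ** adj (emb w)) $ i $ i = (\<Sum>l\<in>UNIV. of_int (w $ i $ l) * of_int (w $ i $ l) * b $ i $ i)"
  proof -
    have "near i i" by (simp add: near_def)
    moreover have "of_int (w $ i $ l) * of_int (w $ i $ l) * b $ l $ l = of_int (w $ i $ l) * of_int (w $ i $ l) * b $ i $ i" for l
      using W_int_nth[OF w, of i l] ii[of l] by (cases "l = i") auto
    ultimately show ?thesis using W_int_conj_nth[OF w b, of i i] by (simp only: simp_thms)
  qed
  also have "\<dots> = b $ i $ i" using rows[of i] by (simp add: sum_distrib_right[symmetric])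
  finally have 1: "(emb w ** b ** adj (emb w)) $ i $ i = b $ i $ i" .
  have 2: "(emb w ** b ** adj (emb w)) $ j $ j = (\<Sum>l\<in>UNIV. of_int (w $ j $ l) * of_int (w $ j $ l) * b $ l $ l)"
    using W_int_conj_nth[OF w b, of j j] by (auto simp: near_def)
  have "c * b $ i $ i = (\<Sum>l\<in>UNIV. of_int (w $ j $ l) * of_int (w $ j $ l) * (c * b $ i $ i))"
    using rows[of j] by (simp add: sum_distrib_right[symmetric])
  also have "\<dots> < (\<Sum>l\<in>UNIV. of_int (w $ j $ l) * of_int (w $ j $ l) * b $ l $ l)"
  proof (rule sum_strict_mono_ex1)
    have lt: "c * b $ i $ i < b $ l $ l" if "w $ j $ l \<noteq> 0" for l
      using W_int_nth[OF w] that simple_pair_near[OF ij] sp by blast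
    show "\<forall>l\<in>UNIV. real_of_int (w $ j $ l) * of_int (w $ j $ l) * (c * b $ i $ i) \<le> of_int (w $ j $ l) * of_int (w $ j $ l) * b $ l $ l"
    proof
      fix l
      show "real_of_int (w $ j $ l) * of_int (w $ j $ l) * (c * b $ i $ i) \<le> of_int (w $ j $ l) * of_int (w $ j $ l) * b $ l $ l"
        using lt[of l] by (cases "w $ j $ l = 0") (auto intro: mult_left_mono)
    qed
    have "\<exists>l. w $ j $ l \<noteq> 0" using rows[of j] by (rule_tac ccontr) simp
    then obtain l where l: "w $ j $ l \<noteq> 0" by blast
    show "\<exists>l\<in>UNIV. real_of_int (w $ j $ l) * of_int (w $ j $ l) * (c * b $ i $ i) < of_int (w $ j $ l) * of_int (w $ j $ l) * b $ l $ l"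
      using lt[OF l] l by (intro bexI[of _ l] mult_strict_left_mono) (auto simp: zero_less_mult_iff linorder_neq_iff)
  qed simp
  finally show ?thesis using 1 2 by simp
qed

section \<open>Intersections of translates of a Siegel set near the cusp\<close>

lemma norm_vmult_K_std:
  assumes "k \<in> K_std" shows "norm (u v* k) = norm u"
proof -
  have "k ** transpose k = mat 1" using assms by (simp add: K_std_def orthogonal_matrix_def)
  moreover have "u v* k = transpose k *v u" by (simp add: transpose_matrix_vector)
  ultimately have "k *v (u v* k) = u" by (simp only: matrix_vector_mul_assoc matrix_vector_mul_lid)
  then have "(u v* k) \<bullet> (u v* k) = u \<bullet> u" by (simp add: dot_lmul_matrix)
  then show ?thesis by (simp add: norm_eq)
qed

lemma norm_vmult_iwB: "x \<in> OA \<Longrightarrow> norm (u v* x) = norm (u v* iwB x)"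
  by (metis iwasawa(1,3) norm_vmult_K_std vector_matrix_mul_assoc)

lemma vmult_nth: "(u v* b) $ j = (\<Sum>l\<in>UNIV. u $ l * b $ l $ j)"
  by (simp add: vector_matrix_mult_def)

text \<open>Together with \<open>diag_attained\<close> this identifies \<open>b $ j $ j\<close> as
  the distance of row \<open>j\<close> of \<open>b\<close> from the span of the rows before it. The
  bound holds because coordinate \<open>j\<close> of \<open>u v* b\<close> sees only row
  \<open>j\<close>.\<close>

lemma diag_le_norm:
  assumes b: "b \<in> B_grp" and u: "\<And>l. j < l \<Longrightarrow> u $ l = 0"
  shows "\<bar>u $ j\<bar> * b $ j $ j \<le> norm (u v* b)"
proof -
  have "(u v* b) $ j = (\<Sum>l\<in>UNIV. if l = j then u $ j * b $ j $ j else 0)"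
    unfolding vmult_nth
  proof (rule sum.cong[OF refl])
    fix l
    show "u $ l * b $ l $ j = (if l = j then u $ j * b $ j $ j else 0)"
      using u[of l] b by (cases l j rule: linorder_cases) (auto simp: B_grp_def lowpos_def lowtri_def)
  qed
  then have "\<bar>(u v* b) $ j\<bar> = \<bar>u $ j\<bar> * b $ j $ j"
    using b by (simp add: abs_mult B_grp_def lowpos_def less_imp_le)
  then show ?thesis using component_le_norm_cart[of "u v* b" j] by simp
qed

lemma lowtri_vmult_zero:
  assumes "lowtri b" "\<And>l. i \<le> l \<Longrightarrow> u $ l = 0" "i \<le> j"
  shows "(u v* b) $ j = 0"
  unfolding vmult_nth
proof (rule sum.neutral, rule ballI)
  fix l
  show "u $ l * b $ l $ j = 0"
    using assms by (cases "i \<le> l") (auto simp: lowtri_def not_le)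
qed

text \<open>Subtracting multiples of the first rows clears the first coordinates.\<close>

lemma clear_coordinates:
  assumes b: "b \<in> B_grp"
  obtains z where "\<And>l. i \<le> l \<Longrightarrow> z $ l = w $ l" "z v* b = (\<chi> l. if l < i then 0 else (w v* b) $ l)"
proof -
  define r where "r = (\<chi> l. if l < i then (w v* b) $ l else 0)"
  define z where "z = w - r v* adj b"
  have "(r v* adj b) $ l = 0" if "i \<le> l" for l
    using b that by (intro lowtri_vmult_zero[of _ i]) (auto simp: B_grp_def lowpos_def lowtri_adj r_def)
  then have "\<And>l. i \<le> l \<Longrightarrow> z $ l = w $ l" by (simp add: z_def)
  moreover have "z v* b = w v* b - r v* (adj b ** b)"
    by (simp add: z_def vec_eq_iff vmult_nth sum_subtractf algebra_simps vector_matrix_mul_assoc[symmetric])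
  then have "z v* b = w v* b - r" by (simp add: OA_D[OF B_grp_OA[OF b]])
  then have "z v* b = (\<chi> l. if l < i then 0 else (w v* b) $ l)" by (auto simp: vec_eq_iff r_def)
  ultimately show ?thesis using that by blast
qed

lemma diag_attained:
  assumes b: "b \<in> B_grp"
  obtains u where "u $ i = 1" "\<And>l. i < l \<Longrightarrow> u $ l = 0" "norm (u v* b) = b $ i $ i"
proof -
  obtain z where z: "\<And>l. i \<le> l \<Longrightarrow> z $ l = axis i 1 $ l"
    "z v* b = (\<chi> l. if l < i then 0 else (axis i 1 v* b) $ l)"
    by (rule clear_coordinates[OF b], rule that)
  have "(axis i 1 v* b) $ l = b $ i $ l" for l
    by (simp add: vmult_nth axis_def if_distrib[of "\<lambda>x. x * _"] cong: if_cong)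
  then have "z v* b = (b $ i $ i) *\<^sub>R axis i 1"
    using b by (auto simp: z(2) vec_eq_iff axis_def B_grp_def lowpos_def lowtri_def)
  then have "norm (z v* b) = b $ i $ i" using b by (simp add: B_grp_def lowpos_def less_imp_le)
  moreover have "z $ i = 1" "\<And>l. i < l \<Longrightarrow> z $ l = 0" using z(1) by (auto simp: axis_def)
  ultimately show ?thesis using that by blast
qed

lemma vmult_lmult: "u v* lmult g x = (u v* emb g) v* x"
  by (simp add: lmult_emb vector_matrix_mul_assoc)

text \<open>Take a combination of the rows of \<open>lmult g x\<close> up to \<open>i\<close>, with
  coefficient 1 at \<open>i\<close>, that has the length of the orthogonalised row \<open>i\<close>.
  Expressed in the rows of \<open>x\<close>, its last coefficient is the nonzero integer
  \<open>g $ i $ j\<close>, so its length is at least the diagonal entry of \<open>iwB x\<close> at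
  \<open>j\<close>. Row \<open>i\<close> of \<open>g\<close> cannot vanish from \<open>i\<close>
  onwards because the inverse is triangular in the rows before \<open>i\<close>.\<close>

lemma siegel_row:
  fixes g :: "(int, 'n::{finite,linorder}) sqmat"
  assumes g: "g \<in> OA" and x: "x \<in> OA"
    and low: "\<And>a l. a < i \<Longrightarrow> a < l \<Longrightarrow> g $ a $ l = 0" "\<And>a l. a < i \<Longrightarrow> a < l \<Longrightarrow> adj g $ a $ l = 0"
  obtains j where "i \<le> j" "g $ i $ j \<noteq> 0" "\<And>l. j < l \<Longrightarrow> g $ i $ l = 0"
    "iwB x $ j $ j \<le> iwB (lmult g x) $ i $ i"
proof -
  have y: "lmult g x \<in> OA" by (rule lmult_OA[OF g x])
  have bx: "iwB x \<in> B_grp" and by': "iwB (lmult g x) \<in> B_grp" using iwasawa x y by auto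
  have "\<exists>l\<ge>i. g $ i $ l \<noteq> 0"
  proof (rule ccontr)
    assume "\<not> ?thesis"
    then have "g $ i $ l * adj g $ l $ i = 0" for l using low(2)[of l i] by (cases "i \<le> l") auto
    then have "(\<Sum>l\<in>UNIV. g $ i $ l * adj g $ l $ i) = 0" by (intro sum.neutral) blast
    then have "(g ** adj g) $ i $ i = 0" by (simp add: matrix_matrix_mult_def)
    then show False by (simp add: OA_D[OF g] mat_def)
  qed
  then obtain l0 where l0: "i \<le> l0" "g $ i $ l0 \<noteq> 0" by blast
  define j where "j = Max {l. g $ i $ l \<noteq> 0}"
  have jge: "l \<le> j" if "g $ i $ l \<noteq> 0" for l unfolding j_def using that by (intro Max_ge) auto
  have "j \<in> {l. g $ i $ l \<noteq> 0}" unfolding j_def using l0(2) by (intro Max_in) auto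
  then have j: "g $ i $ j \<noteq> 0" "l0 \<le> j" using jge[OF l0(2)] by auto
  have jmax: "g $ i $ l = 0" if "j < l" for l using jge[of l] that leD by blast
  obtain u where u: "u $ i = 1" "\<And>l. i < l \<Longrightarrow> u $ l = 0"
    "norm (u v* iwB (lmult g x)) = iwB (lmult g x) $ i $ i"
    by (rule diag_attained[OF by'], rule that)
  have ug: "(u v* emb g) $ l = of_int (g $ i $ l)" if "i \<le> l" for l
  proof -
    have "(u v* emb g) $ l = (\<Sum>a\<in>UNIV. if a = i then of_int (g $ i $ l) else 0)"
      unfolding vmult_nth
    proof (rule sum.cong[OF refl])
      fix a
      show "u $ a * emb g $ a $ l = (if a = i then of_int (g $ i $ l) else 0)"
        using u(1) u(2)[of a] low(1)[of a l] that by (cases a i rule: linorder_cases) auto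
    qed
    then show ?thesis by simp
  qed
  have "iwB x $ j $ j \<le> \<bar>(u v* emb g) $ j\<bar> * iwB x $ j $ j"
  proof -
    have "1 \<le> \<bar>g $ i $ j\<bar>" using j(1) by linarith
    then have "1 \<le> \<bar>(u v* emb g) $ j\<bar>" using ug[of j] l0(1) j(2) by (simp del: of_int_abs add: of_int_abs[symmetric])
    moreover have "0 \<le> iwB x $ j $ j" using bx by (simp add: B_grp_def lowpos_def less_imp_le)
    ultimately show ?thesis using mult_right_mono by fastforce
  qed
  also have "\<dots> \<le> norm ((u v* emb g) v* iwB x)"
    using jmax ug l0(1) j(2) by (intro diag_le_norm[OF bx]) auto
  also have "\<dots> = norm (u v* lmult g x)" by (simp add: vmult_lmult norm_vmult_iwB[OF x, symmetric])
  also have "\<dots> = iwB (lmult g x) $ i $ i" using u(3) norm_vmult_iwB[OF y] by simp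
  finally show ?thesis using that[of j] j jmax l0(1) by (meson order_trans)
qed

text \<open>Applied to \<open>g\<close> and to \<open>adj g\<close>, \<open>siegel_row\<close>
  bounds the diagonal entries for \<open>x\<close> and \<open>lmult g x\<close> at \<open>i\<close>
  by each other. As the entries behind \<open>i\<close> are strictly larger, the index found must be
  \<open>i\<close> both times, so row \<open>i\<close> ends at the diagonal.\<close>

lemma siegel_triangular:
  fixes g :: "(int, 'n::{finite,linorder}) sqmat"
  assumes n: "CARD('n) \<ge> 3" and g: "g \<in> OA" and x: "x \<in> OA"
    and tx: "diagm (iwB x) \<in> T_above 1" and ty: "diagm (iwB (lmult g x)) \<in> T_above 1"
    and ij: "i < j" "\<not> near i j"
  shows "g $ i $ j = 0"
proof -
  let ?h = "(CARD('n) - 1) div 2"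
  have y: "lmult g x \<in> OA" by (rule lmult_OA[OF g x])
  have lt: "iwB x $ i $ i < iwB x $ j $ j" "iwB (lmult g x) $ i $ i < iwB (lmult g x) $ j $ j"
    if "pos i \<le> ?h" "i < j" for i j
    using T_above_one_less[OF n tx that] T_above_one_less[OF n ty that] by (simp_all add: diagm_nth)
  have main: "pos i \<le> ?h \<longrightarrow> (\<forall>l>i. g $ i $ l = 0 \<and> adj g $ i $ l = 0)" for i
  proof (induction i rule: finite_less_induct)
    case (less i)
    show ?case
    proof
      assume i: "pos i \<le> ?h"
      have low: "g $ a $ l = 0" "adj g $ a $ l = 0" if "a < i" "a < l" for a l
      proof -
        have "pos a \<le> ?h" using that(1) i by (simp add: pos_less_iff[symmetric])
        then show "g $ a $ l = 0" "adj g $ a $ l = 0" using less[OF that(1)] that(2) by blast+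
      qed
      obtain j1 where j1: "i \<le> j1" "\<And>l. j1 < l \<Longrightarrow> g $ i $ l = 0"
        "iwB x $ j1 $ j1 \<le> iwB (lmult g x) $ i $ i"
        by (rule siegel_row[OF g x, of i]) (use low in auto)
      have ag: "adj g \<in> OA" using g by simp
      obtain j2 where j2: "i \<le> j2" "\<And>l. j2 < l \<Longrightarrow> adj g $ i $ l = 0"
        "iwB (lmult g x) $ j2 $ j2 \<le> iwB x $ i $ i"
        by (rule siegel_row[OF ag y, of i]) (use low g in auto)
      have "iwB x $ i $ i \<le> iwB x $ j1 $ j1" using lt(1)[OF i, of j1] j1(1) by (cases "i = j1") (auto simp: le_less)
      moreover have "iwB (lmult g x) $ i $ i \<le> iwB (lmult g x) $ j2 $ j2"
        using lt(2)[OF i, of j2] j2(1) by (cases "i = j2") (auto simp: le_less)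
      ultimately have "\<not> iwB x $ i $ i < iwB x $ j1 $ j1" "\<not> iwB (lmult g x) $ i $ i < iwB (lmult g x) $ j2 $ j2"
        using j1(3) j2(3) by linarith+
      then have "j1 = i" "j2 = i" using lt[OF i] j1(1) j2(1) by (auto simp: le_less)
      then show "\<forall>l>i. g $ i $ l = 0 \<and> adj g $ i $ l = 0" using j1(2) j2(2) by blast
    qed
  qed
  show ?thesis
  proof (cases "pos i \<le> ?h")
    case True
    then show ?thesis using main ij by blast
  next
    case i: False
    \<comment> \<open>The lower rows of \<open>g\<close> are read off from the upper rows of
      \<open>adj g\<close>, at the pair \<open>(opp j, opp i)\<close>. Only the middle pair is out
      of reach.\<close>
    have "pos (opp j) \<le> ?h"
    proof (rule ccontr)
      assume "\<not> ?thesis"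
      then have "?h < pos i" "?h + pos j \<le> CARD('n)" "pos i < pos j"
        using i ij pos_opp_add[of j] by (auto simp: pos_less_iff)
      then have "pos i + pos j = CARD('n) + 1 \<and> pos j = pos i + 1" by presburger
      then show False using ij(2) by (simp add: near_iff_pos)
    qed
    then have "adj g $ opp j $ opp i = 0" using main ij(1) by simp
    then show ?thesis by (simp add: adj_nth)
  qed
qed

text \<open>The block diagonal part \<open>w\<close> of a block triangular isometry is again an
  isometry, since the form pairs each block with the opposite one and the other terms vanish by
  triangularity. Its orthogonality then makes \<open>g ** adj w\<close> unipotent.\<close>

lemma near_block_decomposition:
  fixes g :: "(int, 'n::{finite,linorder}) sqmat"
  assumes g: "g \<in> OA" and low: "\<And>i j. i < j \<Longrightarrow> \<not> near i j \<Longrightarrow> g $ i $ j = 0"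
  obtains u w where "u \<in> N_int" "w \<in> W_int" "g = u ** w"
proof -
  define w where "w = (\<chi> i j. if near i j then g $ i $ j else 0)"
  have "(\<Sum>l\<in>UNIV. w $ l $ i * w $ opp l $ j) = (if j = opp i then 1 else 0)" for i j
  proof (cases "near (opp i) j")
    case False
    have "w $ l $ i * w $ opp l $ j = 0" for l
    proof (rule ccontr)
      assume "w $ l $ i * w $ opp l $ j \<noteq> 0"
      then have "near l i" "near (opp l) j" by (auto simp: w_def split: if_splits)
      then show False using False near_opp near_trans near_sym by blast
    qed
    then have "(\<Sum>l\<in>UNIV. w $ l $ i * w $ opp l $ j) = 0" by (intro sum.neutral) blast
    then show ?thesis using False by (auto simp: near_def)
  next
    case True
    have "(\<Sum>l\<in>UNIV. w $ l $ i * w $ opp l $ j) = (\<Sum>l\<in>UNIV. g $ l $ i * g $ opp l $ j)"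
    proof (rule sum.cong[OF refl])
      fix l
      have n: "near (opp l) j \<longleftrightarrow> near l i"
        using True near_opp_iff[of l i] near_trans near_sym by blast
      show "w $ l $ i * w $ opp l $ j = g $ l $ i * g $ opp l $ j"
      proof (cases "near l i")
        case True
        then show ?thesis using n by (simp add: w_def)
      next
        case False
        then have "l < i \<or> i < l" by (auto simp: near_def)
        then have "l < i \<or> opp l < opp i" by simp
        moreover have "opp l < j" if "opp l < opp i"
        proof (rule ccontr)
          assume "\<not> opp l < j"
          then have "j \<le> opp l" by simp
          moreover have "j \<noteq> opp l" using n False by (auto simp: near_def)
          ultimately have "j < opp l" by simp
          then show False using near_between[of j "opp i" "opp l"] True that near_sym by (metis less_trans)
        qed
        ultimately have "g $ l $ i = 0 \<or> g $ opp l $ j = 0" using low False n by blast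
        then show ?thesis using False n by (auto simp: w_def)
      qed
    qed
    then show ?thesis
      using arg_cong[of _ _ "\<lambda>x. x $ i $ j", OF form_iff_adj[THEN iffD2, OF OA_D(1)[OF g]]]
      by (simp add: form_nth antidiag_nth)
  qed
  then have "transpose w ** antidiag ** w = antidiag" by (simp add: vec_eq_iff form_nth antidiag_nth)
  then have "w \<in> OA" by (simp add: OA_int form_iff_adj)
  then have wW: "w \<in> W_int" by (auto simp: W_int_def w_def split: if_splits)
  define u where "u = g ** adj w"
  have "emb w \<in> K_std" by (rule W_int_K_std[OF wW])
  then have "emb (adj w) = emb (transpose w)" by (simp add: emb_adj emb_transpose K_std_transpose)
  then have adjw: "adj w = transpose w" by simp
  have u: "u $ i $ j = (if i = j then 1 else 0)" if "i \<le> j" for i j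
  proof -
    have u0: "u $ i $ j = (\<Sum>l\<in>UNIV. g $ i $ l * w $ j $ l)"
      by (simp add: u_def adjw matrix_matrix_mult_def transpose_def)
    show ?thesis
    proof (cases "near i j")
      case True
      have "(\<Sum>l\<in>UNIV. g $ i $ l * w $ j $ l) = (\<Sum>l\<in>UNIV. w $ i $ l * w $ j $ l)"
      proof (rule sum.cong[OF refl])
        fix l
        have "w $ j $ l = 0 \<or> near i l" using True near_trans by (auto simp: w_def)
        then show "g $ i $ l * w $ j $ l = w $ i $ l * w $ j $ l" by (auto simp: w_def)
      qed
      then show ?thesis using u0 W_int_row_norm[OF wW] by simp
    next
      case False
      then have ij: "i < j" using that by (auto simp: near_def)
      have "g $ i $ l * w $ j $ l = 0" for l
      proof (cases "near j l")
        case jl: True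
        have "i < l"
        proof (rule ccontr)
          assume "\<not> i < l"
          moreover have "i \<noteq> l" using jl False near_sym by blast
          ultimately show False using near_between[of l j i] jl ij near_sym by (metis less_trans linorder_less_linear)
        qed
        moreover have "\<not> near i l" using jl False near_trans near_sym by blast
        ultimately show ?thesis using low by simp
      qed (simp add: w_def)
      then have "(\<Sum>l\<in>UNIV. g $ i $ l * w $ j $ l) = 0" by (intro sum.neutral) blast
      then show ?thesis using u0 False by (auto simp: near_def)
    qed
  qed
  have "u \<in> OA" using g \<open>w \<in> OA\<close> by (simp add: u_def OA_mult)
  then have "u \<in> N_int" using u by (auto simp: N_int_def N_grp_def)
  moreover have "g = u ** w" by (simp add: u_def OA_cancel_right[OF \<open>w \<in> OA\<close>])
  ultimately show ?thesis using that wW by blast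
qed

section \<open>Reduction\<close>

definition height :: "(real, 'n::{finite,linorder}) sqmat \<Rightarrow> (int, 'n) sqmat \<Rightarrow> 'n \<Rightarrow> real" where
  "height x g i = iwB (lmult g x) $ i $ i"

lemma iwB_B: "g \<in> OA \<Longrightarrow> x \<in> OA \<Longrightarrow> iwB (lmult g x) \<in> B_grp"
  by (intro iwasawa(2) lmult_OA)

lemma height_pos: "g \<in> OA \<Longrightarrow> x \<in> OA \<Longrightarrow> height x g i > 0"
  using iwB_B[of g x] by (simp add: height_def B_grp_def lowpos_def)

lemma height_le:
  assumes "g \<in> OA" "x \<in> OA" "u $ i = 1" "\<And>l. i < l \<Longrightarrow> u $ l = 0"
  shows "height x g i \<le> norm (u v* lmult g x)"
  using diag_le_norm[OF iwB_B[OF assms(1,2)], of i u] assms norm_vmult_iwB[OF lmult_OA[OF assms(1,2)], of u]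
  by (simp add: height_def)

lemma height_attained:
  assumes "g \<in> OA" "x \<in> OA"
  obtains u where "u $ i = 1" "\<And>l. i < l \<Longrightarrow> u $ l = 0" "norm (u v* lmult g x) = height x g i"
proof -
  obtain u where "u $ i = 1" "\<And>l. i < l \<Longrightarrow> u $ l = 0" "norm (u v* iwB (lmult g x)) = iwB (lmult g x) $ i $ i"
    by (rule diag_attained[OF iwB_B[OF assms], of i], rule that)
  then show ?thesis using that norm_vmult_iwB[OF lmult_OA[OF assms], of u] by (simp add: height_def)
qed

text \<open>The distance of row \<open>i\<close> from the span of the rows before it involves no
  later row.\<close>

lemma height_cong:
  assumes "g \<in> OA" "h \<in> OA" "x \<in> OA" "\<And>a l. a \<le> i \<Longrightarrow> g $ a $ l = h $ a $ l"
  shows "height x g i = height x h i"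
proof -
  have *: "height x g i \<le> height x h i"
    if "g \<in> OA" "h \<in> OA" "\<And>a l. a \<le> i \<Longrightarrow> g $ a $ l = h $ a $ l" for g h
  proof -
    have hO: "h \<in> OA" by (rule that(2))
    obtain u where u: "u $ i = 1" "\<And>l. i < l \<Longrightarrow> u $ l = 0" "norm (u v* lmult h x) = height x h i"
      by (rule height_attained[OF hO assms(3), of i], rule that)
    have *: "u $ a * emb g $ a $ l = u $ a * emb h $ a $ l" for a l
      using u(2)[of a] that(3)[of a l] by (cases "a \<le> i") auto
    have "u v* emb g = u v* emb h" by (simp only: vec_eq_iff vmult_nth *) simp
    then show ?thesis using height_le[OF that(1) assms(3) u(1,2)] u(3) by (simp add: vmult_lmult)
  qed
  show ?thesis using *[of g h] *[of h g] assms by (auto intro: antisym)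
qed

lemma height_N_int:
  assumes "u \<in> N_int" "g \<in> OA" "x \<in> OA"
  shows "iwB (lmult (u ** g) x) = emb u ** iwB (lmult g x)" "height x (u ** g) = height x g"
proof -
  have y: "lmult g x \<in> OA" using assms lmult_OA by blast
  have "lmult (u ** g) x = (emb u ** iwB (lmult g x)) ** iwK (lmult g x)"
    using iwasawa(3)[OF y] by (simp add: lmult_mult matrix_mul_assoc[symmetric]) (simp add: lmult_emb)
  moreover have uB: "emb u \<in> B_grp" "emb u \<in> N_grp" using assms(1) N_grp_B by (auto simp: N_int_def)
  ultimately show 1: "iwB (lmult (u ** g) x) = emb u ** iwB (lmult g x)"
    using iwasawa[OF y] by (simp add: iwasawa_eq B_grp_mult)
  show "height x (u ** g) = height x g"
  proof
    fix i
    have "diagm (emb u ** iwB (lmult g x)) $ i $ i = diagm (iwB (lmult g x)) $ i $ i"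
      using diagm_mult[OF uB(2) iwasawa(2)[OF y]] by simp
    then show "height x (u ** g) i = height x g i" by (simp add: height_def 1 diagm_nth)
  qed
qed

lemma OA_N_int: "u \<in> N_int \<Longrightarrow> u \<in> OA" by (simp add: N_int_def)

text \<open>After a reduction by \<open>N_int\<close>, bounded heights up to \<open>j\<close> leave only finitely many choices for the rows up to
  \<open>j\<close> of the integral matrix.\<close>

lemma finite_heights:
  fixes x :: "(real, 'n::{finite,linorder}) sqmat"
  assumes x: "x \<in> OA"
  shows "finite {height x g j | g. g \<in> OA \<and> (\<forall>i\<le>j. height x g i \<le> B)}"
proof -
  obtain C :: "(real, 'n) sqmat set" where C: "compact C" "C \<subseteq> N_grp"
    "\<And>u. u \<in> N_grp \<Longrightarrow> \<exists>d\<in>N_int. lmult d u \<in> C"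
    by (rule N_int_cocompact, rule that)
  \<comment> \<open>The heights behind \<open>j\<close> are not bounded, so only the rows up to
    \<open>j\<close> can be confined to a finite set; by \<open>height_cong\<close> they determine
    the height at \<open>j\<close>.\<close>
  define trunc :: "(int, 'n) sqmat \<Rightarrow> (int, 'n) sqmat" where
    "trunc g = (\<chi> i l. if i \<le> j then g $ i $ l else 0)" for g
  define G where "G = {g \<in> OA. (\<forall>i\<le>j. height x g i \<le> B) \<and> npart (iwB (lmult g x)) \<in> C}"
  obtain R where R: "\<And>u i l. u \<in> C \<Longrightarrow> \<bar>u $ i $ l\<bar> \<le> R"
    using compact_imp_bounded[OF C(1)] unfolding bounded_matrix_iff by blast
  \<comment> \<open>In the rows up to \<open>j\<close>, an entry of the triangular part is an entry
    of its unipotent part, bounded by \<open>R\<close>, times a height bounded by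
    \<open>B\<close>.\<close>
  define E where "E = {y :: (real, 'n) sqmat. \<forall>i l. \<bar>y $ i $ l\<bar> \<le> R * \<bar>B\<bar>}"
  have bE: "bounded E" unfolding bounded_matrix_iff E_def by blast
  have bT: "bounded {a ** b | a b. a \<in> {a ** b | a b. a \<in> E \<and> b \<in> K_std} \<and> b \<in> {adj x}}"
    by (intro bounded_matrix_mult bE compact_imp_bounded compact_K_std) simp
  have "emb (trunc g) \<in> {a ** b | a b. a \<in> {a ** b | a b. a \<in> E \<and> b \<in> K_std} \<and> b \<in> {adj x}}"
    if g: "g \<in> G" for g
  proof -
    have gO: "g \<in> OA" and gB: "\<And>i. i \<le> j \<Longrightarrow> height x g i \<le> B" and gC: "npart (iwB (lmult g x)) \<in> C"
      using g by (auto simp: G_def)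
    define b where "b = iwB (lmult g x)"
    define k where "k = iwK (lmult g x)"
    have y: "lmult g x \<in> OA" by (rule lmult_OA[OF gO x])
    have bk: "b \<in> B_grp" "k \<in> K_std" "b ** k = lmult g x" using iwasawa[OF y] by (auto simp: b_def k_def)
    define b' where "b' = (\<chi> i l. if i \<le> j then b $ i $ l else 0)"
    have "b' \<in> E"
      unfolding E_def
    proof (safe)
      fix i l
      show "\<bar>b' $ i $ l\<bar> \<le> R * \<bar>B\<bar>"
      proof (cases "i \<le> j \<and> l \<le> i")
        case True
        have "b $ i $ l = npart b $ i $ l * b $ l $ l"
          using arg_cong[OF npart_diagm[OF bk(1)], of "\<lambda>x. x $ i $ l"] by (simp add: mult_diagm_nth)
        moreover have "\<bar>npart b $ i $ l\<bar> \<le> R" using R gC by (simp add: b_def)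
        moreover have "\<bar>b $ l $ l\<bar> \<le> \<bar>B\<bar>"
          using gB[of l] height_pos[OF gO x, of l] True order_trans[of l i j] by (simp add: height_def b_def)
        ultimately have "\<bar>b $ i $ l\<bar> \<le> R * \<bar>B\<bar>" by (simp add: abs_mult mult_mono' )
        then show ?thesis using True by (simp add: b'_def)
      next
        case False
        then have "b' $ i $ l = 0" using bk(1) by (auto simp: b'_def B_grp_def lowpos_def lowtri_def not_le)
        moreover have "0 \<le> R" using R[OF gC] abs_ge_zero order_trans by blast
        ultimately show ?thesis by simp
      qed
    qed
    moreover have "emb (trunc g) = b' ** k ** adj x"
    proof -
      have "emb g = b ** k ** adj x" unfolding bk(3) lmult_emb OA_cancel_right(1)[OF x] ..
      moreover have "(b' ** k ** adj x) $ i $ l = (if i \<le> j then (b ** k ** adj x) $ i $ l else 0)" for i l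
        by (simp add: matrix_mul_assoc[symmetric]) (simp add: matrix_matrix_mult_def b'_def)
      ultimately have "(b' ** k ** adj x) $ i $ l = (if i \<le> j then emb g $ i $ l else 0)" for i l by simp
      then show ?thesis by (simp add: vec_eq_iff trunc_def)
    qed
    ultimately show ?thesis using bk(2) by blast
  qed
  then have "trunc ` G \<subseteq> {g. emb g \<in> {a ** b | a b. a \<in> {a ** b | a b. a \<in> E \<and> b \<in> K_std} \<and> b \<in> {adj x}}}"
    by blast
  then have fin: "finite (trunc ` G)" using finite_bounded_int_matrices[OF bT] finite_subset by blast
  have "{height x g j | g. g \<in> OA \<and> (\<forall>i\<le>j. height x g i \<le> B)} \<subseteq> (\<lambda>f. height x (inv_into G trunc f) j) ` (trunc ` G)"
  proof clarify
    fix g assume g: "g \<in> OA" "\<forall>i\<le>j. height x g i \<le> B"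
    have bB: "iwB (lmult g x) \<in> B_grp" by (rule iwB_B[OF g(1) x])
    obtain d where d: "d \<in> N_int" "lmult d (npart (iwB (lmult g x))) \<in> C" using C(3)[OF npart_N[OF bB]] by blast
    have dg: "d ** g \<in> OA" using d g OA_N_int by (intro OA_mult)
    have "npart (iwB (lmult (d ** g) x)) = lmult d (npart (iwB (lmult g x)))"
      unfolding height_N_int(1)[OF d(1) g(1) x] lmult_emb[of d]
      by (rule npart_mult[OF _ bB]) (use d(1) in \<open>simp add: N_int_def\<close>)
    then have "d ** g \<in> G" using d g dg height_N_int(2)[OF d(1) g(1) x] by (simp add: G_def)
    then have t: "trunc (d ** g) \<in> trunc ` G" by blast
    define g' where "g' = inv_into G trunc (trunc (d ** g))"
    have g': "g' \<in> G" "trunc g' = trunc (d ** g)" unfolding g'_def by (rule inv_into_into[OF t], rule f_inv_into_f[OF t])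
    have "g' $ a $ l = (d ** g) $ a $ l" if "a \<le> j" for a l
      using arg_cong[OF g'(2), of "\<lambda>x. x $ a $ l"] that by (simp add: trunc_def)
    then have "height x g' j = height x (d ** g) j" using g' dg x by (intro height_cong) (auto simp: G_def)
    also have "\<dots> = height x g j" using height_N_int(2)[OF d(1) g(1) x] by simp
    finally show "height x g j \<in> (\<lambda>f. height x (inv_into G trunc f) j) ` (trunc ` G)"
      using t g'_def by (metis image_eqI)
  qed
  then show ?thesis using fin finite_subset by blast
qed

text \<open>The heights are minimised one at a time. A minimum at \<open>j\<close> exists because
  the heights before \<open>j\<close> are fixed to those found so far, so that
  \<open>finite_heights\<close> leaves finitely many values at \<open>j\<close>.\<close>

lemma lexicographic_minimum:
  fixes x :: "(real, 'n::{finite,linorder}) sqmat"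
  assumes x: "x \<in> OA"
  shows "\<exists>g\<in>OA. \<forall>j. pos j \<le> J \<longrightarrow> (\<forall>h\<in>OA. (\<forall>i<j. height x h i = height x g i) \<longrightarrow> height x g j \<le> height x h j)"
proof (induction J)
  case 0
  have z: "pos (j::'n) = 0 \<longleftrightarrow> False" for j using pos_range(1)[of j] by auto
  show ?case by (intro bexI[of _ "mat 1"]) (simp_all add: z)
next
  case (Suc J)
  then obtain g where g: "g \<in> OA" "\<And>j h. pos j \<le> J \<Longrightarrow> h \<in> OA \<Longrightarrow> (\<forall>i<j. height x h i = height x g i) \<Longrightarrow> height x g j \<le> height x h j"
    by blast
  show ?case
  proof (cases "Suc J \<le> CARD('n)")
    case False
    then have "pos j \<le> J" for j :: 'n using pos_range(2)[of j] by simp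
    then show ?thesis using g by blast
  next
    case True
    define j where "j = (idx (Suc J) :: 'n)"
    have j: "pos j = Suc J" unfolding j_def using True by (intro pos_idx) auto
    \<comment> \<open>This bounds the fixed heights before \<open>j\<close>; at \<open>j\<close>
      itself a value above it cannot be minimal, as \<open>g\<close> competes.\<close>
    define B where "B = Max (range (height x g))"
    have B: "height x g i \<le> B" for i by (simp add: B_def)
    define Y where "Y = {height x h j | h. h \<in> OA \<and> (\<forall>i<j. height x h i = height x g i) \<and> height x h j \<le> B}"
    have "Y \<subseteq> {height x h j | h. h \<in> OA \<and> (\<forall>i\<le>j. height x h i \<le> B)}"
    proof
      fix t assume "t \<in> Y"
      then obtain h where h: "t = height x h j" "h \<in> OA" "\<forall>i<j. height x h i = height x g i" "height x h j \<le> B"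
        by (auto simp: Y_def)
      then have "\<forall>i\<le>j. height x h i \<le> B" using B by (auto simp: le_less)
      then show "t \<in> {height x h j | h. h \<in> OA \<and> (\<forall>i\<le>j. height x h i \<le> B)}" using h by blast
    qed
    then have fin: "finite Y" using finite_heights[OF x] finite_subset by blast
    have gY: "height x g j \<in> Y" using g(1) B by (auto simp: Y_def)
    then have "Min Y \<in> Y" using fin by (intro Min_in) auto
    then obtain h where h: "Min Y = height x h j" "h \<in> OA" "\<forall>i<j. height x h i = height x g i" "height x h j \<le> B"
      by (auto simp: Y_def)
    show ?thesis
    proof (intro bexI[of _ h] allI impI ballI h(2))
      fix l h' assume l: "pos l \<le> Suc J" and h': "h' \<in> OA" "\<forall>i<l. height x h' i = height x h i"
      show "height x h l \<le> height x h' l"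
      proof (cases "l = j")
        case True
        show ?thesis
        proof (cases "height x h' j \<le> B")
          case le: True
          then have "height x h' j \<in> Y" using h' h(3) True by (auto simp: Y_def)
          then show ?thesis using Min_le[OF fin] h(1) True by simp
        next
          case False
          then show ?thesis using h(4) True by simp
        qed
      next
        case False
        then have lJ: "pos l \<le> J" using l j pos_inj[of l j] by simp
        then have lj: "l < j" using j by (simp add: pos_less_iff[symmetric])
        then have "\<forall>i<l. height x h' i = height x g i" using h' h(3) by (auto dest: less_trans)
        then have "height x g l \<le> height x h' l" using g(2)[OF lJ h'(1)] by blast
        then show ?thesis using h(3) lj by simp
      qed
    qed
  qed
qed

text \<open>The test for a lexicographic minimum: a change of row \<open>i\<close> that fixes the
  rows before it must not shorten the orthogonalised row \<open>i\<close>. In the coordinates of the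
  triangular part, orthogonalising means dropping the coordinates before \<open>i\<close>.\<close>

lemma height_move:
  fixes x :: "(real, 'n::{finite,linorder}) sqmat"
  assumes x: "x \<in> OA" and g: "g \<in> OA" and s: "s \<in> OA"
    and low: "\<And>a l. a < i \<Longrightarrow> s $ a $ l = (if l = a then 1 else 0)"
  shows "\<And>a. a < i \<Longrightarrow> height x (s ** g) a = height x g a"
    "height x (s ** g) i \<le> norm (\<chi> l. if l < i then 0 else \<Sum>a\<in>UNIV. of_int (s $ i $ a) * iwB (lmult g x) $ a $ l)"
proof -
  have sg: "s ** g \<in> OA" by (rule OA_mult[OF s g])
  show "height x (s ** g) a = height x g a" if "a < i" for a
  proof (rule height_cong[OF sg g x])
    fix c l assume "c \<le> a"
    then have "c < i" using that by simp
    then show "(s ** g) $ c $ l = g $ c $ l"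
      by (simp add: matrix_matrix_mult_def low if_distrib[of "\<lambda>x. x * _"] cong: if_cong)
  qed
  define b where "b = iwB (lmult g x)"
  have b: "b \<in> B_grp" unfolding b_def by (rule iwB_B[OF g x])
  define w :: "(real, 'n) vec" where "w = (\<chi> a. of_int (s $ i $ a))"
  obtain z where z: "\<And>l. i \<le> l \<Longrightarrow> z $ l = w $ l" "z v* b = (\<chi> l. if l < i then 0 else (w v* b) $ l)"
    by (rule clear_coordinates[OF b, of i w], rule that)
  \<comment> \<open>The rows of \<open>s\<close> before \<open>i\<close> are unit vectors, so the
    coefficients before \<open>i\<close> supply exactly the difference between \<open>z\<close> and
    row \<open>i\<close> of \<open>s\<close>.\<close>
  define u where "u = (\<chi> l. if l < i then z $ l - w $ l else if l = i then 1 else 0)"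
  have "(u v* emb s) $ l = z $ l" for l
  proof -
    have "(u v* emb s) $ l = (\<Sum>a\<in>UNIV. (if a = l then (if l < i then z $ l - w $ l else 0) else 0) + (if a = i then w $ l else 0))"
      unfolding vmult_nth
      by (rule sum.cong) (auto simp: u_def low w_def)
    also have "\<dots> = z $ l" using z(1)[of l] by (auto simp: sum.distrib)
    finally show ?thesis .
  qed
  then have us: "u v* emb s = z" by (simp add: vec_eq_iff)
  have "height x (s ** g) i \<le> norm (u v* lmult (s ** g) x)"
    by (rule height_le[OF sg x]) (auto simp: u_def)
  also have "u v* lmult (s ** g) x = z v* lmult g x"
    by (simp add: lmult_mult vmult_lmult[of u s] us)
  also have "norm (z v* lmult g x) = norm (z v* b)"
    using norm_vmult_iwB[OF lmult_OA[OF g x]] by (simp add: b_def)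
  also have "z v* b = (\<chi> l. if l < i then 0 else \<Sum>a\<in>UNIV. of_int (s $ i $ a) * iwB (lmult g x) $ a $ l)"
    unfolding z(2) vec_eq_iff by (simp add: vmult_nth) (simp add: w_def b_def)
  finally show "height x (s ** g) i \<le> norm (\<chi> l. if l < i then 0 else \<Sum>a\<in>UNIV. of_int (s $ i $ a) * iwB (lmult g x) $ a $ l)" .
qed

section \<open>Integral root swaps\<close>

lemma OA_rows_int:
  fixes s :: "(int, 'n::{finite,linorder}) sqmat"
  assumes "\<And>p q. (\<Sum>l\<in>UNIV. s $ p $ l * s $ q $ opp l) = (if q = opp p then 1 else 0)"
  shows "s \<in> OA"
proof -
  have "(s ** antidiag ** transpose s) $ p $ q = antidiag $ p $ q" for p q
  proof -
    have "(s ** (antidiag ** transpose s)) $ p $ q = (\<Sum>l\<in>UNIV. s $ p $ l * s $ q $ opp l)"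
      unfolding matrix_matrix_mult_def[of s "antidiag ** transpose s"] by (simp add: antidiag_mult) (simp add: transpose_def)
    then show ?thesis by (simp add: assms antidiag_nth matrix_mul_assoc)
  qed
  then show ?thesis by (simp add: OA_dual_form vec_eq_iff)
qed

text \<open>The matrices of the next two lemmas are products of an integral root unipotent and the simple
  reflection; in the second case, that of the short root for odd \<open>n\<close>, the parameter of the root unipotent
  has to be even.\<close>

lemma root_swap_hyperbolic:
  fixes i j :: "'n::{finite,linorder}" and a :: int
  assumes "i \<noteq> j" "opp j \<noteq> j" "opp i \<noteq> i" "opp i \<noteq> j"
  obtains s :: "(int, 'n) sqmat" where "s \<in> OA"
    "\<And>l. s $ i $ l = (if l = j then 1 else if l = i then a else 0)"
    "\<And>p l. p \<notin> {i, j, opp i, opp j} \<Longrightarrow> s $ p $ l = (if l = p then 1 else 0)"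
proof -
  define d :: "'n \<Rightarrow> 'n \<Rightarrow> int" where "d l p = (if l = p then 1 else 0)" for l p
  define s :: "(int, 'n) sqmat" where "s = (\<chi> p l. if p = i then d l j + a * d l i else if p = j then d l i
    else if p = opp i then d l (opp j) else if p = opp j then d l (opp i) - a * d l (opp j) else d l p)"
  have ne: "opp j \<noteq> i" "opp i \<noteq> j" using assms(4) by (metis opp_opp)+
  have dsum: "(\<Sum>l\<in>UNIV. d l p * f l) = f p" for p f
    by (simp add: d_def if_distrib[of "\<lambda>x. x * _"] cong: if_cong)
  have rows: "(\<Sum>l\<in>UNIV. s $ p $ l * f l) = (if p = i then f j + a * f i else if p = j then f i
    else if p = opp i then f (opp j) else if p = opp j then f (opp i) - a * f (opp j) else f p)" for p f
    by (simp add: s_def distrib_right left_diff_distrib sum.distrib sum_subtractf mult.assoc sum_distrib_left[symmetric] dsum)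
  have oeq: "opp l = p \<longleftrightarrow> l = opp p" for l p :: 'n by (metis opp_opp)
  show ?thesis
  proof (rule that[of s])
    show "s \<in> OA"
    proof (rule OA_rows_int)
      fix p q
      show "(\<Sum>l\<in>UNIV. s $ p $ l * s $ q $ opp l) = (if q = opp p then 1 else 0)"
        unfolding rows using assms ne by (auto simp: s_def d_def oeq)
    qed
    show "s $ i $ l = (if l = j then 1 else if l = i then a else 0)" for l using assms by (simp add: s_def d_def)
    show "s $ p $ l = (if l = p then 1 else 0)" if "p \<notin> {i, j, opp i, opp j}" for p l
      using that by (simp add: s_def d_def)
  qed
qed

lemma root_swap_anisotropic:
  fixes i j :: "'n::{finite,linorder}" and a :: int
  assumes "i \<noteq> j" "opp j = j" "opp i \<noteq> i"
  obtains s :: "(int, 'n) sqmat" where "s \<in> OA"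
    "\<And>l. s $ i $ l = (if l = opp i then 1 else if l = j then - 2 * a else if l = i then - 2 * a * a else 0)"
    "\<And>p l. p \<notin> {i, j, opp i} \<Longrightarrow> s $ p $ l = (if l = p then 1 else 0)"
proof -
  define d :: "'n \<Rightarrow> 'n \<Rightarrow> int" where "d l p = (if l = p then 1 else 0)" for l p
  \<comment> \<open>With the parameter \<open>c = 2 * a\<close>, row \<open>i\<close> is the unit
    vector at \<open>opp i\<close> minus \<open>c\<close> times the one at \<open>j\<close>.
    Isotropy forces the coefficient at \<open>i\<close> to be minus half the square of
    \<open>c\<close>, which is integral for even \<open>c\<close>.\<close>
  define s :: "(int, 'n) sqmat" where "s = (\<chi> p l. if p = i then d l (opp i) - 2 * a * d l j - 2 * a * a * d l i
    else if p = j then d l j + 2 * a * d l i else if p = opp i then d l i else d l p)"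
  have ne: "opp i \<noteq> j" using assms by (metis opp_opp)
  have dsum: "(\<Sum>l\<in>UNIV. d l p * f l) = f p" for p f
    by (simp add: d_def if_distrib[of "\<lambda>x. x * _"] cong: if_cong)
  have rows: "(\<Sum>l\<in>UNIV. s $ p $ l * f l) = (if p = i then f (opp i) - 2 * a * f j - 2 * a * a * f i
    else if p = j then f j + 2 * a * f i else if p = opp i then f i else f p)" for p f
    by (simp add: s_def distrib_right left_diff_distrib sum.distrib sum_subtractf mult.assoc sum_distrib_left[symmetric] dsum)
  have oeq: "opp l = p \<longleftrightarrow> l = opp p" for l p :: 'n by (metis opp_opp)
  show ?thesis
  proof (rule that[of s])
    show "s \<in> OA"
    proof (rule OA_rows_int)
      fix p q
      show "(\<Sum>l\<in>UNIV. s $ p $ l * s $ q $ opp l) = (if q = opp p then 1 else 0)"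
        unfolding rows using assms ne by (auto simp: s_def d_def oeq algebra_simps)
    qed
    show "s $ i $ l = (if l = opp i then 1 else if l = j then - 2 * a else if l = i then - 2 * a * a else 0)" for l
      using assms ne by (simp add: s_def d_def)
    show "s $ p $ l = (if l = p then 1 else 0)" if "p \<notin> {i, j, opp i}" for p l
      using that by (simp add: s_def d_def)
  qed
qed

section \<open>Minimality at a simple pair\<close>

lemma norm_vec_sq: "(norm v)\<^sup>2 = (\<Sum>l\<in>UNIV. (v $ l)\<^sup>2)" for v :: "real ^ 'n"
  by (simp only: power2_norm_eq_inner inner_vec_def) (simp add: power2_eq_square)

lemma exists_near_int:
  obtains a :: int where "\<bar>y + of_int a\<bar> \<le> 1 / (2::real)"
proof -
  have "\<bar>of_int (round y) - y\<bar> \<le> 1 / 2" by (rule of_int_round_abs_le)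
  then show ?thesis using that[of "- round y"] by (simp add: abs_minus_commute)
qed

text \<open>As for binary quadratic forms: after translation by the nearest integer, the squared
  length of the swapped row is at most a quarter of the square of \<open>b $ i $ i\<close> plus the
  square of \<open>b $ j $ j\<close>. Minimality gives the ratio \<open>sqrt 3 / 2\<close>, for
  which 1/2 is a convenient strict lower bound.\<close>

lemma reduction_step_hyperbolic:
  fixes i j :: "'n::{finite,linorder}"
  assumes b: "b \<in> B_grp" and sp: "simple_pair i j" and oj: "opp j \<noteq> j"
    and i: "i < opp i" "i < opp j" "opp i \<noteq> j"
    and min: "\<And>s. s \<in> OA \<Longrightarrow> (\<And>a l. a < i \<Longrightarrow> s $ a $ l = (if l = a then 1 else 0)) \<Longrightarrow>
      b $ i $ i \<le> norm (\<chi> l. if l < i then 0 else \<Sum>a\<in>UNIV. of_int (s $ i $ a) * b $ a $ l)"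
  shows "b $ i $ i / 2 < b $ j $ j"
proof -
  have ij: "i < j" and between: "\<And>l. i < l \<Longrightarrow> l < j \<Longrightarrow> near l j" using sp by (auto simp: simple_pair_def)
  have bp: "b $ l $ l > 0" and bl: "l < m \<Longrightarrow> b $ l $ m = 0" for l m
    using b by (auto simp: B_grp_def lowpos_def lowtri_def)
  obtain a where a: "\<bar>b $ j $ i / b $ i $ i + of_int a\<bar> \<le> 1 / 2" by (rule exists_near_int)
  obtain s :: "(int, 'n) sqmat" where s: "s \<in> OA"
    "\<And>l. s $ i $ l = (if l = j then 1 else if l = i then a else 0)"
    "\<And>p l. p \<notin> {i, j, opp i, opp j} \<Longrightarrow> s $ p $ l = (if l = p then 1 else 0)"
    by (rule root_swap_hyperbolic[of i j a], use ij oj i in auto)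
  define v where "v = (\<chi> l. if l < i then 0 else \<Sum>a\<in>UNIV. of_int (s $ i $ a) * b $ a $ l)"
  have v: "v $ l = (if l = i then b $ j $ i + of_int a * b $ i $ i else 0) + (if l = j then b $ j $ j else 0)" for l
  proof -
    have row: "(\<Sum>c\<in>UNIV. of_int (s $ i $ c) * b $ c $ l) = b $ j $ l + of_int a * b $ i $ l"
    proof -
      have "(\<Sum>c\<in>UNIV. of_int (s $ i $ c) * b $ c $ l)
        = (\<Sum>c\<in>UNIV. (if c = j then b $ j $ l else 0) + (if c = i then of_int a * b $ i $ l else 0))"
        using ij by (intro sum.cong) (auto simp: s(2))
      then show ?thesis by (simp add: sum.distrib)
    qed
    have vl: "v $ l = (if l < i then 0 else b $ j $ l + of_int a * b $ i $ l)" by (simp add: v_def row)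
    consider "l < i" | "l = i" | "i < l" "l < j" | "l = j" | "j < l" by (metis linorder_less_linear)
    then show ?thesis
    proof cases
      case 3
      \<comment> \<open>Strictly between \<open>i\<close> and \<open>j\<close> there can only be the
        other middle index, and the middle block of \<open>b\<close> is diagonal.\<close>
      then have "b $ j $ l = 0" using B_grp_near[OF b, of j l] between near_sym by blast
      then show ?thesis unfolding vl using 3 bl[of i l] by auto
    qed (unfold vl, use ij bl in auto)
  qed
  have "(norm v)\<^sup>2 = (\<Sum>l\<in>UNIV. (if l = i then (b $ j $ i + of_int a * b $ i $ i)\<^sup>2 else 0) + (if l = j then (b $ j $ j)\<^sup>2 else 0))"
    unfolding norm_vec_sq by (rule sum.cong) (use ij in \<open>auto simp: v\<close>)
  then have nv: "(norm v)\<^sup>2 = (b $ j $ i + of_int a * b $ i $ i)\<^sup>2 + (b $ j $ j)\<^sup>2" by (simp add: sum.distrib)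
  have "b $ i $ i \<le> norm v"
    unfolding v_def
  proof (rule min[OF s(1)])
    fix p l assume "p < i"
    then have "p \<notin> {i, j, opp i, opp j}" using ij i by auto
    then show "s $ p $ l = (if l = p then 1 else 0)" by (rule s(3))
  qed
  then have 1: "(b $ i $ i)\<^sup>2 \<le> (b $ j $ i + of_int a * b $ i $ i)\<^sup>2 + (b $ j $ j)\<^sup>2"
    unfolding nv[symmetric] using bp[of i] by (intro power_mono) (auto intro: less_imp_le)
  have "b $ j $ i + of_int a * b $ i $ i = (b $ j $ i / b $ i $ i + of_int a) * b $ i $ i"
    using bp[of i] by (simp add: field_simps)
  then have "\<bar>b $ j $ i + of_int a * b $ i $ i\<bar> \<le> 1 / 2 * b $ i $ i"
    using a bp[of i] by (simp add: abs_mult)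
  then have "(b $ j $ i + of_int a * b $ i $ i)\<^sup>2 \<le> (1 / 2 * b $ i $ i)\<^sup>2"
    using bp[of i] by (intro abs_le_square_iff[THEN iffD1]) simp
  then have "(b $ i $ i)\<^sup>2 * (3 / 4) \<le> (b $ j $ j)\<^sup>2" using 1 by (simp add: power2_eq_square)
  moreover have "(b $ i $ i / 2)\<^sup>2 < (b $ i $ i)\<^sup>2 * (3 / 4)" using bp[of i] by (simp add: power2_eq_square)
  ultimately have "(b $ i $ i / 2)\<^sup>2 < (b $ j $ j)\<^sup>2" by simp
  then show ?thesis using bp[of j] by (meson power2_less_imp_less less_imp_le)
qed

text \<open>On the coordinates \<open>i\<close>, \<open>j\<close>, \<open>k\<close> the isometry
  \<open>b\<close> is determined by \<open>t\<close> and \<open>\<beta>\<close>. Translation by an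
  even integer leaves a remainder \<open>\<delta>\<close> of absolute value at most 1, and the
  swapped row has length \<open>t / 2 * \<delta>\<^sup>2 + 1 / t\<close>. Minimality gives
  \<open>t * t \<le> 2\<close>, while the middle entry \<open>b $ j $ j\<close> is 1.\<close>

lemma reduction_step_anisotropic:
  fixes i j :: "'n::{finite,linorder}"
  assumes b: "b \<in> B_grp" and oj: "opp j = j" and ij: "i < j"
    and three: "\<And>l. i \<le> l \<Longrightarrow> l \<le> opp i \<Longrightarrow> l = i \<or> l = j \<or> l = opp i"
    and min: "\<And>s. s \<in> OA \<Longrightarrow> (\<And>a l. a < i \<Longrightarrow> s $ a $ l = (if l = a then 1 else 0)) \<Longrightarrow>
      b $ i $ i \<le> norm (\<chi> l. if l < i then 0 else \<Sum>a\<in>UNIV. of_int (s $ i $ a) * b $ a $ l)"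
  shows "b $ i $ i / 2 < b $ j $ j"
proof -
  define k where "k = opp i"
  have jk: "j < k" using ij oj opp_less[of j i] by (simp add: k_def)
  have ok: "opp k = i" "opp i = k" by (simp_all add: k_def)
  have ne: "i \<noteq> j" "j \<noteq> k" "i \<noteq> k" "j \<noteq> i" "k \<noteq> j" "k \<noteq> i" "\<not> j < i" "\<not> k < i" "i < k"
    using ij jk by auto
  have bp: "b $ l $ l > 0" and bl: "l < m \<Longrightarrow> b $ l $ m = 0" for l m
    using b by (auto simp: B_grp_def lowpos_def lowtri_def)
  define t where "t = b $ i $ i"
  define \<beta> where "\<beta> = b $ j $ i"
  have t: "t > 0" by (simp add: t_def bp)
  have bjj: "b $ j $ j = 1" using B_grp_diag_opp[OF b, of j] bp[of j] oj by (simp add: square_eq_1_iff)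
  have bkk: "b $ k $ k = 1 / t" using B_grp_diag_opp[OF b, of i] t by (simp add: ok t_def field_simps)
  have form: "(\<Sum>l\<in>UNIV. b $ l $ p * b $ opp l $ q) = (if q = opp p then 1 else 0)" for p q
    using arg_cong[OF form_iff_adj[THEN iffD2, OF OA_D(1)[OF B_grp_OA[OF b]]], of "\<lambda>x. x $ p $ q"]
    by (simp add: form_nth antidiag_nth)
  have sum3: "(\<Sum>l\<in>UNIV. b $ l $ i * b $ opp l $ q) = b $ i $ i * b $ k $ q + b $ j $ i * b $ j $ q + b $ k $ i * b $ i $ q"
    if "i \<le> q" for q
  proof -
    have "(\<Sum>l\<in>UNIV. b $ l $ i * b $ opp l $ q) = (\<Sum>l\<in>{i, j, k}. b $ l $ i * b $ opp l $ q)"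
    proof (rule sum.mono_neutral_right)
      show "\<forall>l\<in>UNIV - {i, j, k}. b $ l $ i * b $ opp l $ q = 0"
      proof
        fix l assume "l \<in> UNIV - {i, j, k}"
        then have "\<not> (i \<le> l \<and> l \<le> k)" using three[of l] by (auto simp: k_def)
        then have "l < i \<or> opp l < i" using opp_less[of l k] ok by auto
        then have "b $ l $ i = 0 \<or> b $ opp l $ q = 0" using bl that by (meson less_le_trans)
        then show "b $ l $ i * b $ opp l $ q = 0" by auto
      qed
    qed auto
    then show ?thesis by (simp add: ok oj ne add.assoc)
  qed
  have bki: "b $ k $ i = - (\<beta> * \<beta>) / (2 * t)"
  proof -
    have "i \<noteq> opp i" using ij jk by (simp add: ok)
    then have "t * b $ k $ i + \<beta> * \<beta> + b $ k $ i * t = 0"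
      using sum3[of i] form[of i i] by (simp add: t_def \<beta>_def)
    then show ?thesis using t by (simp add: field_simps)
  qed
  have bkj: "b $ k $ j = - \<beta> / t"
  proof -
    have "j \<noteq> opp i" using jk by (simp add: ok)
    then have "t * b $ k $ j + \<beta> = 0"
      using sum3[of j] form[of i j] ij bl[of i j] by (simp add: t_def \<beta>_def bjj)
    then show ?thesis using t by (simp add: field_simps)
  qed
  obtain a where a: "\<bar>\<beta> / (2 * t) + of_int a\<bar> \<le> 1 / 2" by (rule exists_near_int)
  define \<delta> where "\<delta> = \<beta> / t + 2 * of_int a"
  have "\<delta> = 2 * (\<beta> / (2 * t) + of_int a)" by (simp add: \<delta>_def)
  then have "\<bar>\<delta>\<bar> = 2 * \<bar>\<beta> / (2 * t) + of_int a\<bar>" by (simp only: abs_mult abs_numeral)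
  also have "\<dots> \<le> 2 * (1 / 2)" using a by (intro mult_left_mono) simp_all
  finally have d1: "\<bar>\<delta>\<bar> \<le> 1" by simp
  obtain s :: "(int, 'n) sqmat" where s: "s \<in> OA"
    "\<And>l. s $ i $ l = (if l = opp i then 1 else if l = j then - 2 * a else if l = i then - 2 * a * a else 0)"
    "\<And>p l. p \<notin> {i, j, opp i} \<Longrightarrow> s $ p $ l = (if l = p then 1 else 0)"
    by (rule root_swap_anisotropic[of i j a], use ij oj jk ok in auto)
  define v where "v = (\<chi> l. if l < i then 0 else \<Sum>a\<in>UNIV. of_int (s $ i $ a) * b $ a $ l)"
  have v: "v $ l = (if l = i then - (t / 2) * \<delta>\<^sup>2 else 0) + (if l = j then - \<delta> else 0) + (if l = k then 1 / t else 0)" for l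
  proof -
    have row: "(\<Sum>c\<in>UNIV. of_int (s $ i $ c) * b $ c $ l) = b $ k $ l - 2 * of_int a * b $ j $ l - 2 * of_int a * of_int a * b $ i $ l"
    proof -
      have "(\<Sum>c\<in>UNIV. of_int (s $ i $ c) * b $ c $ l)
        = (\<Sum>c\<in>UNIV. (if c = k then b $ k $ l else 0) + (if c = j then - 2 * of_int a * b $ j $ l else 0)
            + (if c = i then - 2 * of_int a * of_int a * b $ i $ l else 0))"
        using ij jk by (intro sum.cong) (auto simp: s(2) ok)
      then show ?thesis by (simp add: sum.distrib)
    qed
    have vl: "v $ l = (if l < i then 0 else b $ k $ l - 2 * of_int a * b $ j $ l - 2 * of_int a * of_int a * b $ i $ l)"
      by (simp add: v_def row)
    consider "l < i" | "l = i" | "l = j" | "l = k" | "k < l" using three[of l] by (auto simp: ok) (meson not_le)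
    then show ?thesis
    proof cases
      case 2
      have "- (\<beta> * \<beta>) / (2 * t) - 2 * of_int a * \<beta> - 2 * of_int a * of_int a * t = - (t / 2) * \<delta>\<^sup>2"
        using t by (simp add: \<delta>_def power2_eq_square field_simps)
      then show ?thesis unfolding vl using 2 by (simp add: ne bki \<beta>_def[symmetric] t_def[symmetric])
    next
      case 3
      then show ?thesis unfolding vl using bl[OF ij] by (simp add: bkj bjj \<delta>_def ne)
    next
      case 4
      then show ?thesis unfolding vl using bl[OF jk] bl[OF ne(9)] by (simp add: bkk ne)
    qed (unfold vl, use ij jk bl in auto)
  qed
  have "(norm v)\<^sup>2 = (\<Sum>l\<in>UNIV. (if l = i then (- (t / 2) * \<delta>\<^sup>2)\<^sup>2 else 0) + (if l = j then (- \<delta>)\<^sup>2 else 0) + (if l = k then (1 / t)\<^sup>2 else 0))"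
    unfolding norm_vec_sq by (rule sum.cong) (use ij jk in \<open>auto simp: v\<close>)
  also have "\<dots> = (- (t / 2) * \<delta>\<^sup>2)\<^sup>2 + (- \<delta>)\<^sup>2 + (1 / t)\<^sup>2" by (simp add: sum.distrib)
  \<comment> \<open>The vector \<open>v\<close> is isotropic: its middle coordinate squared plus
    twice the product of the outer ones is 0. Its squared length is therefore the square of the
    difference of the outer coordinates.\<close>
  also have "\<dots> = (t / 2 * \<delta>\<^sup>2 + 1 / t)\<^sup>2"
    using t by (simp add: power2_eq_square field_simps)
  finally have nv: "(norm v)\<^sup>2 = (t / 2 * \<delta>\<^sup>2 + 1 / t)\<^sup>2" .
  have "0 \<le> t / 2 * \<delta>\<^sup>2 + 1 / t" using t by simp
  with nv have "norm v = t / 2 * \<delta>\<^sup>2 + 1 / t" by (rule power2_eq_imp_eq[OF _ norm_ge_zero])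
  moreover have "t \<le> norm v"
    unfolding v_def t_def
  proof (rule min[OF s(1)])
    fix p l assume "p < i"
    then have "p \<notin> {i, j, opp i}" using ij jk ok by auto
    then show "s $ p $ l = (if l = p then 1 else 0)" by (rule s(3))
  qed
  moreover have "t / 2 * \<delta>\<^sup>2 \<le> t / 2 * 1"
    using t d1 by (intro mult_left_mono) (auto simp: abs_square_le_1)
  ultimately have "t / 2 \<le> 1 / t" by simp
  then have "t * t \<le> 2" using t by (simp add: field_simps)
  have "t < 2"
  proof (rule ccontr)
    assume "\<not> t < 2"
    then have "2 * 2 \<le> t * t" by (intro mult_mono) auto
    then show False using \<open>t * t \<le> 2\<close> by simp
  qed
  then show ?thesis by (simp add: t_def[symmetric] bjj)
qed

text \<open>The root swap for a simple pair \<open>(i, j)\<close> changes only the rows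
  \<open>i\<close>, \<open>j\<close> and their opposites, none of which comes before
  \<open>i\<close>; so lexicographic minimality at \<open>i\<close> supplies the hypothesis
  \<open>min\<close> of the reduction steps. The anisotropic step belongs to the last pair for odd
  \<open>n\<close>, where \<open>j\<close> is the middle index.\<close>

lemma reduction:
  fixes x :: "(real, 'n::{finite,linorder}) sqmat"
  assumes n: "CARD('n) \<ge> 3" and x: "x \<in> OA"
  obtains g where "g \<in> OA" "\<And>i j. simple_pair i j \<Longrightarrow> iwB (lmult g x) $ i $ i / 2 < iwB (lmult g x) $ j $ j"
proof -
  obtain g where g: "g \<in> OA"
    and lex: "\<And>j h. pos j \<le> CARD('n) \<Longrightarrow> h \<in> OA \<Longrightarrow> (\<forall>i<j. height x h i = height x g i) \<Longrightarrow> height x g j \<le> height x h j"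
    using lexicographic_minimum[OF x, of "CARD('n)"] by blast
  define b where "b = iwB (lmult g x)"
  have b: "b \<in> B_grp" unfolding b_def by (rule iwB_B[OF g x])
  have "b $ i $ i / 2 < b $ j $ j" if sp: "simple_pair i j" for i j
  proof -
    have min: "b $ i $ i \<le> norm (\<chi> l. if l < i then 0 else \<Sum>a\<in>UNIV. of_int (s $ i $ a) * b $ a $ l)"
      if s: "s \<in> OA" "\<And>a l. a < i \<Longrightarrow> s $ a $ l = (if l = a then 1 else 0)" for s
    proof -
      have "height x g i \<le> height x (s ** g) i"
        using height_move(1)[OF x g s] by (intro lex OA_mult s g pos_range) auto
      also have "\<dots> \<le> norm (\<chi> l. if l < i then 0 else \<Sum>a\<in>UNIV. of_int (s $ i $ a) * b $ a $ l)"
        unfolding b_def by (rule height_move(2)[OF x g s])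
      finally show ?thesis by (simp add: height_def b_def)
    qed
    have ij: "i < j" and h: "pos i \<le> (CARD('n) - 1) div 2" using sp by (auto simp: simple_pair_def)
    have h2: "2 * ((CARD('n) - 1) div 2) \<le> CARD('n) - 1" by simp
    have oi: "i < opp i"
      unfolding pos_less_iff[symmetric] using h h2 pos_opp_add[of i] n by linarith
    show ?thesis
    proof (cases "opp j = j")
      case True
      then have j: "2 * pos j = CARD('n) + 1" using pos_opp_add[of j] by simp
      then have "pos j = pos i + 1"
        using sp h2 h half_facts(5)[OF n] by (auto simp: simple_pair_pos)
      then have pk: "pos j = pos i + 1" "pos (opp i) = pos i + 2" using j pos_opp_add[of i] by auto
      show ?thesis
      proof (rule reduction_step_anisotropic[OF b True ij _ min])
        fix l assume "i \<le> l" "l \<le> opp i"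
        then have "pos i \<le> pos l" "pos l \<le> pos i + 2" using pk by (simp_all add: pos_le_iff[symmetric])
        then have "pos l = pos i \<or> pos l = pos j \<or> pos l = pos (opp i)" using pk by auto
        then show "l = i \<or> l = j \<or> l = opp i" by (simp add: pos_inj)
      qed
    next
      case False
      have c: "pos j = pos i + 1 \<or> (even CARD('n) \<and> pos j = CARD('n) div 2 + 1 \<and> pos i + 1 = CARD('n) div 2)"
        using sp by (simp add: simple_pair_pos)
      have "i < opp j \<and> opp i \<noteq> j"
      proof (cases "pos j = pos i + 1")
        case True
        then have "pos i < pos (opp j)" "pos (opp i) \<noteq> pos j" using h h2 pos_opp_add[of i] pos_opp_add[of j] n by linarith+
        then show ?thesis by (auto simp: pos_less_iff)
      next
        case False
        then have e: "even CARD('n)" "pos j = CARD('n) div 2 + 1" "pos i + 1 = CARD('n) div 2" using c by auto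
        then have "pos i < pos (opp j)" "pos (opp i) \<noteq> pos j"
          using half_facts(5)[OF n e(1)] pos_opp_add[of i] pos_opp_add[of j] by linarith+
        then show ?thesis by (auto simp: pos_less_iff)
      qed
      then show ?thesis by (intro reduction_step_hyperbolic[OF b sp False oi _ _ min]) auto
    qed
  qed
  then show ?thesis using that g by (simp add: b_def)
qed

section \<open>Compact tiles\<close>

text \<open>The translates are locally finite: a convergent sequence is bounded, so it meets only
  finitely many of them, and a finite union of compact sets is closed.\<close>

lemma closed_saturation:
  fixes C :: "(real, 'n::{finite,linorder}) sqmat set"
  assumes C: "compact C" "C \<subseteq> OA" and D: "D \<subseteq> OA"
  shows "closed (\<Union>d\<in>D. lmult d ` C)"
  unfolding closed_sequential_limits
proof (intro allI impI)
  fix x l assume A: "(\<forall>n. x n \<in> (\<Union>d\<in>D. lmult d ` C)) \<and> x \<longlonglongrightarrow> l"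
  then have bx: "bounded (range x)" by (metis convergent_imp_bounded)
  have fin: "finite {g. \<exists>y\<in>C. lmult g y \<in> range x}"
    by (rule finite_movers[OF compact_imp_bounded[OF C(1)] bx C(2)])
  define F where "F = D \<inter> {g. \<exists>y\<in>C. lmult g y \<in> range x}"
  have "closed (\<Union>d\<in>F. lmult d ` C)"
    using fin by (intro closed_UN compact_imp_closed compact_continuous_image C continuous_intros ballI) (auto simp: F_def)
  moreover have "x n \<in> (\<Union>d\<in>F. lmult d ` C)" for n
  proof -
    obtain d y where dy: "d \<in> D" "y \<in> C" "x n = lmult d y" using A by blast
    moreover from dy have "lmult d y \<in> range x" by (metis rangeI)
    ultimately have "d \<in> F" unfolding F_def by blast
    then show ?thesis using dy by blast
  qed
  ultimately have "l \<in> (\<Union>d\<in>F. lmult d ` C)" using A closed_sequentially by blast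
  then show "l \<in> (\<Union>d\<in>D. lmult d ` C)" by (auto simp: F_def)
qed

text \<open>Only finitely many matrices return some point of the unit ball around \<open>x\<close>
  to this ball, and each of them except \<open>mat 1\<close> moves \<open>x\<close>. The property
  passes to smaller radii, which leaves room for a generic choice.\<close>

lemma small_ball:
  fixes x :: "(real, 'n::{finite,linorder}) sqmat"
  assumes x: "x \<in> OA"
  obtains r where "r > 0" "\<And>d y. y \<in> OA \<Longrightarrow> dist x y \<le> r \<Longrightarrow> dist x (lmult d y) \<le> r \<Longrightarrow> d = mat 1"
proof -
  define M where "M = {g. \<exists>y\<in>cball x 1 \<inter> OA. lmult g y \<in> cball x 1}"
  have finM: "finite M" unfolding M_def by (intro finite_movers) (auto intro: bounded_subset[OF bounded_cball])
  have "\<exists>r>0. \<forall>y\<in>OA. dist x y \<le> r \<longrightarrow> dist x (lmult d y) \<le> r \<longrightarrow> d = mat 1" for d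
  proof (cases "d = mat 1")
    case False
    then have ne: "lmult d x \<noteq> x" using lmult_free[OF x, of d "mat 1"] by auto
    define e where "e = dist (lmult d x) x / 2"
    have e: "e > 0" using ne by (simp add: e_def)
    have "continuous_on UNIV (lmult d)" by (intro continuous_intros)
    then obtain r where r: "r > 0" "\<And>y. dist y x < r \<Longrightarrow> dist (lmult d y) (lmult d x) < e"
      using e unfolding continuous_on_iff by (metis UNIV_I)
    have "\<not> (dist x y \<le> min (r / 2) (e / 2) \<and> dist x (lmult d y) \<le> min (r / 2) (e / 2))" for y
    proof
      assume A: "dist x y \<le> min (r / 2) (e / 2) \<and> dist x (lmult d y) \<le> min (r / 2) (e / 2)"
      then have "dist y x < r" "dist x (lmult d y) \<le> e / 2" using r(1) by (auto simp: dist_commute)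
      moreover from this(1) have "dist (lmult d y) (lmult d x) < e" by (rule r(2))
      moreover have "dist (lmult d x) x \<le> dist (lmult d y) (lmult d x) + dist x (lmult d y)"
        by (metis dist_commute dist_triangle)
      moreover have "dist (lmult d x) x = 2 * e" by (simp add: e_def)
      ultimately show False using e by linarith
    qed
    then show ?thesis using r(1) e by (intro exI[of _ "min (r / 2) (e / 2)"]) auto
  qed (auto intro: exI[of _ 1])
  then obtain \<rho> where \<rho>: "\<And>d. \<rho> d > 0" "\<And>d y. y \<in> OA \<Longrightarrow> dist x y \<le> \<rho> d \<Longrightarrow> dist x (lmult d y) \<le> \<rho> d \<Longrightarrow> d = mat 1"
    by metis
  define r where "r = Min (insert 1 (\<rho> ` M))"
  have r: "r > 0" "r \<le> 1" "\<And>d. d \<in> M \<Longrightarrow> r \<le> \<rho> d"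
    using finM \<rho>(1) by (auto simp: r_def)
  show ?thesis
  proof (rule that[OF r(1)])
    fix d y assume y: "y \<in> OA" "dist x y \<le> r" "dist x (lmult d y) \<le> r"
    then have "y \<in> cball x 1 \<inter> OA" "lmult d y \<in> cball x 1" using r(2) by auto
    then have "d \<in> M" unfolding M_def by blast
    then show "d = mat 1" using \<rho>(2)[OF y(1)] y r(3) by (meson order_trans)
  qed
qed

text \<open>A compact tile with negligible frontier, built from finitely many small balls with negligible
  spheres: each new ball contributes the part of it not yet reached by the group.\<close>

lemma tessellation:
  fixes X C :: "(real, 'n::{finite,linorder}) sqmat set" and neg :: "(real, 'n) sqmat set \<Rightarrow> bool"
  assumes X: "closed X" "X \<subseteq> OA"
    and D: "D \<subseteq> OA" "mat 1 \<in> D" "\<And>d e. d \<in> D \<Longrightarrow> e \<in> D \<Longrightarrow> d ** e \<in> D" "\<And>d. d \<in> D \<Longrightarrow> adj d \<in> D"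
    and DX: "\<And>d x. d \<in> D \<Longrightarrow> x \<in> X \<Longrightarrow> lmult d x \<in> X"
    and C: "compact C" "C \<subseteq> X" "\<And>x. x \<in> X \<Longrightarrow> \<exists>d\<in>D. lmult d x \<in> C"
    and neg_empty: "neg {}"
    and neg_Un: "\<And>A B. neg A \<Longrightarrow> neg B \<Longrightarrow> neg (A \<union> B)"
    and neg_subset: "\<And>A B. neg A \<Longrightarrow> B \<subseteq> A \<Longrightarrow> neg B"
    and neg_UN: "\<And>A. neg A \<Longrightarrow> A \<subseteq> X \<Longrightarrow> neg (\<Union>d\<in>D. lmult d ` A)"
    and neg_sphere: "\<And>x e. x \<in> X \<Longrightarrow> e > 0 \<Longrightarrow> \<exists>r. 0 < r \<and> r < e \<and> neg (X \<inter> sphere x r)"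
  shows "\<exists>N U. compact N \<and> N \<subseteq> X \<and> U \<subseteq> N \<and> openin (top_of_set X) U \<and> neg (N - U) \<and>
    (\<forall>x\<in>X. \<exists>d\<in>D. lmult d x \<in> N) \<and> (\<forall>d\<in>D. \<forall>x\<in>U. lmult d x \<in> U \<longrightarrow> d = mat 1)"
proof -
  define good where "good x r \<longleftrightarrow> x \<in> X \<and> 0 < r \<and> neg (X \<inter> sphere x r) \<and>
    (\<forall>d y. y \<in> OA \<longrightarrow> dist x y \<le> r \<longrightarrow> dist x (lmult d y) \<le> r \<longrightarrow> d = mat 1)" for x :: "(real, 'n) sqmat" and r
  have ex_good: "\<exists>r. good x r" if "x \<in> X" for x
  proof -
    have xX: "x \<in> X" by (rule that)
    have xO: "x \<in> OA" using that X by blast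
    obtain r0 where r0: "r0 > 0" "\<And>d y. y \<in> OA \<Longrightarrow> dist x y \<le> r0 \<Longrightarrow> dist x (lmult d y) \<le> r0 \<Longrightarrow> d = mat 1"
      by (rule small_ball[OF xO], rule that)
    obtain r where r: "0 < r" "r < r0" "neg (X \<inter> sphere x r)" using neg_sphere[OF xX r0(1)] by blast
    have "d = mat 1" if "y \<in> OA" "dist x y \<le> r" "dist x (lmult d y) \<le> r" for d y
      using r0(2)[OF that(1)] that r(2) by force
    then show ?thesis unfolding good_def using xX r by blast
  qed
  then obtain \<rho> where \<rho>: "\<And>x. x \<in> X \<Longrightarrow> good x (\<rho> x)" by metis
  have "C \<subseteq> (\<Union>x\<in>C. ball x (\<rho> x))"
  proof
    fix x assume "x \<in> C"
    then have "0 < \<rho> x" using \<rho>[of x] C(2) by (auto simp: good_def)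
    then show "x \<in> (\<Union>x\<in>C. ball x (\<rho> x))" by (intro UN_I[OF \<open>x \<in> C\<close>]) simp
  qed
  then obtain P where P: "P \<subseteq> C" "finite P" "C \<subseteq> (\<Union>x\<in>P. ball x (\<rho> x))"
    using compactE_image[OF C(1), of C "\<lambda>x. ball x (\<rho> x)"] by blast
  have sat_mono: "x \<in> (\<Union>d\<in>D. lmult d ` A) \<longleftrightarrow> (\<exists>d\<in>D. lmult d x \<in> A)" for x A
  proof
    assume "x \<in> (\<Union>d\<in>D. lmult d ` A)"
    then obtain d y where dy: "d \<in> D" "y \<in> A" "x = lmult d y" by blast
    then have "lmult (adj d) x = y" using D(1) by auto
    then show "\<exists>d\<in>D. lmult d x \<in> A" using D(4)[OF dy(1)] dy(2) by auto
  next
    assume "\<exists>d\<in>D. lmult d x \<in> A"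
    then obtain d where d: "d \<in> D" "lmult d x \<in> A" by blast
    then have "x = lmult (adj d) (lmult d x)" using D(1) by auto
    then show "x \<in> (\<Union>d\<in>D. lmult d ` A)" using D(4)[OF d(1)] d(2) by blast
  qed
  have "\<exists>N U. compact N \<and> N \<subseteq> X \<and> U \<subseteq> N \<and> openin (top_of_set X) U \<and> neg (N - U) \<and>
     (\<forall>x\<in>X. x \<in> (\<Union>p\<in>P. ball p (\<rho> p)) \<longrightarrow> (\<exists>d\<in>D. lmult d x \<in> N)) \<and>
     (\<forall>d x. d \<in> D \<longrightarrow> x \<in> U \<longrightarrow> lmult d x \<in> U \<longrightarrow> d = mat 1)"
    using P(2,1)
  proof (induction P rule: finite_induct)
    case empty
    then show ?case using neg_empty by (intro exI[of _ "{}"]) auto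
  next
    case (insert p P)
    then obtain N U where N: "compact N" "N \<subseteq> X" and U: "U \<subseteq> N" "openin (top_of_set X) U" "neg (N - U)"
      and cover: "\<And>x. x \<in> X \<Longrightarrow> x \<in> (\<Union>p\<in>P. ball p (\<rho> p)) \<Longrightarrow> \<exists>d\<in>D. lmult d x \<in> N"
      and disj: "\<And>d x. d \<in> D \<Longrightarrow> x \<in> U \<Longrightarrow> lmult d x \<in> U \<Longrightarrow> d = mat 1"
      by auto
    have "p \<in> X" using insert.prems C by auto
    then have p: "p \<in> X" "0 < \<rho> p" "neg (X \<inter> sphere p (\<rho> p))"
      "\<And>d y. y \<in> OA \<Longrightarrow> dist p y \<le> \<rho> p \<Longrightarrow> dist p (lmult d y) \<le> \<rho> p \<Longrightarrow> d = mat 1"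
      using \<rho> unfolding good_def by auto
    define S where "S = (\<Union>d\<in>D. lmult d ` N)"
    have clS: "closed S" unfolding S_def using N X D by (intro closed_saturation) auto
    have SN: "x \<in> S \<longleftrightarrow> (\<exists>d\<in>D. lmult d x \<in> N)" for x unfolding S_def by (rule sat_mono)
    have Sinv: "lmult d x \<in> S" if d: "d \<in> D" and xS: "x \<in> S" for d x
    proof -
      obtain e where e: "e \<in> D" "lmult e x \<in> N" using xS SN by blast
      have "lmult (e ** adj d) (lmult d x) = lmult e x"
        using d D(1) by (simp add: lmult_mult subset_iff)
      then show ?thesis unfolding SN using e D(3)[OF e(1) D(4)[OF d]] by (intro bexI[of _ "e ** adj d"]) auto
    qed
    have NS: "N \<subseteq> S" using SN D(2) by (auto intro!: bexI[of _ "mat 1"])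
    define V where "V = X \<inter> ball p (\<rho> p) - S"
    have VX: "V \<subseteq> X" "closure V \<subseteq> X" using closure_minimal[of V X] X by (auto simp: V_def)
    have clV: "closure V \<subseteq> cball p (\<rho> p)"
      by (rule closure_minimal) (auto simp: V_def)
    have opV: "openin (top_of_set X) V"
    proof -
      have "V = X \<inter> (ball p (\<rho> p) - S)" by (auto simp: V_def)
      then show ?thesis using clS by (metis openin_open_Int open_Diff open_ball)
    qed
    \<comment> \<open>Off the sphere, the frontier of \<open>V\<close> lies in \<open>S\<close>, so
      it translates into \<open>N\<close>. It cannot translate into \<open>U\<close>: as
      \<open>U\<close> is relatively open, nearby points of \<open>V\<close> would then lie in
      \<open>S\<close>.\<close>
    have "N \<union> closure V - (U \<union> V) \<subseteq> (N - U) \<union> ((X \<inter> sphere p (\<rho> p)) \<union> (\<Union>d\<in>D. lmult d ` (N - U)))"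
    proof
      fix y assume y: "y \<in> N \<union> closure V - (U \<union> V)"
      show "y \<in> (N - U) \<union> ((X \<inter> sphere p (\<rho> p)) \<union> (\<Union>d\<in>D. lmult d ` (N - U)))"
      proof (cases "y \<in> N \<or> y \<in> sphere p (\<rho> p)")
        case True
        then show ?thesis using y VX by auto
      next
        case False
        then have yV: "y \<in> closure V" "y \<notin> V" "y \<in> ball p (\<rho> p)" "y \<in> X"
          using y clV VX by (auto simp: less_le)
        then have "y \<in> S" by (auto simp: V_def)
        then obtain d where d: "d \<in> D" "lmult d y \<in> N" using SN by blast
        have "lmult d y \<notin> U"
        proof
          assume dU: "lmult d y \<in> U"
          obtain O' where O': "open O'" "U = X \<inter> O'" using U(2) by (auto simp: openin_open)
          have "open (lmult d -` O')"
            using O'(1) by (intro open_vimage continuous_intros)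
          moreover have "y \<in> lmult d -` O'" using dU O' by auto
          ultimately have "lmult d -` O' \<inter> V \<noteq> {}" using yV(1) open_Int_closure_eq_empty by blast
          then obtain z where z: "z \<in> V" "lmult d z \<in> O'" by auto
          then have "lmult d z \<in> U" using DX[OF d(1)] VX O' by auto
          then have "z \<in> S" unfolding SN using d(1) U(1) by blast
          then show False using z by (simp add: V_def)
        qed
        then have "y \<in> (\<Union>d\<in>D. lmult d ` (N - U))" unfolding sat_mono using d by blast
        then show ?thesis by blast
      qed
    qed
    moreover have "neg ((N - U) \<union> ((X \<inter> sphere p (\<rho> p)) \<union> (\<Union>d\<in>D. lmult d ` (N - U))))"
      using N by (intro neg_Un U p neg_UN) auto
    ultimately have n: "neg (N \<union> closure V - (U \<union> V))" by (rule neg_subset[rotated])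
    have cV: "compact (closure V)" using bounded_subset[OF bounded_cball clV] by (simp add: compact_closure closed_closure compact_eq_bounded_closed)
    have cov: "\<exists>d\<in>D. lmult d x \<in> N \<union> closure V" if xX: "x \<in> X" and x: "x \<in> (\<Union>p\<in>insert p P. ball p (\<rho> p))" for x
    proof (cases "x \<in> S")
      case True
      then show ?thesis using SN by blast
    next
      case False
      then have "x \<notin> (\<Union>p\<in>P. ball p (\<rho> p))" using cover[OF xX] SN by blast
      then have "x \<in> V" using x xX False by (auto simp: V_def)
      then show ?thesis using D(2) closure_subset by (intro bexI[of _ "mat 1"]) auto
    qed
    \<comment> \<open>\<open>S\<close> is invariant, contains \<open>U\<close> and misses
      \<open>V\<close>, so no element moves a point between \<open>U\<close> and \<open>V\<close>;
      within \<open>V\<close> the choice of the radius applies.\<close>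
    have dis: "d = mat 1" if d: "d \<in> D" and x: "x \<in> U \<union> V" "lmult d x \<in> U \<union> V" for d x
    proof -
      have US: "z \<in> S" if "z \<in> U" for z using that U(1) NS by blast
      have xO: "x \<in> OA" using x(1) U(1) N(2) VX(1) X(2) by blast
      have undo: "lmult (adj d) (lmult d x) = x" using d D(1) by auto
      have same: "lmult d x \<in> S \<longleftrightarrow> x \<in> S"
        using Sinv[OF d, of x] Sinv[OF D(4)[OF d], of "lmult d x"] undo by auto
      consider "x \<in> U" "lmult d x \<in> U" | "x \<in> V" "lmult d x \<in> V"
        using x same US unfolding V_def by blast
      then show ?thesis
      proof cases
        case 1
        then show ?thesis using disj[OF d] by blast
      next
        case 2
        then have "dist p x \<le> \<rho> p" "dist p (lmult d x) \<le> \<rho> p" by (auto simp: V_def)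
        then show ?thesis using p(4)[OF xO] by blast
      qed
    qed
    show ?case
    proof (rule exI[of _ "N \<union> closure V"], rule exI[of _ "U \<union> V"], intro conjI)
      show "compact (N \<union> closure V)" using N cV by (intro compact_Un)
      show "N \<union> closure V \<subseteq> X" using N VX by blast
      show "U \<union> V \<subseteq> N \<union> closure V" using U(1) closure_subset by blast
      show "openin (top_of_set X) (U \<union> V)" by (intro openin_Un U opV)
      show "neg (N \<union> closure V - (U \<union> V))" by (rule n)
      show "\<forall>x\<in>X. x \<in> (\<Union>p\<in>insert p P. ball p (\<rho> p)) \<longrightarrow> (\<exists>d\<in>D. lmult d x \<in> N \<union> closure V)"
        using cov by blast
      show "\<forall>d x. d \<in> D \<longrightarrow> x \<in> U \<union> V \<longrightarrow> lmult d x \<in> U \<union> V \<longrightarrow> d = mat 1"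
        using dis by blast
    qed
  qed
  then obtain N U where N: "compact N" "N \<subseteq> X" and U: "U \<subseteq> N" "openin (top_of_set X) U" "neg (N - U)"
    and cover: "\<And>x. x \<in> X \<Longrightarrow> x \<in> (\<Union>p\<in>P. ball p (\<rho> p)) \<Longrightarrow> \<exists>d\<in>D. lmult d x \<in> N"
    and disj: "\<And>d x. d \<in> D \<Longrightarrow> x \<in> U \<Longrightarrow> lmult d x \<in> U \<Longrightarrow> d = mat 1"
    by auto
  have "\<exists>d\<in>D. lmult d x \<in> N" if x: "x \<in> X" for x
  proof -
    obtain d where d: "d \<in> D" "lmult d x \<in> C" using C(3)[OF x] by blast
    then obtain e where e: "e \<in> D" "lmult e (lmult d x) \<in> N" using cover[of "lmult d x"] P(3) C(2) by blast
    then show ?thesis using D(3)[OF e(1) d(1)] by (intro bexI[of _ "e ** d"]) (auto simp: lmult_mult)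
  qed
  then show ?thesis using disj
    by (intro exI[of _ N] exI[of _ U] conjI N U ballI impI; blast)
qed

section \<open>Null sets of a Haar measure\<close>

context
  fixes \<mu> :: "(real, 'n::{finite,linorder}) sqmat measure"
  assumes haar: "haar_measure \<mu>"
begin

lemma haar_space: "space \<mu> = OA" and haar_sets: "sets \<mu> = sets (restrict_space borel OA)"
  and haar_compact: "C \<subseteq> OA \<Longrightarrow> compact C \<Longrightarrow> emeasure \<mu> C < \<infinity>"
  and haar_invariant: "g \<in> OA \<Longrightarrow> B \<in> sets \<mu> \<Longrightarrow> emeasure \<mu> ((\<lambda>x. g ** x) ` B) = emeasure \<mu> B"
  using haar by (auto simp: haar_measure_def)

lemma haar_sets_subset: "A \<in> sets \<mu> \<Longrightarrow> A \<subseteq> OA"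
  using sets.sets_into_space[of A \<mu>] by (simp add: haar_space)

lemma haar_sets_iff: "A \<in> sets \<mu> \<longleftrightarrow> A \<subseteq> OA \<and> A \<in> sets borel"
proof -
  have "OA \<inter> space borel \<in> sets (borel :: (real, 'n) sqmat measure)" using borel_closed[OF closed_OA] by simp
  then show ?thesis unfolding haar_sets by (rule sets_restrict_space_iff)
qed

lemma haar_sets_closed: "closed A \<Longrightarrow> A \<subseteq> OA \<Longrightarrow> A \<in> sets \<mu>"
  by (simp add: haar_sets_iff borel_closed)

lemma haar_sets_open: "open A \<Longrightarrow> OA \<inter> A \<in> sets \<mu>"
  by (simp add: haar_sets_iff borel_closed[OF closed_OA] borel_open sets.Int)

lemma haar_sets_openin: "openin (top_of_set OA) A \<Longrightarrow> A \<in> sets \<mu>"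
  using haar_sets_open by (auto simp: openin_open)

lemma haar_continuous: "continuous_on OA f \<Longrightarrow> f \<in> borel_measurable \<mu>"
  using borel_measurable_continuous_on_restrict measurable_cong_sets[OF haar_sets refl] by blast

lemma lmult_image: "d \<in> OA \<Longrightarrow> A \<subseteq> OA \<Longrightarrow> lmult d ` A = lmult (adj d) -` A \<inter> OA"
  by (auto simp: lmult_OA intro!: image_eqI[where x="lmult (adj d) _"])

lemma haar_lmult_sets:
  assumes "d \<in> OA" "A \<in> sets \<mu>" shows "lmult d ` A \<in> sets \<mu>"
proof -
  have "lmult (adj d) \<in> measurable (restrict_space borel OA) (restrict_space borel OA)"
    using assms(1) by (intro measurable_restrict_space2 borel_measurable_continuous_on_restrict continuous_intros)
      (auto simp: space_restrict_space lmult_OA)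
  then have "lmult (adj d) \<in> measurable \<mu> \<mu>"
    using measurable_cong_sets[OF haar_sets haar_sets] by blast
  then have "lmult (adj d) -` A \<inter> space \<mu> \<in> sets \<mu>" using assms(2) by (rule measurable_sets)
  then show ?thesis using lmult_image[OF assms(1) haar_sets_subset[OF assms(2)]] by (simp add: haar_space)
qed

lemma haar_lmult_null:
  assumes "d \<in> OA" "A \<in> null_sets \<mu>" shows "lmult d ` A \<in> null_sets \<mu>"
proof -
  have A: "A \<in> sets \<mu>" "emeasure \<mu> A = 0" using assms(2) by auto
  have "emeasure \<mu> (lmult d ` A) = 0"
    using haar_invariant[of "emb d" A] assms(1) A by (simp add: lmult_def)
  then show ?thesis using haar_lmult_sets[OF assms(1) A(1)] by auto
qed

text \<open>On each of countably many compact sets covering \<open>OA\<close> the measure is finite,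
  and the image under \<open>f\<close> of a finite measure has only countably many atoms.\<close>

lemma countable_non_null_levels:
  assumes f: "continuous_on OA (f :: (real, 'n) sqmat \<Rightarrow> real)"
  shows "countable {r. {x \<in> OA. f x = r} \<notin> null_sets \<mu>}"
proof -
  define C where "C m = OA \<inter> cball (0 :: (real, 'n) sqmat) (real m)" for m :: nat
  have fm: "f \<in> borel_measurable \<mu>" by (rule haar_continuous[OF f])
  have C: "compact (C m)" "C m \<subseteq> OA" for m unfolding C_def by (auto intro: closed_Int_compact closed_OA)
  have Cs: "C m \<in> sets \<mu>" for m by (intro haar_sets_closed compact_imp_closed C)
  have lev: "{x \<in> OA. f x = r} \<in> sets \<mu>" for r
    using measurable_sets[OF fm, of "{r}"] by (simp add: haar_space vimage_def Int_def conj_commute)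
  define M where "M m = distr (restrict_space \<mu> (C m)) borel f" for m
  have fr: "f \<in> borel_measurable (restrict_space \<mu> (C m))" for m
    using fm by (rule measurable_restrict_space1)
  have sp: "space (restrict_space \<mu> (C m)) = C m" for m
    using C(2) by (auto simp: space_restrict_space haar_space)
  have "finite_measure (restrict_space \<mu> (C m))" for m
  proof (rule finite_measureI)
    have "emeasure (restrict_space \<mu> (C m)) (C m) = emeasure \<mu> (C m)"
      using Cs sets.Int_space_eq2[OF Cs] by (intro emeasure_restrict_space) auto
    then show "emeasure (restrict_space \<mu> (C m)) (space (restrict_space \<mu> (C m))) \<noteq> \<infinity>"
      using haar_compact[OF C(2,1)] by (simp add: sp less_top)
  qed
  then have fin: "finite_measure (M m)" for m unfolding M_def by (rule finite_measure.finite_measure_distr[OF _ fr])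
  have "countable {r. measure (M m) {r} \<noteq> 0}" for m by (rule finite_measure.countable_support[OF fin])
  then have "countable (\<Union>m. {r. measure (M m) {r} \<noteq> 0})" by auto
  moreover have "{r. {x \<in> OA. f x = r} \<notin> null_sets \<mu>} \<subseteq> (\<Union>m. {r. measure (M m) {r} \<noteq> 0})"
  proof (rule ccontr)
    assume "\<not> ?thesis"
    then obtain r where r: "{x \<in> OA. f x = r} \<notin> null_sets \<mu>" "\<And>m. measure (M m) {r} = 0" by blast
    have "{x \<in> C m. f x = r} \<in> null_sets \<mu>" for m
    proof -
      have eq: "{x \<in> C m. f x = r} = {x \<in> OA. f x = r} \<inter> C m" using C(2) by auto
      have s: "{x \<in> C m. f x = r} \<in> sets \<mu>" unfolding eq by (intro sets.Int lev Cs)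
      have "emeasure (M m) {r} = 0" using r(2) finite_measure.emeasure_eq_measure[OF fin] by simp
      moreover have "emeasure (M m) {r} = emeasure (restrict_space \<mu> (C m)) (f -` {r} \<inter> C m)"
        unfolding M_def by (subst emeasure_distr[OF fr]) (auto simp: sp)
      moreover have "f -` {r} \<inter> C m = {x \<in> C m. f x = r}" by auto
      moreover have "emeasure (restrict_space \<mu> (C m)) {x \<in> C m. f x = r} = emeasure \<mu> {x \<in> C m. f x = r}"
        using Cs sets.Int_space_eq2[OF Cs] by (intro emeasure_restrict_space) auto
      ultimately show ?thesis using s by auto
    qed
    then have "(\<Union>m. {x \<in> C m. f x = r}) \<in> null_sets \<mu>" by (intro null_sets_UN') auto
    moreover have "(\<Union>m. {x \<in> C m. f x = r}) = {x \<in> OA. f x = r}"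
      unfolding C_def using real_arch_simple by auto
    ultimately show False using r(1) by simp
  qed
  ultimately show ?thesis by (rule countable_subset[rotated])
qed

lemma measurable_saturation:
  assumes "A \<in> sets \<mu>" shows "(\<Union>d\<in>OA. lmult d ` A) \<in> sets \<mu>"
  using assms by (intro sets.countable_UN'' countable_int_matrices haar_lmult_sets)

text \<open>Countably many open sets \<open>B n\<close> cover the group, each meeting every orbit at
  most once. \<open>E n\<close> keeps those points of \<open>S2\<close> in the n-th set whose orbits
  were met neither by \<open>S1\<close> nor by an earlier part of \<open>S2\<close>; saturations are
  countable unions, so this is measurable.\<close>

lemma orbit_selection:
  assumes S1: "S1 \<in> sets \<mu>" and S2: "S2 \<in> sets \<mu>"
  obtains E where "E \<in> sets \<mu>" "E \<subseteq> S2" "\<And>x. x \<in> S2 \<Longrightarrow> \<exists>d\<in>OA. lmult d x \<in> S1 \<union> E"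
    "\<And>d x. d \<in> OA \<Longrightarrow> x \<in> E \<Longrightarrow> lmult d x \<in> E \<Longrightarrow> d = mat 1"
    "\<And>d x. d \<in> OA \<Longrightarrow> x \<in> E \<Longrightarrow> lmult d x \<notin> S1"
proof -
  define P where "P x r \<longleftrightarrow> r > 0 \<and> (\<forall>d y. y \<in> OA \<longrightarrow> dist x y \<le> r \<longrightarrow> dist x (lmult d y) \<le> r \<longrightarrow> d = mat 1)"
    for x :: "(real, 'n) sqmat" and r
  define \<rho> where "\<rho> x = (SOME r. P x r)" for x
  have P\<rho>: "P x (\<rho> x)" if x: "x \<in> OA" for x
  proof -
    obtain r where "r > 0" "\<And>d y. y \<in> OA \<Longrightarrow> dist x y \<le> r \<Longrightarrow> dist x (lmult d y) \<le> r \<Longrightarrow> d = mat 1"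
      by (rule small_ball[OF x], rule that)
    then have "P x r" by (simp add: P_def)
    then show ?thesis unfolding \<rho>_def by (rule someI)
  qed
  have \<rho>: "\<rho> x > 0" "y \<in> OA \<Longrightarrow> dist x y \<le> \<rho> x \<Longrightarrow> dist x (lmult d y) \<le> \<rho> x \<Longrightarrow> d = mat 1"
    if "x \<in> OA" for x y d
    using P\<rho>[OF that] by (auto simp: P_def)
  define \<B> where "\<B> = (\<lambda>x :: (real, 'n) sqmat. ball x (\<rho> x)) ` OA"
  obtain \<B>' where \<B>': "\<B>' \<subseteq> \<B>" "countable \<B>'" "\<Union>\<B>' = \<Union>\<B>"
    by (rule Lindelof[of \<B>]) (auto simp: \<B>_def)
  have "mat 1 \<in> \<Union>\<B>"
    unfolding \<B>_def using \<rho>(1)[OF OA_one] by (intro UN_I[OF OA_one]) simp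
  then have ne: "\<B>' \<noteq> {}" using \<B>'(3) by auto
  define B where "B = from_nat_into \<B>'"
  have Bin: "B n \<in> \<B>" for n using from_nat_into[OF ne, of n] \<B>'(1) by (auto simp: B_def)
  have cover: "\<exists>n. x \<in> B n" if "x \<in> OA" for x
  proof -
    have "x \<in> \<Union>\<B>" unfolding \<B>_def using \<rho>(1)[OF that] that by (intro UN_I[OF that]) simp
    then obtain A where "A \<in> \<B>'" "x \<in> A" using \<B>'(3) by blast
    then show ?thesis unfolding B_def using from_nat_into_surj[OF \<B>'(2)] by metis
  qed
  have Bopen: "open (B n)" for n using Bin[of n] by (auto simp: \<B>_def)
  have Bfree: "d = mat 1" if "x \<in> OA" "x \<in> B n" "lmult d x \<in> B n" for d x n
  proof -
    obtain p where p: "p \<in> OA" "B n = ball p (\<rho> p)" using Bin[of n] by (auto simp: \<B>_def)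
    show ?thesis by (rule \<rho>(2)[OF p(1) that(1)]) (use that p in auto)
  qed
  define sat where "sat A = (\<Union>d\<in>OA. lmult d ` A)" for A :: "(real, 'n) sqmat set"
  have sat: "x \<in> sat A \<longleftrightarrow> (\<exists>d\<in>OA. lmult d x \<in> A)" for x A
  proof
    assume "x \<in> sat A"
    then obtain d y where "d \<in> OA" "y \<in> A" "x = lmult d y" by (auto simp: sat_def)
    then show "\<exists>d\<in>OA. lmult d x \<in> A" by (intro bexI[of _ "adj d"]) auto
  next
    assume "\<exists>d\<in>OA. lmult d x \<in> A"
    then obtain d where d: "d \<in> OA" "lmult d x \<in> A" by blast
    then have "x = lmult (adj d) (lmult d x)" by simp
    then show "x \<in> sat A" unfolding sat_def using d by (intro UN_I[of "adj d"] image_eqI[of _ _ "lmult d x"]) auto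
  qed
  define E where "E n = S2 \<inter> B n - sat (S1 \<union> (\<Union>m<n. S2 \<inter> B m))" for n
  have SB: "S2 \<inter> B n \<in> sets \<mu>" for n
  proof -
    have "S2 \<inter> B n = S2 \<inter> (OA \<inter> B n)" using haar_sets_subset[OF S2] by blast
    then show ?thesis using haar_sets_open[OF Bopen] S2 by (metis sets.Int)
  qed
  have "E n \<in> sets \<mu>" for n
    unfolding E_def sat_def by (intro sets.Diff sets.Un sets.finite_UN SB measurable_saturation S1) auto
  then have Es: "(\<Union>n. E n) \<in> sets \<mu>" by auto
  have dis: False if "m < n" "d \<in> OA" "x \<in> E n" "lmult d x \<in> E m" for m n d x
  proof -
    have "x \<in> sat (S1 \<union> (\<Union>m<n. S2 \<inter> B m))"
      unfolding sat using that by (intro bexI[of _ d]) (auto simp: E_def)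
    then show False using that(3) by (simp add: E_def)
  qed
  show ?thesis
  proof (rule that[OF Es])
    show "(\<Union>n. E n) \<subseteq> S2" by (auto simp: E_def)
    show "\<exists>d\<in>OA. lmult d x \<in> S1 \<union> (\<Union>n. E n)" if x: "x \<in> S2" for x
    proof (cases "\<exists>d\<in>OA. lmult d x \<in> S1")
      case False
      define P where "P n \<longleftrightarrow> (\<exists>d\<in>OA. lmult d x \<in> S2 \<inter> B n)" for n
      obtain n0 where "x \<in> B n0" using cover x haar_sets_subset[OF S2] by blast
      then have "P n0" unfolding P_def using x by (intro bexI[of _ "mat 1"]) auto
      define n where "n = (LEAST n. P n)"
      have "P n" unfolding n_def by (rule LeastI[of P, OF \<open>P n0\<close>])
      then obtain d where d: "d \<in> OA" "lmult d x \<in> S2 \<inter> B n" by (auto simp: P_def)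
      have "lmult d x \<notin> sat (S1 \<union> (\<Union>m<n. S2 \<inter> B m))"
      proof
        assume "lmult d x \<in> sat (S1 \<union> (\<Union>m<n. S2 \<inter> B m))"
        then obtain e where e: "e \<in> OA" "lmult e (lmult d x) \<in> S1 \<union> (\<Union>m<n. S2 \<inter> B m)" using sat by blast
        then have ed: "e ** d \<in> OA" "lmult (e ** d) x \<in> S1 \<union> (\<Union>m<n. S2 \<inter> B m)"
          using d(1) by (auto simp: lmult_mult OA_mult)
        then obtain m where "m < n" "P m" using False unfolding P_def by blast
        then show False using not_less_Least[of m P] by (simp add: n_def)
      qed
      then have "lmult d x \<in> E n" using d(2) by (simp add: E_def)
      then show ?thesis using d(1) by blast
    qed blast
    show "d = mat 1" if d: "d \<in> OA" and xE: "x \<in> (\<Union>n. E n)" "lmult d x \<in> (\<Union>n. E n)" for d x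
    proof -
      obtain n m where n: "x \<in> E n" and m: "lmult d x \<in> E m" using xE by blast
      have xO: "x \<in> OA" using n haar_sets_subset[OF S2] by (auto simp: E_def)
      consider "m < n" | "m = n" | "n < m" by linarith
      then show ?thesis
      proof cases
        case 1
        then show ?thesis using dis d n m by blast
      next
        case 2
        then show ?thesis using Bfree[OF xO, of n d] n m by (auto simp: E_def)
      next
        case 3
        have "lmult (adj d) (lmult d x) \<in> E n" using n d by simp
        then show ?thesis using dis[OF 3, of "adj d" "lmult d x"] d m by simp
      qed
    qed
    show "lmult d x \<notin> S1" if d: "d \<in> OA" and xE: "x \<in> (\<Union>n. E n)" for d x
    proof
      assume "lmult d x \<in> S1"
      then have "x \<in> sat (S1 \<union> (\<Union>m<n. S2 \<inter> B m))" for n unfolding sat using d by blast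
      then show False using xE by (auto simp: E_def)
    qed
  qed
qed

text \<open>A subset of \<open>X\<close> counts as negligible if its preimage under the equivariant
  coordinate \<open>p\<close> lies in a null set. Measuring on the whole group avoids a
  factorisation of the Haar measure along \<open>N T K\<close>; spheres in \<open>X\<close>
  correspond to level sets of the distance from \<open>p y\<close> to the centre.\<close>

lemma tile:
  fixes X C :: "(real, 'n) sqmat set"
  assumes X: "closed X" "X \<subseteq> OA"
    and D: "D \<subseteq> OA" "mat 1 \<in> D" "\<And>d e. d \<in> D \<Longrightarrow> e \<in> D \<Longrightarrow> d ** e \<in> D" "\<And>d. d \<in> D \<Longrightarrow> adj d \<in> D"
    and DX: "\<And>d x. d \<in> D \<Longrightarrow> x \<in> X \<Longrightarrow> lmult d x \<in> X"
    and C: "compact C" "C \<subseteq> X" "\<And>x. x \<in> X \<Longrightarrow> \<exists>d\<in>D. lmult d x \<in> C"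
    and p: "continuous_on OA p" "\<And>x. x \<in> OA \<Longrightarrow> p x \<in> X"
      "\<And>d x. d \<in> D \<Longrightarrow> x \<in> OA \<Longrightarrow> p (lmult d x) = lmult d (p x)"
  shows "\<exists>N U. compact N \<and> N \<subseteq> X \<and> U \<subseteq> N \<and> openin (top_of_set X) U \<and>
    (\<exists>Z\<in>null_sets \<mu>. {x \<in> OA. p x \<in> N - U} \<subseteq> Z) \<and>
    (\<forall>x\<in>X. \<exists>d\<in>D. lmult d x \<in> N) \<and> (\<forall>d\<in>D. \<forall>x\<in>U. lmult d x \<in> U \<longrightarrow> d = mat 1)"
proof -
  define neg where "neg A \<longleftrightarrow> (\<exists>Z\<in>null_sets \<mu>. {x \<in> OA. p x \<in> A} \<subseteq> Z)" for A
  have e: "neg {}" unfolding neg_def by (intro bexI[of _ "{}"]) auto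
  have u: "neg (A \<union> B)" if AB: "neg A" "neg B" for A B
  proof -
    obtain Z W where "Z \<in> null_sets \<mu>" "{x \<in> OA. p x \<in> A} \<subseteq> Z" "W \<in> null_sets \<mu>" "{x \<in> OA. p x \<in> B} \<subseteq> W"
      using AB unfolding neg_def by blast
    then show ?thesis unfolding neg_def by (intro bexI[of _ "Z \<union> W"]) auto
  qed
  have s: "neg B" if "neg A" "B \<subseteq> A" for A B using that unfolding neg_def by blast
  have un: "neg (\<Union>d\<in>D. lmult d ` A)" if A: "neg A" "A \<subseteq> X" for A
  proof -
    obtain Z where Z: "Z \<in> null_sets \<mu>" "{x \<in> OA. p x \<in> A} \<subseteq> Z" using A(1) unfolding neg_def by blast
    have "(\<Union>d\<in>D. lmult d ` Z) \<in> null_sets \<mu>"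
      using D(1) Z(1) by (intro null_sets_UN' countable_int_matrices haar_lmult_null) auto
    moreover have "{x \<in> OA. p x \<in> (\<Union>d\<in>D. lmult d ` A)} \<subseteq> (\<Union>d\<in>D. lmult d ` Z)"
    proof
      fix x assume "x \<in> {x \<in> OA. p x \<in> (\<Union>d\<in>D. lmult d ` A)}"
      then obtain d y where dy: "x \<in> OA" "d \<in> D" "y \<in> A" "p x = lmult d y" by blast
      have dO: "d \<in> OA" using dy D by blast
      have "p (lmult (adj d) x) = y" using p(3)[OF D(4)[OF dy(2)] dy(1)] dy(4) dO by simp
      then have "lmult (adj d) x \<in> Z" using Z(2) dy dO lmult_OA[of "adj d" x] by auto
      then show "x \<in> (\<Union>d\<in>D. lmult d ` Z)"
        using dy(2) dO by (intro UN_I[OF dy(2)] image_eqI[of _ _ "lmult (adj d) x"]) auto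
    qed
    ultimately show ?thesis unfolding neg_def by blast
  qed
  have sph: "\<exists>r. 0 < r \<and> r < \<epsilon> \<and> neg (X \<inter> sphere x r)" if "x \<in> X" "\<epsilon> > 0" for x \<epsilon>
  proof -
    have "continuous_on OA (\<lambda>y. dist x (p y))" by (intro continuous_intros p)
    then have "countable {r. {y \<in> OA. dist x (p y) = r} \<notin> null_sets \<mu>}" by (rule countable_non_null_levels)
    moreover have "uncountable {0<..<\<epsilon>}" using that(2) by (simp add: uncountable_open_interval)
    ultimately have "\<not> {0<..<\<epsilon>} \<subseteq> {r. {y \<in> OA. dist x (p y) = r} \<notin> null_sets \<mu>}" using countable_subset by blast
    then obtain r where r: "0 < r" "r < \<epsilon>" "{y \<in> OA. dist x (p y) = r} \<in> null_sets \<mu>" by auto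
    then have "neg (X \<inter> sphere x r)"
      unfolding neg_def by (intro bexI[OF _ r(3)]) auto
    then show ?thesis using r by blast
  qed
  have "\<exists>N U. compact N \<and> N \<subseteq> X \<and> U \<subseteq> N \<and> openin (top_of_set X) U \<and> neg (N - U) \<and>
    (\<forall>x\<in>X. \<exists>d\<in>D. lmult d x \<in> N) \<and> (\<forall>d\<in>D. \<forall>x\<in>U. lmult d x \<in> U \<longrightarrow> d = mat 1)"
    by (rule tessellation[where C=C]) (fact X D DX C e u s un sph)+
  then show ?thesis unfolding neg_def .
qed

end

section \<open>The box-shaped fundamental domain\<close>

text \<open>The domain is \<open>S1 \<union> E\<close>, where \<open>E\<close> represents the orbits
  of \<open>S2\<close> that miss \<open>S1\<close>. Its translates can overlap only inside
  \<open>S1\<close>, and since the action separates the points of \<open>U\<close>, only in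
  \<open>Z\<close> and a translate of \<open>Z\<close>.\<close>

lemma fundamental_domain_box_shaped:
  fixes \<mu> :: "(real, 'n::{finite,linorder}) sqmat measure"
  assumes haar: "haar_measure \<mu>"
    and S1: "generalized_siegel_set K S1" "S1 \<in> sets \<mu>"
    and S2: "generalized_siegel_set K S2" "S2 \<in> sets \<mu>" "S1 \<subseteq> S2"
    and U: "U \<subseteq> S1" "openin (top_of_set OA) U"
    and Z: "Z \<in> null_sets \<mu>" "S1 - U \<subseteq> Z"
    and free: "\<And>d x. d \<in> OA \<Longrightarrow> x \<in> U \<Longrightarrow> lmult d x \<in> U \<Longrightarrow> d = mat 1"
    and cover: "\<And>x. x \<in> OA \<Longrightarrow> \<exists>d\<in>OA. lmult d x \<in> S2"
    and cusp: "c > 0" "S1 \<inter> siegel N_grp c K = S2 \<inter> siegel N_grp c K"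
  shows "\<exists>F. fundamental_domain \<mu> F \<and> box_shaped_at_infinity \<mu> K F"
proof -
  obtain E where E: "E \<in> sets \<mu>" "E \<subseteq> S2" "\<And>x. x \<in> S2 \<Longrightarrow> \<exists>d\<in>OA. lmult d x \<in> S1 \<union> E"
    "\<And>d x. d \<in> OA \<Longrightarrow> x \<in> E \<Longrightarrow> lmult d x \<in> E \<Longrightarrow> d = mat 1"
    "\<And>d x. d \<in> OA \<Longrightarrow> x \<in> E \<Longrightarrow> lmult d x \<notin> S1"
    by (rule orbit_selection[OF haar S1(2) S2(2)], rule that)
  have S1O: "S1 \<subseteq> OA" and S2O: "S2 \<subseteq> OA"
    using haar_sets_subset[OF haar S1(2)] haar_sets_subset[OF haar S2(2)] .
  have orb: "orbit g \<inter> A \<noteq> {}" if "\<exists>d\<in>OA. lmult d g \<in> A" for g :: "(real, 'n) sqmat" and A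
    using that by (auto simp: orbit_def)
  let ?F = "S1 \<union> E"
  have "fundamental_domain \<mu> ?F"
    unfolding fundamental_domain_def
  proof (intro conjI ballI impI)
    show "?F \<subseteq> OA" using S1O S2O E(2) by blast
    show Fs: "?F \<in> sets \<mu>" using S1(2) E(1) by blast
    fix g :: "(real, 'n) sqmat" assume "g \<in> OA"
    then obtain d where d: "d \<in> OA" "lmult d g \<in> S2" using cover by blast
    then obtain e where "e \<in> OA" "lmult e (lmult d g) \<in> ?F" using E(3) by blast
    then show "orbit g \<inter> ?F \<noteq> {}" using d(1) by (intro orb bexI[of _ "e ** d"]) (auto simp: lmult_mult OA_mult)
  next
    fix d :: "(int, 'n) sqmat" assume d: "d \<in> OA" "d \<noteq> mat 1"
    have "lmult d ` ?F \<inter> ?F \<subseteq> Z \<union> lmult d ` Z"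
    proof
      fix y assume "y \<in> lmult d ` ?F \<inter> ?F"
      then obtain x where x: "x \<in> ?F" "y = lmult d x" "y \<in> ?F" by blast
      have undo: "x = lmult (adj d) y" "adj d \<in> OA" using x(2) d(1) by simp_all
      have xE: "x \<notin> E"
        using E(4)[OF d(1), of x] E(5)[OF d(1), of x] x(2,3) d(2) by blast
      then have "x \<in> S1" using x(1) by blast
      then have "y \<notin> E" using E(5)[OF undo(2), of y] undo(1) by metis
      with xE have "x \<in> S1" "y \<in> S1" using x by auto
      moreover have "x \<notin> U \<or> y \<notin> U" using free[OF d(1), of x] d(2) x(2) by blast
      ultimately show "y \<in> Z \<union> lmult d ` Z" using Z(2) x(2) by blast
    qed
    moreover have "Z \<union> lmult d ` Z \<in> null_sets \<mu>"
      using Z(1) haar_lmult_null[OF haar d(1) Z(1)] by (rule null_sets.Un)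
    moreover have Fs: "?F \<in> sets \<mu>" using S1(2) E(1) by blast
    have "lmult d ` ?F \<inter> ?F \<in> sets \<mu>" using haar_lmult_sets[OF haar d(1) Fs] Fs by (rule sets.Int)
    ultimately show "lmult d ` ?F \<inter> ?F \<in> null_sets \<mu>" by (meson null_sets_subset)
  qed
  moreover have "box_shaped_at_infinity \<mu> K ?F"
    unfolding box_shaped_at_infinity_def
  proof (rule exI[of _ S1], rule exI[of _ S2], intro conjI)
    show "\<exists>U1\<subseteq>S1. openin (top_of_set OA) U1 \<and> (AE x in \<mu>. x \<in> S1 \<longrightarrow> x \<in> U1) \<and>
       (\<forall>g\<in>OA. \<forall>x\<in>orbit g \<inter> U1. \<forall>y\<in>orbit g \<inter> U1. x = y)"
    proof (intro exI[of _ U] conjI U ballI)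
      show "AE x in \<mu>. x \<in> S1 \<longrightarrow> x \<in> U"
        by (rule AE_I'[OF Z(1)]) (use Z(2) in auto)
      fix g :: "(real, 'n) sqmat" and x y assume g: "g \<in> OA" and x: "x \<in> orbit g \<inter> U" and y: "y \<in> orbit g \<inter> U"
      obtain d e where d: "d \<in> OA" "x = lmult d g" and e: "e \<in> OA" "y = lmult e g"
        using x y by (auto simp: orbit_def)
      have "y = lmult (e ** adj d) x" using d e by (simp add: lmult_mult)
      moreover have "e ** adj d \<in> OA" using d e by (simp add: OA_mult)
      ultimately have "e ** adj d = mat 1" using free[of "e ** adj d" x] x y by auto
      then show "x = y" using \<open>y = lmult (e ** adj d) x\<close> by simp
    qed
    show "\<forall>g\<in>OA. orbit g \<inter> S2 \<noteq> {}" using cover orb by blast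
    show "\<exists>c>0. S1 \<inter> siegel N_grp c K = S2 \<inter> siegel N_grp c K" using cusp by blast
  qed (use S1 S2 E(2) in auto)
  ultimately show ?thesis by blast
qed

text \<open>Write \<open>w b k\<close> as \<open>(w b w\<inverse>) (w k)\<close>:
  \<open>W_int\<close> lies in \<open>K_std\<close> and normalises \<open>B_grp\<close>.\<close>

lemma iwasawa_W_int:
  assumes w: "w \<in> W_int" and y: "y \<in> OA"
  shows "iwB (lmult w y) = emb w ** iwB y ** adj (emb w)" "iwK (lmult w y) = lmult w (iwK y)"
proof -
  have wO: "emb w \<in> OA" using w by (simp add: W_int_def)
  have "lmult w y = (emb w ** iwB y ** adj (emb w)) ** (emb w ** iwK y)"
  proof -
    have "(emb w ** iwB y ** adj (emb w)) ** (emb w ** iwK y) = emb w ** iwB y ** (adj (emb w) ** emb w) ** iwK y"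
      by (simp add: matrix_mul_assoc)
    also have "\<dots> = emb w ** (iwB y ** iwK y)" by (simp add: OA_D[OF wO] matrix_mul_assoc)
    finally show ?thesis by (simp add: iwasawa(3)[OF y] lmult_emb)
  qed
  then show "iwB (lmult w y) = emb w ** iwB y ** adj (emb w)" "iwK (lmult w y) = lmult w (iwK y)"
    using iwasawa_eq[OF W_int_conj_B[OF w iwasawa(2)[OF y]] K_std_mult[OF W_int_K_std[OF w] iwasawa(1)[OF y]]]
    by (simp_all add: lmult_emb)
qed

text \<open>Coordinates of the decomposition \<open>N T K\<close> for \<open>K = b\<inverse> K_std b\<close>: the compact part of \<open>x\<close> is
  \<open>b\<inverse> k b\<close> with \<open>k\<close> the compact part of \<open>x b\<inverse>\<close> for \<open>K_std\<close>.\<close>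

definition lower_part :: "(real, 'n::{finite,linorder}) sqmat \<Rightarrow> (real, 'n) sqmat \<Rightarrow> (real, 'n) sqmat" where
  "lower_part b x = iwB (x ** adj b) ** b"

definition compact_part :: "(real, 'n::{finite,linorder}) sqmat \<Rightarrow> (real, 'n) sqmat \<Rightarrow> (real, 'n) sqmat" where
  "compact_part b x = iwK (x ** adj b)"

context
  fixes b :: "(real, 'n::{finite,linorder}) sqmat"
  assumes b: "b \<in> B_grp"
begin

lemma bOA: "b \<in> OA" by (rule B_grp_OA[OF b])

lemma shift_OA: "x \<in> OA \<Longrightarrow> x ** adj b \<in> OA" using bOA by (simp add: OA_mult)

lemma lower_part_B: "x \<in> OA \<Longrightarrow> lower_part b x \<in> B_grp"
  unfolding lower_part_def by (intro B_grp_mult iwasawa shift_OA b)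

lemma compact_part_K: "x \<in> OA \<Longrightarrow> compact_part b x \<in> K_std"
  unfolding compact_part_def by (intro iwasawa shift_OA)

lemma parts_eq: "x \<in> OA \<Longrightarrow> lower_part b x ** (adj b ** compact_part b x ** b) = x"
proof -
  assume x: "x \<in> OA"
  have "lower_part b x ** (adj b ** compact_part b x ** b) = (iwB (x ** adj b) ** b ** adj b) ** compact_part b x ** b"
    by (simp add: lower_part_def matrix_mul_assoc)
  also have "\<dots> = (iwB (x ** adj b) ** iwK (x ** adj b)) ** b"
    by (simp add: OA_cancel_right[OF bOA] compact_part_def)
  also have "\<dots> = x" by (simp add: iwasawa(3)[OF shift_OA[OF x]] OA_cancel_right[OF bOA])
  finally show ?thesis .
qed

lemma parts_unique:
  assumes "l \<in> B_grp" "k \<in> K_std"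
  shows "lower_part b (l ** (adj b ** k ** b)) = l" "compact_part b (l ** (adj b ** k ** b)) = k"
proof -
  have "l ** (adj b ** k ** b) ** adj b = (l ** adj b) ** k"
    by (simp add: matrix_mul_assoc OA_cancel_right[OF bOA])
  moreover have "l ** adj b \<in> B_grp" using assms b by (simp add: B_grp_mult B_grp_adj)
  ultimately show "lower_part b (l ** (adj b ** k ** b)) = l" "compact_part b (l ** (adj b ** k ** b)) = k"
    using assms(2) by (simp_all add: lower_part_def compact_part_def iwasawa_eq OA_cancel_right[OF bOA])
qed

lemma continuous_on_shift: "continuous_on OA (\<lambda>x. x ** adj b)"
  by (intro continuous_intros)

lemma continuous_on_lower_part: "continuous_on OA (lower_part b)"
proof -
  have "continuous_on OA (\<lambda>x. iwB (x ** adj b))"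
    by (rule continuous_on_compose2[OF continuous_on_iwB continuous_on_shift]) (auto simp: shift_OA)
  then show ?thesis unfolding lower_part_def[abs_def] by (intro continuous_intros)
qed

lemma continuous_on_compact_part: "continuous_on OA (compact_part b)"
  unfolding compact_part_def[abs_def]
  by (rule continuous_on_compose2[OF continuous_on_iwK continuous_on_shift]) (auto simp: shift_OA)

lemma lower_part_N_int:
  assumes d: "d \<in> N_int" and x: "x \<in> OA"
  shows "lower_part b (lmult d x) = lmult d (lower_part b x)" "compact_part b (lmult d x) = compact_part b x"
proof -
  have "lmult d x = lmult d (lower_part b x) ** (adj b ** compact_part b x ** b)"
    using parts_eq[OF x] by (metis lmult_assoc)
  moreover have "lmult d (lower_part b x) \<in> B_grp"
    using d lower_part_B[OF x] N_grp_B by (auto simp: lmult_emb N_int_def intro!: B_grp_mult)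
  ultimately show "lower_part b (lmult d x) = lmult d (lower_part b x)" "compact_part b (lmult d x) = compact_part b x"
    using parts_unique compact_part_K[OF x] by metis+
qed

lemma compact_part_W_int: "w \<in> W_int \<Longrightarrow> x \<in> OA \<Longrightarrow> compact_part b (lmult w x) = lmult w (compact_part b x)"
  unfolding compact_part_def lmult_assoc[symmetric] by (rule iwasawa_W_int(2)[OF _ shift_OA])

lemma siegel_iff:
  assumes "N' \<subseteq> N_grp" "K' \<subseteq> K_std"
  shows "x \<in> siegel N' c ((\<lambda>k. adj b ** k ** b) ` K') \<longleftrightarrow>
    x \<in> OA \<and> npart (lower_part b x) \<in> N' \<and> diagm (lower_part b x) \<in> T_above c \<and> compact_part b x \<in> K'"
proof
  assume "x \<in> siegel N' c ((\<lambda>k. adj b ** k ** b) ` K')"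
  then obtain u t k where *: "u \<in> N'" "t \<in> T_above c" "k \<in> K'" and x: "x = (u ** t) ** (adj b ** k ** b)"
    by (auto simp: siegel_def)
  then have u: "u \<in> N_grp" and t: "t \<in> T_grp" and k: "k \<in> K_std" using assms by (auto simp: T_above_def)
  have ut: "u ** t \<in> B_grp" using u t by (simp add: B_grp_mult N_grp_B T_grp_B)
  have "x \<in> OA" unfolding x using ut k bOA by (simp add: OA_mult B_grp_OA K_std_OA)
  then show "x \<in> OA \<and> npart (lower_part b x) \<in> N' \<and> diagm (lower_part b x) \<in> T_above c \<and> compact_part b x \<in> K'"
    using * by (simp add: x parts_unique[OF ut k] npart_NT[OF u t])
next
  assume A: "x \<in> OA \<and> npart (lower_part b x) \<in> N' \<and> diagm (lower_part b x) \<in> T_above c \<and> compact_part b x \<in> K'"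
  then have "x = npart (lower_part b x) ** diagm (lower_part b x) ** (adj b ** compact_part b x ** b)"
    using npart_diagm[OF lower_part_B] parts_eq by simp
  then show "x \<in> siegel N' c ((\<lambda>k. adj b ** k ** b) ` K')"
    unfolding siegel_def using A by blast
qed

end

theorem theorem2p1:
  fixes K :: "(real, 'n::{finite,linorder}) sqmat set"
    and \<mu> :: "(real, 'n) sqmat measure"
  assumes "CARD('n) \<ge> 3"
    and "maximal_compact_subgroup K"
    and "haar_measure \<mu>"
  shows "\<exists>F. fundamental_domain \<mu> F \<and> box_shaped_at_infinity \<mu> K F"
proof -
  note n = assms(1) and haar = assms(3)
  obtain b where b: "b \<in> B_grp" and K: "K = (\<lambda>k. adj b ** k ** b) ` K_std"
    by (rule maximal_compact_eq[OF assms(2)])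
  have bp: "b $ i $ i > 0" for i using b by (simp add: B_grp_def lowpos_def)
  let ?n = "\<lambda>x. npart (lower_part b x)" and ?s = "\<lambda>x. diagm (lower_part b x)" and ?k = "compact_part b"
  have sN: "?n (lmult d x) = lmult d (?n x)" "?s (lmult d x) = ?s x" if "d \<in> N_int" "x \<in> OA" for d x
    using that lower_part_N_int(1)[OF b that] npart_mult[of "emb d" "lower_part b x"] diagm_mult[of "emb d" "lower_part b x"] lower_part_B[OF b]
    by (simp_all add: lmult_emb N_int_def)
  have contn: "continuous_on OA ?n" and conts: "continuous_on OA ?s"
    using continuous_on_lower_part[OF b] by (auto intro!: continuous_intros)
  obtain C :: "(real, 'n) sqmat set" where C: "compact C" "C \<subseteq> N_grp" "\<And>u. u \<in> N_grp \<Longrightarrow> \<exists>d\<in>N_int. lmult d u \<in> C"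
    by (rule N_int_cocompact, rule that)
  have NintO: "N_int \<subseteq> (OA :: (int, 'n) sqmat set)" "mat 1 \<in> (N_int :: (int, 'n) sqmat set)"
    by (auto simp: N_int_def N_grp_iff B_grp_one) (simp add: mat_def)
  have Nint_mult: "d ** e \<in> N_int" if "d \<in> N_int" "e \<in> N_int" for d e :: "(int, 'n) sqmat"
    using that by (simp add: N_int_def N_grp_unipotent emb_mult OA_mult unipotent_mult)
  have Nint_adj: "adj d \<in> N_int" if "d \<in> N_int" for d :: "(int, 'n) sqmat"
    using that by (simp add: N_int_def N_grp_iff emb_adj B_grp_adj) (simp add: adj_nth)
  have Nint_act: "lmult d u \<in> N_grp" if "d \<in> N_int" "u \<in> N_grp" for d and u :: "(real, 'n) sqmat"
    using that by (simp add: N_int_def N_grp_unipotent lmult_emb OA_mult unipotent_mult)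
  have N_OA: "N_grp \<subseteq> (OA :: (real, 'n) sqmat set)" by (auto simp: N_grp_unipotent)
  have nN: "?n x \<in> N_grp" if "x \<in> OA" for x by (rule npart_N[OF lower_part_B[OF b that]])
  have "\<exists>N U. compact N \<and> N \<subseteq> N_grp \<and> U \<subseteq> N \<and> openin (top_of_set N_grp) U \<and>
    (\<exists>Z\<in>null_sets \<mu>. {x \<in> OA. ?n x \<in> N - U} \<subseteq> Z) \<and>
    (\<forall>x\<in>N_grp. \<exists>d\<in>N_int. lmult d x \<in> N) \<and> (\<forall>d\<in>N_int. \<forall>x\<in>U. lmult d x \<in> U \<longrightarrow> d = mat 1)"
    by (rule tile[OF haar, where C=C])
       (fact closed_N_grp N_OA NintO Nint_mult Nint_adj Nint_act C contn nN sN(1))+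
  then obtain N' VN ZN where N': "compact N'" "N' \<subseteq> N_grp" "VN \<subseteq> N'" "openin (top_of_set N_grp) VN"
    "ZN \<in> null_sets \<mu>" "{x \<in> OA. ?n x \<in> N' - VN} \<subseteq> ZN"
    "\<And>x. x \<in> N_grp \<Longrightarrow> \<exists>d\<in>N_int. lmult d x \<in> N'"
    "\<And>d x. d \<in> N_int \<Longrightarrow> x \<in> VN \<Longrightarrow> lmult d x \<in> VN \<Longrightarrow> d = mat 1"
    by blast
  have WintO: "W_int \<subseteq> (OA :: (int, 'n) sqmat set)" by (auto simp: W_int_def)
  have K_OA: "K_std \<subseteq> (OA :: (real, 'n) sqmat set)" by (auto simp: K_std_def)
  have Wact: "lmult w k \<in> K_std" if "w \<in> W_int" "k \<in> K_std" for w and k :: "(real, 'n) sqmat"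
    unfolding lmult_emb by (intro K_std_mult W_int_K_std that)
  have Wcov: "\<exists>d\<in>W_int. lmult d x \<in> K_std" if "x \<in> K_std" for x :: "(real, 'n) sqmat"
    using that W_int_one by (intro bexI[of _ "mat 1"]) auto
  have clK: "closed (K_std :: (real, 'n) sqmat set)" by (rule compact_imp_closed[OF compact_K_std])
  have "\<exists>N U. compact N \<and> N \<subseteq> K_std \<and> U \<subseteq> N \<and> openin (top_of_set K_std) U \<and>
    (\<exists>Z\<in>null_sets \<mu>. {x \<in> OA. ?k x \<in> N - U} \<subseteq> Z) \<and>
    (\<forall>x\<in>K_std. \<exists>d\<in>W_int. lmult d x \<in> N) \<and> (\<forall>d\<in>W_int. \<forall>x\<in>U. lmult d x \<in> U \<longrightarrow> d = mat 1)"
    by (rule tile[OF haar, where C=K_std])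
       (fact clK K_OA WintO W_int_one W_int_mult W_int_adj Wact compact_K_std subset_refl Wcov
          continuous_on_compact_part[OF b] compact_part_K[OF b] compact_part_W_int[OF b])+
  then obtain K' VK ZK where K': "compact K'" "K' \<subseteq> K_std" "VK \<subseteq> K'" "openin (top_of_set K_std) VK"
    "ZK \<in> null_sets \<mu>" "{x \<in> OA. ?k x \<in> K' - VK} \<subseteq> ZK"
    "\<And>x. x \<in> K_std \<Longrightarrow> \<exists>d\<in>W_int. lmult d x \<in> K'"
    "\<And>d x. d \<in> W_int \<Longrightarrow> x \<in> VK \<Longrightarrow> lmult d x \<in> VK \<Longrightarrow> d = mat 1"
    by blast
  \<comment> \<open>The results on heights concern the standard decomposition of
    \<open>x ** adj b\<close>. Passing to \<open>lower_part\<close> multiplies its diagonal by that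
    of \<open>b\<close>, and \<open>q\<close> bounds the distortion of the quotients in both
    directions.\<close>
  define q where "q = Max (range (\<lambda>(i, j). b $ j $ j / b $ i $ i))"
  have q: "b $ j $ j \<le> q * b $ i $ i" for i j
  proof -
    have "b $ j $ j / b $ i $ i \<le> q" unfolding q_def by (rule Max_ge) (auto intro: image_eqI[of _ _ "(i, j)"])
    then show ?thesis using bp[of i] by (simp add: field_simps)
  qed
  have q1: "1 \<le> q" using q[of undefined undefined] bp[of undefined] by simp
  \<comment> \<open>\<open>c1 = q\<close> makes the standard coordinates exceed 1, as
    \<open>siegel_triangular\<close> requires; \<open>c2\<close> is the bound 1/2 from
    \<open>reduction\<close> divided by \<open>q\<close>.\<close>
  define c1 c2 where "c1 = q" and "c2 = 1 / (2 * q)"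
  have c: "c1 > 0" "c2 > 0" "c2 \<le> c1"
    using q1 mult_mono[of 1 q 1 q] by (auto simp: c1_def c2_def field_simps)
  have diag: "lower_part b x $ i $ i = iwB (x ** adj b) $ i $ i * b $ i $ i" if "x \<in> OA" for x i
    using iwasawa(2)[OF shift_OA[OF b that]] b by (simp add: lower_part_def lowtri_mult_diag B_grp_def lowpos_def)
  have s_above: "?s x \<in> T_above c \<longleftrightarrow> (\<forall>i j. simple_pair i j \<longrightarrow> c * lower_part b x $ i $ i < lower_part b x $ j $ j)"
    if "x \<in> OA" "c > 0" for x c
    using T_above_iff[OF that(2) n, of "?s x"] diagm_T_grp[OF lower_part_B[OF b that(1)]] by (simp add: diagm_nth)
  have high: "diagm (iwB (x ** adj b)) \<in> T_above 1" if x: "x \<in> OA" and s: "?s x \<in> T_above c1" for x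
  proof -
    have B: "iwB (x ** adj b) \<in> B_grp" by (rule iwasawa(2)[OF shift_OA[OF b x]])
    have "iwB (x ** adj b) $ i $ i < iwB (x ** adj b) $ j $ j" if sp: "simple_pair i j" for i j
    proof -
      have p: "iwB (x ** adj b) $ i $ i > 0" using B by (simp add: B_grp_def lowpos_def)
      have "iwB (x ** adj b) $ i $ i * b $ j $ j \<le> iwB (x ** adj b) $ i $ i * (q * b $ i $ i)"
        using p q by (intro mult_left_mono) auto
      also have "\<dots> = c1 * lower_part b x $ i $ i" by (simp add: diag[OF x] c1_def)
      also have "\<dots> < lower_part b x $ j $ j" using s s_above[OF x c(1)] sp by blast
      also have "\<dots> = iwB (x ** adj b) $ j $ j * b $ j $ j" by (rule diag[OF x])
      finally show ?thesis using bp[of j] by (simp add: mult_less_cancel_right)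
    qed
    then show ?thesis using T_above_iff[of 1 "diagm (iwB (x ** adj b))"] n diagm_T_grp[OF B] by (simp add: diagm_nth)
  qed
  define S where "S c = siegel N' c ((\<lambda>k. adj b ** k ** b) ` K')" for c
  have S: "x \<in> S c \<longleftrightarrow> x \<in> OA \<and> ?n x \<in> N' \<and> ?s x \<in> T_above c \<and> ?k x \<in> K'" for x c
    unfolding S_def by (rule siegel_iff[OF b N'(2) K'(2)])
  define U where "U = {x \<in> OA. ?n x \<in> VN \<and> ?s x \<in> T_above c1 \<and> ?k x \<in> VK}"
  have open_s: "openin (top_of_set OA) {x \<in> OA. ?s x \<in> T_above c}" if c: "c > 0" for c
  proof -
    let ?SP = "{(i, j). simple_pair i j} :: ('n \<times> 'n) set"
    let ?O = "\<Inter>(i, j)\<in>?SP. {t :: (real, 'n) sqmat. c * t $ i $ i < t $ j $ j}"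
    have "open ?O" by (intro open_INT) (auto intro!: open_Collect_less continuous_intros)
    then have "openin (top_of_set OA) (OA \<inter> lower_part b -` ?O)"
      by (rule continuous_openin_preimage_gen[OF continuous_on_lower_part[OF b]])
    moreover have "OA \<inter> lower_part b -` ?O = {x \<in> OA. ?s x \<in> T_above c}"
      using s_above[OF _ c] by auto
    ultimately show ?thesis by simp
  qed
  have closed_nk: "closed {x \<in> OA. ?n x \<in> N'}" "closed {x \<in> OA. ?k x \<in> K'}"
  proof -
    have "closed (OA \<inter> ?n -` N')" "closed (OA \<inter> ?k -` K')"
      by (intro continuous_closed_preimage contn continuous_on_compact_part[OF b] closed_OA compact_imp_closed N' K')+
    then show "closed {x \<in> OA. ?n x \<in> N'}" "closed {x \<in> OA. ?k x \<in> K'}" by (simp_all add: vimage_def Int_def)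
  qed
  have S_sets: "S c \<in> sets \<mu>" if c: "c > 0" for c
  proof -
    have "S c = {x \<in> OA. ?n x \<in> N'} \<inter> {x \<in> OA. ?s x \<in> T_above c} \<inter> {x \<in> OA. ?k x \<in> K'}" using S by auto
    then show ?thesis
      using haar_sets_closed[OF haar closed_nk(1)] haar_sets_closed[OF haar closed_nk(2)] haar_sets_openin[OF haar open_s[OF c]]
      by (auto intro!: sets.Int)
  qed
  have gen: "generalized_siegel_set K (S c)" if "c > 0" for c
  proof -
    have "(\<lambda>k. adj b ** k ** b) ` K' \<subseteq> K" unfolding K by (rule image_mono[OF K'(2)])
    then show ?thesis
      unfolding generalized_siegel_set_def
      by (intro exI[where x=N'] exI[where x=c] exI[where x="(\<lambda>k. adj b ** k ** b) ` K'"] conjI N'(1,2) that S_def)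
  qed
  show ?thesis
  proof (rule fundamental_domain_box_shaped[OF haar gen[OF c(1)] S_sets[OF c(1)] gen[OF c(2)] S_sets[OF c(2)]])
    have Tmono: "?s x \<in> T_above c2" if "x \<in> OA" "?s x \<in> T_above c1" for x
    proof -
      have "c2 * lower_part b x $ i $ i \<le> c1 * lower_part b x $ i $ i" for i
        using c(3) lower_part_B[OF b that(1)] by (intro mult_right_mono) (auto simp: B_grp_def lowpos_def less_imp_le)
      then show ?thesis using s_above[OF that(1) c(1)] s_above[OF that(1) c(2)] that(2) by (meson le_less_trans)
    qed
    show "S c1 \<subseteq> S c2"
    proof
      fix x assume "x \<in> S c1"
      then have "x \<in> OA \<and> ?n x \<in> N' \<and> ?s x \<in> T_above c1 \<and> ?k x \<in> K'" by (simp only: S)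
      then show "x \<in> S c2" using Tmono[of x] by (simp only: S)
    qed
    show "U \<subseteq> S c1" using S N'(3) K'(3) by (auto simp: U_def)
    show "openin (top_of_set OA) U"
    proof -
      have "U = (OA \<inter> ?n -` VN) \<inter> {x \<in> OA. ?s x \<in> T_above c1} \<inter> (OA \<inter> ?k -` VK)" by (auto simp: U_def)
      moreover have "openin (top_of_set OA) (OA \<inter> ?n -` VN)"
        by (rule continuous_openin_preimage[OF contn _ N'(4)]) (use npart_N[OF lower_part_B[OF b]] in auto)
      moreover have "openin (top_of_set OA) (OA \<inter> ?k -` VK)"
        by (rule continuous_openin_preimage[OF continuous_on_compact_part[OF b] _ K'(4)]) (use compact_part_K[OF b] in auto)
      ultimately show ?thesis using open_s[OF c(1)] by (auto intro!: openin_Int)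
    qed
    show "ZN \<union> ZK \<in> null_sets \<mu>" using N'(5) K'(5) by blast
    show "S c1 - U \<subseteq> ZN \<union> ZK" using S N'(6) K'(6) by (auto simp: U_def)
    show "d = mat 1" if d: "d \<in> OA" and x: "x \<in> U" and dx: "lmult d x \<in> U" for d x
    proof -
      have xO: "x \<in> OA" "lmult d x \<in> OA" using x dx by (auto simp: U_def)
      let ?y = "x ** adj b"
      have y: "?y \<in> OA" by (rule shift_OA[OF b xO(1)])
      have "diagm (iwB ?y) \<in> T_above 1" "diagm (iwB (lmult d ?y)) \<in> T_above 1"
        using high[OF xO(1)] high[OF xO(2)] x dx by (auto simp: U_def lmult_assoc)
      then have "\<And>i j. i < j \<Longrightarrow> \<not> near i j \<Longrightarrow> d $ i $ j = 0"
        by (rule siegel_triangular[OF n d y])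
      then obtain u w where uw: "u \<in> N_int" "w \<in> W_int" "d = u ** w"
        using near_block_decomposition[OF d] by blast
      have wx: "lmult w x \<in> OA" using uw(2) xO(1) WintO by (auto intro: lmult_OA)
      \<comment> \<open>\<open>u\<close> leaves the compact part alone, so \<open>w\<close> is
        detected there; only with \<open>w = mat 1\<close> does the part in \<open>N\<close> reveal
        \<open>u\<close>.\<close>
      have "?k (lmult d x) = lmult w (?k x)"
        by (simp add: uw(3) lmult_mult lower_part_N_int(2)[OF b uw(1) wx] compact_part_W_int[OF b uw(2) xO(1)])
      then have w1: "w = mat 1" using K'(8)[OF uw(2), of "?k x"] x dx by (auto simp: U_def)
      then have "?n (lmult d x) = lmult u (?n x)" using sN(1)[OF uw(1) xO(1)] uw(3) by simp
      then have "u = mat 1" using N'(8)[OF uw(1), of "?n x"] x dx by (auto simp: U_def)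
      then show ?thesis using uw(3) w1 by simp
    qed
    show "\<exists>d\<in>OA. lmult d x \<in> S c2" if x: "x \<in> OA" for x
    proof -
      let ?y = "x ** adj b"
      have y: "?y \<in> OA" by (rule shift_OA[OF b x])
      obtain g where g: "g \<in> OA" "\<And>i j. simple_pair i j \<Longrightarrow> iwB (lmult g ?y) $ i $ i / 2 < iwB (lmult g ?y) $ j $ j"
        by (rule reduction[OF n y], rule that)
      have gx: "lmult g x \<in> OA" by (rule lmult_OA[OF g(1) x])
      \<comment> \<open>\<open>w\<close> also changes the part in \<open>N\<close>, whereas
        \<open>u\<close> preserves those in \<open>T\<close> and \<open>K\<close>, so the compact
        part is adjusted before the unipotent one.\<close>
      obtain w where w: "w \<in> W_int" "lmult w (?k (lmult g x)) \<in> K'" using K'(7)[OF compact_part_K[OF b gx]] by blast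
      have wO: "w \<in> OA" using w WintO by blast
      have wgx: "lmult w (lmult g x) \<in> OA" by (rule lmult_OA[OF wO gx])
      obtain u where u: "u \<in> N_int" "lmult u (?n (lmult w (lmult g x))) \<in> N'"
        using N'(7)[OF npart_N[OF lower_part_B[OF b wgx]]] by blast
      define z where "z = lmult w (lmult g x)"
      have zy: "z ** adj b = lmult w (lmult g ?y)" by (simp add: z_def lmult_assoc)
      have gy: "lmult g ?y \<in> OA" by (rule lmult_OA[OF g(1) y])
      have zO: "z \<in> OA" using wgx by (simp add: z_def)
      have half: "1 / 2 * iwB (z ** adj b) $ i $ i < iwB (z ** adj b) $ j $ j" if "simple_pair i j" for i j
        unfolding zy iwasawa_W_int(1)[OF w(1) gy]
        by (rule W_int_conj_simple[OF w(1) iwasawa(2)[OF gy] _ that]) (use g(2) in simp)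
      have "?s z \<in> T_above c2"
        unfolding s_above[OF zO c(2)]
      proof (intro allI impI)
        fix i j :: 'n assume sp: "simple_pair i j"
        have p: "iwB (z ** adj b) $ i $ i > 0" using iwasawa(2)[OF shift_OA[OF b zO]] by (simp add: B_grp_def lowpos_def)
        have "c2 * lower_part b z $ i $ i = 1 / 2 * iwB (z ** adj b) $ i $ i * (b $ i $ i / q)"
          by (simp add: diag[OF zO] c2_def)
        also have "\<dots> \<le> 1 / 2 * iwB (z ** adj b) $ i $ i * b $ j $ j"
          using p q[of i j] q1 by (intro mult_left_mono) (auto simp: field_simps)
        also have "\<dots> < iwB (z ** adj b) $ j $ j * b $ j $ j"
          by (rule mult_strict_right_mono[OF half[OF sp] bp])
        also have "\<dots> = lower_part b z $ j $ j" by (simp add: diag[OF zO])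
        finally show "c2 * lower_part b z $ i $ i < lower_part b z $ j $ j" .
      qed
      moreover have "?k z \<in> K'" using w(2) by (simp add: z_def compact_part_W_int[OF b w(1) gx])
      ultimately have "lmult u z \<in> S c2"
        using u N_int_def lower_part_N_int(2)[OF b u(1) zO] sN[OF u(1) zO] zO NintO
        by (auto simp: S z_def[symmetric] intro!: lmult_OA)
      then have "lmult (u ** w ** g) x \<in> S c2" by (simp add: lmult_mult z_def)
      moreover have "u ** w ** g \<in> OA" using u(1) NintO wO g(1) by (intro OA_mult) auto
      ultimately show ?thesis by blast
    qed
    \<comment> \<open>The two sets share their tiles, and the bound \<open>c1\<close> on
      \<open>T\<close> removes the only difference.\<close>
    show "S c1 \<inter> siegel N_grp c1 K = S c2 \<inter> siegel N_grp c1 K"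
    proof -
      have "x \<in> siegel N_grp c1 K \<Longrightarrow> x \<in> OA \<and> ?s x \<in> T_above c1" for x
        unfolding K using siegel_iff[OF b subset_refl subset_refl] by blast
      then show ?thesis using S Tmono by blast
    qed
  qed (rule c(1))
qed

end
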